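(* Let $W$ be a Coxeter group of type $D_n$ with $n\ge 4$, with a fixed Coxeter element $c$, and let $\mathsf{Pop}_T=\mathsf{Pop}_T(\cdot,c)$. Then (1) $\mathsf{Pop}_T^{2n-3}(w)=e$ for all $w\in W$, and (2) $\max_{w\in W}|O_{\mathsf{Pop}_T}(w)|=2n-2$.
   Context: $W$ has set of simple reflections $S$, set of reflections $T=\{wsw^{-1}: s\in S,\ w\in W\}$, and Coxeter number $h$ (for $D_n$, $h=2n-2$). $\ell_T(w)$ is the minimum number of reflections whose product is $w$; the absolute order is $v\le_T w$ iff $\ell_T(wv^{-1})=\ell_T(w)-\ell_T(v)$. A Coxeter element is a regular element of $W$ (one with an eigenvector lying on no reflecting hyperplane) of order $h$. $\mathrm{NC}(W,c)$ is the interval $[e,c]$ in absolute order, a lattice with join $\bigvee$. The noncrossing projection is $\pi_T(w,c)=\bigvee_{t\in T,\ t\le_T w} t$ (join in $\mathrm{NC}(W,c)$, empty join $=e$), and $\mathsf{Pop}_T(w,c)=w\,\pi_T(w,c)^{-1}$. The forward orbit of $x$ under $f$ is $O_f(x)=\{x,f(x),f^2(x),\ldots\}$. *)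

theory Defs
  imports "HOL-Analysis.Analysis" "HOL-Algebra.Multiplicative_Group" "HOL-Algebra.Generated_Groups"
begin

definition reflections_of :: "('g, 'b) monoid_scheme \<Rightarrow> 'g set \<Rightarrow> 'g set" where
  "reflections_of W S =
     {w \<otimes>\<^bsub>W\<^esub> s \<otimes>\<^bsub>W\<^esub> inv\<^bsub>W\<^esub> w | s w. s \<in> S \<and> w \<in> carrier W}"

definition reflection_length :: "('g, 'b) monoid_scheme \<Rightarrow> 'g set \<Rightarrow> 'g \<Rightarrow> nat" where
  "reflection_length W T w =
     (LEAST k. \<exists>ts. set ts \<subseteq> T \<and> length ts = k \<and> foldr (\<otimes>\<^bsub>W\<^esub>) ts \<one>\<^bsub>W\<^esub> = w)"

definition absolute_le :: "('g, 'b) monoid_scheme \<Rightarrow> 'g set \<Rightarrow> 'g \<Rightarrow> 'g \<Rightarrow> bool" where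
  "absolute_le W T v w \<longleftrightarrow>
     int (reflection_length W T (w \<otimes>\<^bsub>W\<^esub> inv\<^bsub>W\<^esub> v))
       = int (reflection_length W T w) - int (reflection_length W T v)"

definition NC :: "('g, 'b) monoid_scheme \<Rightarrow> 'g set \<Rightarrow> 'g \<Rightarrow> 'g gorder" where
  "NC W T c =
     \<lparr>carrier = {w \<in> carrier W. absolute_le W T \<one>\<^bsub>W\<^esub> w \<and> absolute_le W T w c},
      eq = (=), le = absolute_le W T\<rparr>"

definition nc_projection :: "('g, 'b) monoid_scheme \<Rightarrow> 'g set \<Rightarrow> 'g \<Rightarrow> 'g \<Rightarrow> 'g" where
  "nc_projection W T c w = \<Squnion>\<^bsub>NC W T c\<^esub> {t \<in> T. absolute_le W T t w}"

definition Pop :: "('g, 'b) monoid_scheme \<Rightarrow> 'g set \<Rightarrow> 'g \<Rightarrow> 'g \<Rightarrow> 'g" where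
  "Pop W T c w = w \<otimes>\<^bsub>W\<^esub> inv\<^bsub>W\<^esub> (nc_projection W T c w)"

definition forward_orbit :: "('a \<Rightarrow> 'a) \<Rightarrow> 'a \<Rightarrow> 'a set" where
  "forward_orbit f x = range (\<lambda>k::nat. (f ^^ k) x)"

definition general_linear_group :: "('a::euclidean_space \<Rightarrow> 'a) monoid" where
  "general_linear_group = \<lparr>carrier = {f. linear f \<and> bij f}, monoid.mult = (\<circ>), one = id\<rparr>"

definition orthogonal_reflection :: "'a::euclidean_space \<Rightarrow> 'a \<Rightarrow> 'a" where
  "orthogonal_reflection a x = x - (2 * (x \<bullet> a) / (a \<bullet> a)) *\<^sub>R a"

text \<open>The Coxeter diagram of type D on the nodes 0, ..., n - 1: the path 0 -- 1 -- ... -- n - 2,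
  together with the edge joining n - 3 and n - 1.\<close>

definition D_edge :: "nat \<Rightarrow> nat \<Rightarrow> nat \<Rightarrow> bool" where
  "D_edge n i j \<longleftrightarrow> (i + 1 = j \<and> j + 1 < n) \<or> (i + 3 = n \<and> j + 1 = n)"

definition D_coxeter_matrix :: "nat \<Rightarrow> nat \<Rightarrow> nat \<Rightarrow> nat" where
  "D_coxeter_matrix n i j =
     (if i = j then 1 else if D_edge n i j \<or> D_edge n j i then 3 else 2)"

definition D_simple_roots :: "nat \<Rightarrow> (nat \<Rightarrow> 'a::euclidean_space) \<Rightarrow> bool" where
  "D_simple_roots n \<alpha> \<longleftrightarrow>
     span (\<alpha> ` {..<n}) = UNIV \<and>
     (\<forall>i<n. \<forall>j<n. \<alpha> i \<bullet> \<alpha> j = - cos (pi / real (D_coxeter_matrix n i j)))"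

definition simple_reflections :: "nat \<Rightarrow> (nat \<Rightarrow> 'a::euclidean_space) \<Rightarrow> ('a \<Rightarrow> 'a) set" where
  "simple_reflections n \<alpha> = (\<lambda>i. orthogonal_reflection (\<alpha> i)) ` {..<n}"

definition reflection_group :: "nat \<Rightarrow> (nat \<Rightarrow> 'a::euclidean_space) \<Rightarrow> ('a \<Rightarrow> 'a) monoid" where
  "reflection_group n \<alpha> =
     general_linear_group
       \<lparr>carrier := generate general_linear_group (simple_reflections n \<alpha>)\<rparr>"

definition reflections :: "nat \<Rightarrow> (nat \<Rightarrow> 'a::euclidean_space) \<Rightarrow> ('a \<Rightarrow> 'a) set" where
  "reflections n \<alpha> = reflections_of (reflection_group n \<alpha>) (simple_reflections n \<alpha>)"

text \<open>Eigenvectors live in the complexification of the space. The pair (x, y) stands for the complex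
  vector x + \<i> y, on which a real linear map w acts by w x + \<i> w y.\<close>

definition complex_eigenvector ::
    "('a::euclidean_space \<Rightarrow> 'a) \<Rightarrow> complex \<Rightarrow> 'a \<times> 'a \<Rightarrow> bool" where
  "complex_eigenvector w \<mu> = (\<lambda>(x, y).
     (x, y) \<noteq> (0, 0) \<and>
     w x = Re \<mu> *\<^sub>R x - Im \<mu> *\<^sub>R y \<and>
     w y = Im \<mu> *\<^sub>R x + Re \<mu> *\<^sub>R y)"

text \<open>The reflecting hyperplane of t is its fixed space; x + \<i> y lies on its complexification
  iff t fixes both x and y.\<close>

definition regular_element :: "('a::euclidean_space \<Rightarrow> 'a) set \<Rightarrow> ('a \<Rightarrow> 'a) \<Rightarrow> bool" where
  "regular_element T w \<longleftrightarrow>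
     (\<exists>\<mu> x y. complex_eigenvector w \<mu> (x, y) \<and> (\<forall>t\<in>T. \<not> (t x = x \<and> t y = y)))"

definition D_coxeter_number :: "nat \<Rightarrow> nat" where
  "D_coxeter_number n = 2 * n - 2"

definition D_coxeter_element :: "nat \<Rightarrow> (nat \<Rightarrow> 'a::euclidean_space) \<Rightarrow> ('a \<Rightarrow> 'a) \<Rightarrow> bool" where
  "D_coxeter_element n \<alpha> c \<longleftrightarrow>
     c \<in> carrier (reflection_group n \<alpha>) \<and>
     regular_element (reflections n \<alpha>) c \<and>
     group.ord (reflection_group n \<alpha>) c = D_coxeter_number n"

definition Pop\<^sub>T :: "nat \<Rightarrow> (nat \<Rightarrow> 'a::euclidean_space) \<Rightarrow> ('a \<Rightarrow> 'a) \<Rightarrow> ('a \<Rightarrow> 'a) \<Rightarrow> 'a \<Rightarrow> 'a" where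
  "Pop\<^sub>T n \<alpha> c = Pop (reflection_group n \<alpha>) (reflections n \<alpha>) c"

end

theory Submission
  imports Defs
begin

text \<open>
  In type D the group consists of even signed permutations of an orthonormal basis, the reflection
  length of \<open>w\<close> is the codimension of its fixed space, and a reflection lies below \<open>w\<close> iff its root
  is orthogonal to that fixed space. A regular element \<open>c\<close> of order \<open>2m\<close>, \<open>m = n - 1\<close>, arranges
  \<open>2m\<close> of the signed basis vectors on a circle, \<open>E i \<mapsto> E (i + 1)\<close> with \<open>E (i + m) = - E i\<close>, and
  exchanges the two remaining central vectors \<open>z\<close> and \<open>- z\<close>.

  For \<open>v\<close> below \<open>c\<close> the ranges of \<open>v - 1\<close> and \<open>c - v\<close> are complementary, so every \<open>f\<close> with
  \<open>(c - 1) f\<close> in the range of \<open>c - v\<close> is fixed by \<open>v\<close>. Since \<open>c - 1\<close> telescopes on sums of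
  consecutive circle vectors, this says that if \<open>v\<close> moves \<open>E i\<close> to \<open>E j\<close>, then the sum over the open
  arc between them is fixed by \<open>v\<close>. The element below \<open>c\<close> with fixed space inside that of \<open>w\<close> and of
  maximal dimension turns out to fix all arcs and half circles fixed by \<open>w\<close>, hence it is the join of
  the reflections below \<open>w\<close>.

  For the upper bound, follow the preimage of a circle point \<open>E j\<close> along the orbit. On the circle
  it moves towards \<open>E j\<close> at every step without overtaking it; it can enter the centre only at
  distance more than \<open>m\<close> and then leaves it at distance less than \<open>m\<close> one step later. If it starts
  in the centre, then it may flip between \<open>z\<close> and \<open>- z\<close> for a while, but the progress of the other
  circle points bounds this time. The lower bound comes from the orbit of \<open>c\<close> inverse, on which
  every projection equals \<open>c\<close>.
\<close>

section \<open>Fixed and moved spaces of isometries\<close>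

text \<open>Nothing about noncrossing partitions is presupposed, so the join in the projection has
  to be produced. The maximal choice of the fixed space supplies it for this reason: a candidate
  that fails to fix some arc fixed by \<open>w\<close> would displace a vector fixed by
  \<open>w\<close> along a root, and composing it with that reflection would enlarge its fixed
  space.

  The obstacle is the centre. Arcs do not see \<open>z\<close> and \<open>- z\<close>; what is known
  about them comes from parity, since an even signed permutation cannot send exactly one member of a
  choice of signs out of that choice.

  The exponent 2n - 3 = 2m - 1 is the largest distance that a preimage on the circle may have to
  travel at one position or more per step; for the inverse of \<open>c\<close> all circle points
  start at this distance and advance by exactly one.

  A Coxeter element is given only by regularity and its order, so the circle has to be found:
  pairing the signed basis vectors with the eigenvector separates them up to sign, and counting
  together with parity leaves a single cycle structure.\<close>

abbreviation finv :: "('a \<Rightarrow> 'b) \<Rightarrow> 'b \<Rightarrow> 'a" where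
  "finv \<equiv> Hilbert_Choice.inv"

definition fixspace :: "('a::euclidean_space \<Rightarrow> 'a) \<Rightarrow> 'a set" where
  "fixspace w = {x. w x = x}"

definition movspace :: "('a::euclidean_space \<Rightarrow> 'a) \<Rightarrow> 'a set" where
  "movspace w = range (\<lambda>x. w x - x)"

lemma fixspace_iff: "x \<in> fixspace w \<longleftrightarrow> w x = x"
  by (simp add: fixspace_def)

lemma subspace_fixspace: "linear w \<Longrightarrow> subspace (fixspace w)"
  by (auto simp: fixspace_def subspace_def linear_iff linear_0)

lemma subspace_movspace: "linear w \<Longrightarrow> subspace (movspace w)"
  unfolding movspace_def
  by (rule linear_subspace_image) (auto intro: linear_compose_sub linear_ident)

lemma movspace_orthogonal_fixspace:
  assumes "orthogonal_transformation w" "x \<in> movspace w" "y \<in> fixspace w"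
  shows "x \<bullet> y = 0"
proof -
  obtain u where "x = w u - u" using assms(2) by (auto simp: movspace_def)
  moreover have "w u \<bullet> y = u \<bullet> y"
    using assms by (metis fixspace_iff orthogonal_transformation_def)
  ultimately show ?thesis by (simp add: inner_diff_left)
qed

text \<open>If \<open>y\<close> is orthogonal to every \<open>w x - x\<close>, then
  \<open>w x \<bullet> y = x \<bullet> y = w x \<bullet> w y\<close>, and surjectivity turns
  \<open>w x\<close> into an arbitrary vector.\<close>

lemma fixspace_eq_orthogonal_movspace:
  assumes "orthogonal_transformation w"
  shows "fixspace w = {y. \<forall>x\<in>movspace w. orthogonal x y}"
proof (intro equalityI subsetI)
  fix y assume "y \<in> {y. \<forall>x\<in>movspace w. orthogonal x y}"
  then have "(w x - x) \<bullet> y = 0" for x by (auto simp: movspace_def orthogonal_def)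
  then have "w x \<bullet> w y = w x \<bullet> y" for x
    using assms by (simp add: inner_diff_left orthogonal_transformation_def)
  then have "u \<bullet> w y = u \<bullet> y" for u
    using orthogonal_transformation_surj[OF assms] by (metis surjD)
  then show "y \<in> fixspace w" using vector_eq_ldot[of "w y" y] by (simp add: fixspace_iff)
qed (use assms in \<open>auto simp: orthogonal_def movspace_orthogonal_fixspace\<close>)

lemma dim_fixspace_movspace:
  fixes w :: "'a::euclidean_space \<Rightarrow> 'a"
  assumes "orthogonal_transformation w"
  shows "dim (fixspace w) + dim (movspace w) = DIM('a)"
  using dim_subspace_orthogonal_to_vectors[of "movspace w" UNIV] assms
  by (simp add: fixspace_eq_orthogonal_movspace subspace_movspace orthogonal_transformation_linear)

text \<open>The range of \<open>w - 1\<close> lies in the orthogonal complement of the fixed space,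
  and the two have the same dimension.\<close>

lemma mem_movspace_iff:
  fixes w :: "'a::euclidean_space \<Rightarrow> 'a"
  assumes "orthogonal_transformation w"
  shows "x \<in> movspace w \<longleftrightarrow> (\<forall>y\<in>fixspace w. x \<bullet> y = 0)"
proof
  assume *: "\<forall>y\<in>fixspace w. x \<bullet> y = 0"
  let ?P = "{x. \<forall>y\<in>fixspace w. orthogonal y x}"
  have lin: "linear w" using assms orthogonal_transformation_linear by blast
  have "dim ?P + dim (fixspace w) = DIM('a)"
    using dim_subspace_orthogonal_to_vectors[of "fixspace w" UNIV] lin
    by (simp add: subspace_fixspace)
  then have "dim ?P = dim (movspace w)" using dim_fixspace_movspace[OF assms] by linarith
  moreover have "movspace w \<subseteq> ?P"
    using movspace_orthogonal_fixspace[OF assms] by (auto simp: orthogonal_def inner_commute)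
  moreover have "subspace ?P"
    by (simp add: subspace_orthogonal_to_vectors)
  ultimately have "movspace w = ?P"
    using subspace_dim_equal[of "movspace w" ?P] subspace_movspace[OF lin] by simp
  moreover have "x \<in> ?P" using * by (auto simp: orthogonal_def inner_commute)
  ultimately show "x \<in> movspace w" by simp
qed (use assms movspace_orthogonal_fixspace in blast)

lemma movspace_subset_iff:
  fixes v w :: "'a::euclidean_space \<Rightarrow> 'a"
  assumes "orthogonal_transformation v" "orthogonal_transformation w"
  shows "movspace w \<subseteq> movspace v \<longleftrightarrow> fixspace v \<subseteq> fixspace w"
proof
  assume "movspace w \<subseteq> movspace v"
  then show "fixspace v \<subseteq> fixspace w"
    using assms by (auto simp: fixspace_eq_orthogonal_movspace)
next
  assume "fixspace v \<subseteq> fixspace w"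
  then show "movspace w \<subseteq> movspace v"
    using assms mem_movspace_iff by (metis subsetD subsetI)
qed

text \<open>Subadditivity of codimension, from
  \<open>v (w x) - x = (v (w x) - w x) + (w x - x)\<close>.\<close>

lemma dim_movspace_comp_le:
  fixes v w :: "'a::euclidean_space \<Rightarrow> 'a"
  assumes "linear v" "linear w"
  shows "dim (movspace (v \<circ> w)) \<le> dim (movspace v) + dim (movspace w)"
proof -
  let ?S = "{x + y |x y. x \<in> movspace v \<and> y \<in> movspace w}"
  have "v (w x) - x = (v (w x) - w x) + (w x - x)" for x by simp
  then have "movspace (v \<circ> w) \<subseteq> ?S"
    unfolding movspace_def by (smt (verit) comp_apply image_subset_iff mem_Collect_eq rangeI)
  then have "dim (movspace (v \<circ> w)) \<le> dim ?S" by (rule dim_subset)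
  then show ?thesis
    using dim_sums_Int[of "movspace v" "movspace w"] assms subspace_movspace by fastforce
qed

section \<open>Reflections and their effect on the codimension of the fixed space\<close>

lemma orthogonal_reflection_linear: "linear (orthogonal_reflection a)"
  unfolding orthogonal_reflection_def
  by (rule linearI) (simp_all add: inner_add_left algebra_simps add_divide_distrib flip: scaleR_add_left)

lemma orthogonal_transformation_reflection:
  "orthogonal_transformation (orthogonal_reflection (a::'a::euclidean_space))"
proof (cases "a = 0")
  case False
  show ?thesis unfolding orthogonal_transformation_def
  proof (intro conjI allI orthogonal_reflection_linear)
    fix v w :: 'a
    have "a \<bullet> a \<noteq> 0" using False by simp
    then show "orthogonal_reflection a v \<bullet> orthogonal_reflection a w = v \<bullet> w"
      unfolding orthogonal_reflection_def
      by (simp add: inner_diff_left inner_diff_right inner_commute field_simps)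
  qed
qed (simp add: orthogonal_reflection_def[abs_def])

lemma orthogonal_reflection_fixes_iff:
  "a \<noteq> 0 \<Longrightarrow> orthogonal_reflection a x = x \<longleftrightarrow> x \<bullet> a = 0"
  by (auto simp: orthogonal_reflection_def)

lemma orthogonal_reflection_involution: "orthogonal_reflection a (orthogonal_reflection a x) = x"
  by (cases "a = 0") (auto simp: orthogonal_reflection_def inner_diff_left algebra_simps)

lemma finv_orthogonal_reflection: "finv (orthogonal_reflection a) = orthogonal_reflection a"
  by (rule inv_unique_comp) (auto simp: fun_eq_iff orthogonal_reflection_involution)

lemma orthogonal_reflection_scaleR:
  "k \<noteq> 0 \<Longrightarrow> orthogonal_reflection (k *\<^sub>R a) = orthogonal_reflection a"
  by (auto simp: orthogonal_reflection_def fun_eq_iff)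

lemma orthogonal_reflection_conj:
  assumes "orthogonal_transformation w"
  shows "w (orthogonal_reflection a x) = orthogonal_reflection (w a) (w x)"
  using assms unfolding orthogonal_reflection_def orthogonal_transformation_def
  by (simp add: linear_diff linear_scale)

lemma dim_movspace_reflection:
  fixes a :: "'a::euclidean_space"
  assumes "a \<noteq> 0"
  shows "dim (movspace (orthogonal_reflection a)) = 1"
proof -
  have "movspace (orthogonal_reflection a) \<subseteq> span {a}"
    by (auto simp: movspace_def orthogonal_reflection_def span_scale span_base span_neg)
  then have "dim (movspace (orthogonal_reflection a)) \<le> 1"
    by (metis dim_le_card' dim_span card.empty card.insert empty_iff finite.emptyI finite.insertI le_trans
        dim_subset One_nat_def dim_le_card')
  moreover have "orthogonal_reflection a a - a \<in> movspace (orthogonal_reflection a)"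
    by (auto simp: movspace_def)
  then have "- 2 *\<^sub>R a \<in> movspace (orthogonal_reflection a)"
    using assms by (simp add: orthogonal_reflection_def)
  then have "dim (movspace (orthogonal_reflection a)) \<noteq> 0"
    using assms by (auto simp: dim_eq_0)
  ultimately show ?thesis by linarith
qed

text \<open>Since \<open>w\<close> is an isometry, \<open>u\<close> and \<open>w u\<close> are exchanged by the reflection along \<open>w u - u\<close>.\<close>

lemma orthogonal_reflection_comp_fixes:
  assumes "orthogonal_transformation w" "k \<noteq> 0" "w u - u = k *\<^sub>R a"
  shows "orthogonal_reflection a (w u) = u"
proof (cases "a = 0")
  case True
  then show ?thesis using assms(3) by (simp add: orthogonal_reflection_def)
next
  case False
  define b where "b = w u - u"
  have "w u \<bullet> w u = u \<bullet> u" using assms(1) by (simp add: orthogonal_transformation_def)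
  then have "2 * (w u \<bullet> b) = b \<bullet> b"
    by (simp add: b_def inner_diff_left inner_diff_right inner_commute)
  moreover have "b \<bullet> b \<noteq> 0" using False assms b_def by simp
  ultimately have "orthogonal_reflection b (w u) = u"
    by (simp add: orthogonal_reflection_def) (simp add: b_def)
  then show ?thesis using assms b_def orthogonal_reflection_scaleR[of k a] by auto
qed

lemma fixspace_subset_fixspace_reflection_comp:
  assumes "orthogonal_transformation w" "a \<in> movspace w"
  shows "fixspace w \<subseteq> fixspace (orthogonal_reflection a \<circ> w)"
proof
  fix x assume x: "x \<in> fixspace w"
  then have "a \<bullet> x = 0" using assms movspace_orthogonal_fixspace by blast
  then show "x \<in> fixspace (orthogonal_reflection a \<circ> w)"
    using x by (simp add: fixspace_iff orthogonal_reflection_def inner_commute)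
qed

text \<open>A preimage \<open>u\<close> of \<open>a\<close> under \<open>w - 1\<close> becomes
  fixed, so the fixed space grows. Reflecting once more returns to \<open>w\<close>, so by
  subadditivity it grows by one dimension only.\<close>

lemma dim_movspace_reflection_comp:
  fixes w :: "'a::euclidean_space \<Rightarrow> 'a"
  assumes "orthogonal_transformation w" "a \<in> movspace w" "a \<noteq> 0"
  shows "dim (movspace (orthogonal_reflection a \<circ> w)) + 1 = dim (movspace w)"
proof -
  let ?s = "orthogonal_reflection a"
  have os: "orthogonal_transformation ?s" by (rule orthogonal_transformation_reflection)
  have osw: "orthogonal_transformation (?s \<circ> w)"
    using os assms(1) by (rule orthogonal_transformation_compose)
  obtain u where u: "a = w u - u" using assms(2) by (auto simp: movspace_def)
  have "?s (w u) = u"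
    using orthogonal_reflection_comp_fixes[of w 1 u a] assms(1) u by simp
  then have "u \<in> fixspace (?s \<circ> w)" "u \<notin> fixspace w"
    using u assms(3) by (auto simp: fixspace_iff)
  then have "fixspace w \<subset> fixspace (?s \<circ> w)"
    using fixspace_subset_fixspace_reflection_comp[OF assms(1,2)] by blast
  then have "dim (fixspace w) < dim (fixspace (?s \<circ> w))"
    using subspace_fixspace assms(1) osw orthogonal_transformation_linear
    by (metis dim_psubset span_eq_iff)
  moreover have "?s \<circ> (?s \<circ> w) = w"
    by (simp add: fun_eq_iff orthogonal_reflection_involution)
  then have "dim (movspace w) \<le> 1 + dim (movspace (?s \<circ> w))"
    using dim_movspace_comp_le[of ?s "?s \<circ> w"] os osw orthogonal_transformation_linear
      dim_movspace_reflection[OF assms(3)] by metis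
  ultimately show ?thesis
    using dim_fixspace_movspace[OF assms(1)] dim_fixspace_movspace[OF osw] by linarith
qed

text \<open>The absolute order divides on the right, so the reflection stands there. For one
  direction, \<open>movspace w\<close> lies in the sum of the smaller space and the line of
  \<open>a\<close>, and dimensions force equality. For the other, the reflection along
  \<open>a\<close> passes to the left of \<open>w\<close> as the reflection along
  \<open>w a\<close>, which again lies in \<open>movspace w\<close>.\<close>

lemma dim_movspace_comp_reflection_iff:
  fixes w :: "'a::euclidean_space \<Rightarrow> 'a"
  assumes "orthogonal_transformation w" "a \<noteq> 0"
  shows "dim (movspace (w \<circ> orthogonal_reflection a)) + 1 = dim (movspace w) \<longleftrightarrow> a \<in> movspace w"
proof
  let ?s = "orthogonal_reflection a"
  have os: "orthogonal_transformation ?s" by (rule orthogonal_transformation_reflection)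
  assume *: "dim (movspace (w \<circ> ?s)) + 1 = dim (movspace w)"
  let ?S = "{x + y |x y. x \<in> movspace (w \<circ> ?s) \<and> y \<in> span {a}}"
  have ows: "orthogonal_transformation (w \<circ> ?s)"
    using os assms(1) orthogonal_transformation_compose by blast
  have sub: "movspace w \<subseteq> ?S"
  proof
    fix y assume "y \<in> movspace w"
    then obtain x where "y = w x - x" by (auto simp: movspace_def)
    then have "y = ((w \<circ> ?s) (?s x) - ?s x) + (- (2 * (x \<bullet> a) / (a \<bullet> a))) *\<^sub>R a"
      by (simp add: orthogonal_reflection_involution) (simp add: orthogonal_reflection_def)
    moreover have "(- (2 * (x \<bullet> a) / (a \<bullet> a))) *\<^sub>R a \<in> span {a}"
      by (rule span_scale) (simp add: span_base)
    moreover have "(w \<circ> ?s) (?s x) - ?s x \<in> movspace (w \<circ> ?s)" unfolding movspace_def by blast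
    ultimately show "y \<in> ?S" by blast
  qed
  have sp: "subspace ?S"
    using subspace_sums[of "movspace (w \<circ> ?s)" "span {a}"] ows
    by (simp add: subspace_movspace orthogonal_transformation_linear)
  have "dim ?S \<le> dim (movspace (w \<circ> ?s)) + dim (span {a})"
    using dim_sums_Int[of "movspace (w \<circ> ?s)" "span {a}"] ows subspace_movspace
      orthogonal_transformation_linear by fastforce
  also have "\<dots> \<le> dim (movspace w)"
    using * dim_le_card'[of "{a}"] by simp
  finally have "movspace w = ?S"
    using sub sp assms(1) subspace_movspace orthogonal_transformation_linear
    by (intro subspace_dim_equal) auto
  moreover have "0 \<in> movspace (w \<circ> ?s)" "a \<in> span {a}"
    using subspace_0[OF subspace_movspace[OF orthogonal_transformation_linear[OF ows]]]
    by (auto simp: span_base)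
  then have "0 + a \<in> ?S" by blast
  ultimately show "a \<in> movspace w" by simp
next
  assume a: "a \<in> movspace w"
  have lin: "linear w" using assms(1) orthogonal_transformation_linear by blast
  obtain u where u: "a = w u - u" using a by (auto simp: movspace_def)
  then have "w a = w (w u) - w u" using lin by (simp add: linear_diff)
  then have "w a \<in> movspace w" by (auto simp: movspace_def)
  moreover have "w a \<noteq> 0"
    using assms by (metis norm_eq_zero orthogonal_transformation_norm)
  moreover have "w \<circ> orthogonal_reflection a = orthogonal_reflection (w a) \<circ> w"
    using orthogonal_reflection_conj[OF assms(1)] by (auto simp: fun_eq_iff)
  ultimately show "dim (movspace (w \<circ> orthogonal_reflection a)) + 1 = dim (movspace w)"
    using dim_movspace_reflection_comp[OF assms(1)] by simp
qed

section \<open>Elements below a fixed-point-free isometry\<close>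

lemma movspace_eq_UNIV:
  fixes w :: "'a::euclidean_space \<Rightarrow> 'a"
  assumes "orthogonal_transformation w" "fixspace w = {0}"
  shows "movspace w = UNIV"
proof -
  have "x \<in> movspace w" for x
    using mem_movspace_iff[OF assms(1), of x] assms(2) by simp
  then show ?thesis by blast
qed

lemma movspace_comp_finv:
  fixes v :: "'a::euclidean_space \<Rightarrow> 'a"
  assumes "bij v"
  shows "movspace (c \<circ> finv v) = range (\<lambda>x. c x - v x)"
proof -
  have "range (\<lambda>x. c x - v x) = (\<lambda>y. c (finv v y) - y) ` range v"
    using assms by (simp add: image_image bij_is_inj)
  then show ?thesis using assms by (simp add: movspace_def bij_is_surj)
qed

text \<open>For fixed-point-free \<open>c\<close> the dimension of the space is the codimension of
  \<open>c\<close>, so this is \<open>v\<close> below \<open>c\<close> in absolute order, phrased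
  without a group or a reflection length.\<close>

definition divides_coxeter :: "('a::euclidean_space \<Rightarrow> 'a) \<Rightarrow> ('a \<Rightarrow> 'a) \<Rightarrow> bool" where
  "divides_coxeter c v \<longleftrightarrow>
     orthogonal_transformation v \<and> dim (movspace v) + dim (movspace (c \<circ> finv v)) = DIM('a)"

locale fixed_point_free =
  fixes c :: "'a::euclidean_space \<Rightarrow> 'a"
  assumes orth_c: "orthogonal_transformation c" and fix_c: "fixspace c = {0}"
begin

lemma inj_c_minus_1: "c x - x = c y - y \<Longrightarrow> x = y"
proof -
  assume "c x - x = c y - y"
  then have "c (x - y) = x - y"
    using orth_c by (simp add: orthogonal_transformation_linear linear_diff algebra_simps)
  then have "x - y \<in> fixspace c" by (simp add: fixspace_iff)
  then show ?thesis using fix_c by simp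
qed

lemma surj_c_minus_1: "\<exists>x. c x - x = y"
proof -
  have "y \<in> movspace c" using movspace_eq_UNIV[OF orth_c fix_c] by simp
  then show ?thesis unfolding movspace_def by (elim imageE) (auto intro: exI)
qed

text \<open>If \<open>v\<close> lies below \<open>c\<close>, the ranges of \<open>c - v\<close> and of \<open>v - 1\<close> are complementary,
  because they sum to the range of \<open>c - 1\<close>, which is everything.\<close>

lemma divides_coxeter_fixes:
  assumes "divides_coxeter c v" "c f - f = c x - v x"
  shows "v f = f"
proof -
  have ov: "orthogonal_transformation v" using assms(1) by (simp add: divides_coxeter_def)
  have oi: "orthogonal_transformation (c \<circ> finv v)"
    using orth_c ov by (intro orthogonal_transformation_compose orthogonal_transformation_inv)
  let ?A = "movspace v" and ?B = "movspace (c \<circ> finv v)"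
  have B: "?B = range (\<lambda>x. c x - v x)"
    by (rule movspace_comp_finv) (simp add: ov orthogonal_transformation_bij)
  have sub: "subspace ?A" "subspace ?B"
    using ov oi by (auto intro: subspace_movspace orthogonal_transformation_linear)
  have "y \<in> {x + y |x y. x \<in> ?A \<and> y \<in> ?B}" for y
  proof -
    obtain x where "c x - x = y" using surj_c_minus_1 by blast
    then have "y = (v x - x) + (c x - v x)" by simp
    moreover have "v x - x \<in> ?A" by (simp add: movspace_def)
    moreover have "c x - v x \<in> ?B" by (simp add: B)
    ultimately show ?thesis by blast
  qed
  then have "{x + y |x y. x \<in> ?A \<and> y \<in> ?B} = UNIV" by blast
  then have "dim (?A \<inter> ?B) = 0"
    using dim_sums_Int[OF sub] assms(1) by (simp add: divides_coxeter_def)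
  then have int: "?A \<inter> ?B \<subseteq> {0}" by simp
  have lin: "linear c" "linear v" using orth_c ov orthogonal_transformation_linear by auto
  have "v f - f = c (x - f) - v (x - f)"
    using assms(2) lin by (simp add: linear_diff algebra_simps)
  then have "v f - f \<in> ?B" unfolding B by (rule range_eqI)
  moreover have "v f - f \<in> ?A" by (simp add: movspace_def)
  ultimately have "v f - f \<in> ?A \<inter> ?B" by blast
  then show ?thesis using int by auto
qed

text \<open>A fixed \<open>f\<close> satisfies \<open>c f - f = c f - v f\<close>; the converse is
  complementarity. For group elements the space on the right is spanned by roots, so the fixed space
  can be examined root by root.\<close>

lemma divides_coxeter_fixspace:
  assumes "divides_coxeter c v"
  shows "fixspace v = {f. c f - f \<in> movspace (c \<circ> finv v)}"
proof -
  have "bij v" using assms by (simp add: divides_coxeter_def orthogonal_transformation_bij)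
  then show ?thesis
    using divides_coxeter_fixes[OF assms] movspace_comp_finv[of v c]
    by (auto simp: fixspace_iff) (metis rangeI)
qed

text \<open>Write \<open>c y - y = v u - u\<close> and choose \<open>f\<close> with
  \<open>c f - f = c u - v u\<close>. Then \<open>v\<close> fixes \<open>f\<close>, and injectivity
  of \<open>c - 1\<close> gives \<open>y = u - f\<close>.\<close>

lemma divides_coxeter_movspace:
  assumes "divides_coxeter c v" "c y - y \<in> movspace v"
  shows "v y - y = c y - y"
proof -
  obtain u where u: "c y - y = v u - u" using assms(2) by (auto simp: movspace_def)
  obtain f where f: "c f - f = c u - v u" using surj_c_minus_1 by blast
  have lin: "linear c" "linear v"
    using orth_c assms(1) orthogonal_transformation_linear by (auto simp: divides_coxeter_def)
  have "v f = f" using divides_coxeter_fixes[OF assms(1) f] .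
  moreover have "y = u - f"
  proof (rule inj_c_minus_1)
    have "c (u - f) - (u - f) = (c u - u) - (c f - f)" using lin(1) by (simp add: linear_diff)
    also have "\<dots> = v u - u" unfolding f by simp
    finally show "c y - y = c (u - f) - (u - f)" unfolding u by (rule sym)
  qed
  ultimately have "v y - y = v u - u" using lin(2) by (simp add: linear_diff)
  then show ?thesis using u by (rule trans[OF _ sym])
qed

text \<open>\<open>v\<close> and \<open>v0\<close> agree on \<open>fixspace v\<close> and on
  \<open>M\<close>, where both coincide with \<open>c\<close>. These spaces meet only in 0 because
  \<open>c\<close> has no fixed points, so \<open>K\<close> is large, and \<open>v0\<close> carries
  \<open>K\<close> onto the fixed space of \<open>v \<circ> finv v0\<close>. Subadditivity is the
  reverse bound. Thus inclusion of fixed spaces decides the order below \<open>c\<close>.\<close>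

lemma divides_coxeter_mono:
  assumes v0: "divides_coxeter c v0" and v: "divides_coxeter c v" and sub: "fixspace v \<subseteq> fixspace v0"
  shows "dim (movspace (v \<circ> finv v0)) + dim (movspace v0) = dim (movspace v)"
proof -
  have o: "orthogonal_transformation v0" "orthogonal_transformation v"
    using v0 v by (auto simp: divides_coxeter_def)
  have oi: "orthogonal_transformation (v \<circ> finv v0)"
    using o by (intro orthogonal_transformation_compose orthogonal_transformation_inv)
  have lin: "linear c" "linear v" "linear v0" using orth_c o orthogonal_transformation_linear by auto
  have bij: "bij v0" using o by (simp add: orthogonal_transformation_bij)
  define K where "K = {x. v x = v0 x}"
  define M where "M = {y. c y - y \<in> movspace v0}"
  have linc: "linear (\<lambda>y. c y - y)" using lin by (intro linear_compose_sub linear_ident)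
  have injc: "inj (\<lambda>y. c y - y)" by (auto intro: injI inj_c_minus_1)
  have M: "(\<lambda>y. c y - y) ` M = movspace v0"
    using surj_c_minus_1 unfolding M_def by (auto simp: image_iff) metis
  then have dM: "dim M = dim (movspace v0)"
    using dim_image_eq[OF linc, of M] injc by (metis inj_on_subset subset_UNIV)
  have "subspace M"
    using linear_subspace_vimage[OF linc subspace_movspace[OF lin(3)]]
    by (simp add: M_def vimage_def)
  have "movspace v0 \<subseteq> movspace v" using movspace_subset_iff o sub by blast
  then have "v y = c y" "v0 y = c y" if "y \<in> M" for y
    using that divides_coxeter_movspace[OF v] divides_coxeter_movspace[OF v0]
    unfolding M_def by force+
  then have "M \<subseteq> K" "M \<inter> fixspace v \<subseteq> {0}"
    using fix_c by (auto simp: K_def fixspace_iff)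
  moreover have "fixspace v \<subseteq> K" using sub by (auto simp: K_def fixspace_iff)
  moreover have "subspace K"
    using lin by (auto simp: K_def subspace_def linear_add linear_scale linear_0)
  ultimately have "{x + y |x y. x \<in> M \<and> y \<in> fixspace v} \<subseteq> K" and "dim (M \<inter> fixspace v) = 0"
    by (auto simp: subset_iff intro: subspace_add)
  then have "dim M + dim (fixspace v) \<le> dim K"
    using dim_sums_Int[OF \<open>subspace M\<close> subspace_fixspace[OF lin(2)]]
      dim_subset[of "{x + y |x y. x \<in> M \<and> y \<in> fixspace v}" K] by linarith
  moreover have "v0 ` K = fixspace (v \<circ> finv v0)"
    using bij unfolding K_def fixspace_def
    by (auto simp: image_iff bij_is_inj) (metis bij_inv_eq_iff)
  then have "dim K = dim (fixspace (v \<circ> finv v0))"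
    using dim_image_eq[OF lin(3), of K] bij by (metis bij_is_inj inj_on_subset subset_UNIV)
  moreover have "v = (v \<circ> finv v0) \<circ> v0" using bij by (auto simp: fun_eq_iff bij_is_inj)
  then have "dim (movspace v) \<le> dim (movspace (v \<circ> finv v0)) + dim (movspace v0)"
    using dim_movspace_comp_le[of "v \<circ> finv v0" v0] oi lin orthogonal_transformation_linear by metis
  ultimately show ?thesis
    using dM dim_fixspace_movspace[OF oi] dim_fixspace_movspace[OF o(2)] by linarith
qed

text \<open>The codimension of \<open>v\<close> drops by one and that of its cofactor in
  \<open>c\<close> rises by at most one; subadditivity forbids their sum to fall below that of
  \<open>c\<close>.\<close>

lemma divides_coxeter_reflection_comp:
  assumes v: "divides_coxeter c v" and a: "a \<in> movspace v" "a \<noteq> 0"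
  shows "divides_coxeter c (orthogonal_reflection a \<circ> v)"
proof -
  let ?s = "orthogonal_reflection a"
  have ov: "orthogonal_transformation v" using v by (simp add: divides_coxeter_def)
  have os: "orthogonal_transformation ?s" by (rule orthogonal_transformation_reflection)
  have osv: "orthogonal_transformation (?s \<circ> v)"
    using os ov by (rule orthogonal_transformation_compose)
  have oi: "orthogonal_transformation (c \<circ> finv w)" if "orthogonal_transformation w" for w :: "'a \<Rightarrow> 'a"
    using that orth_c by (intro orthogonal_transformation_compose orthogonal_transformation_inv)
  have l: "linear ?s" "linear (?s \<circ> v)" "linear (c \<circ> finv (?s \<circ> v))" "linear (c \<circ> finv v)"
    using os osv oi ov orthogonal_transformation_linear by auto
  have eq: "finv (?s \<circ> v) = finv v \<circ> ?s"
    using o_inv_distrib[of ?s v] os ov orthogonal_transformation_bij finv_orthogonal_reflection by metis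
  have "dim (movspace ((c \<circ> finv v) \<circ> ?s)) \<le> dim (movspace (c \<circ> finv v)) + 1"
    using dim_movspace_comp_le[of "c \<circ> finv v" ?s] l dim_movspace_reflection[OF a(2)] by simp
  then have "dim (movspace (c \<circ> finv (?s \<circ> v))) \<le> dim (movspace (c \<circ> finv v)) + 1"
    by (simp add: eq o_assoc)
  moreover have "dim (movspace (?s \<circ> v)) + 1 = dim (movspace v)"
    using dim_movspace_reflection_comp[OF ov a] .
  moreover have "c = (c \<circ> finv (?s \<circ> v)) \<circ> (?s \<circ> v)"
    using orthogonal_transformation_bij[OF osv] by (auto simp: fun_eq_iff bij_is_inj simp del: o_apply)
  then have "dim (movspace c) \<le> dim (movspace (c \<circ> finv (?s \<circ> v))) + dim (movspace (?s \<circ> v))"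
    using dim_movspace_comp_le[of "c \<circ> finv (?s \<circ> v)" "?s \<circ> v"] l by metis
  moreover have "dim (movspace c) = DIM('a)"
    using movspace_eq_UNIV[OF orth_c fix_c] by simp
  ultimately show ?thesis
    using v osv by (auto simp: divides_coxeter_def)
qed

end

section \<open>Absolute order on groups of even signed permutations\<close>

locale signed_basis =
  fixes X :: "'a::euclidean_space set"
  assumes finite_X: "finite X"
    and neg_X: "a \<in> X \<Longrightarrow> - a \<in> X"
    and unit_X: "a \<in> X \<Longrightarrow> a \<bullet> a = 1"
    and orth_X: "a \<in> X \<Longrightarrow> b \<in> X \<Longrightarrow> b \<noteq> a \<Longrightarrow> b \<noteq> - a \<Longrightarrow> a \<bullet> b = 0"
    and span_X: "span X = UNIV"
begin

text \<open>As \<open>X\<close> is closed under negation, \<open>a - b\<close> covers all four sign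
  patterns on two distinct axes.\<close>

definition roots :: "'a set" where
  "roots = {a - b | a b. a \<in> X \<and> b \<in> X \<and> b \<noteq> a \<and> b \<noteq> - a}"

text \<open>A choice of one vector from each pair \<open>a\<close>, \<open>- a\<close>. The elements
  of \<open>H\<close> that a signed permutation sends out of \<open>H\<close> are its sign changes
  relative to this choice.\<close>

definition half_system :: "'a set \<Rightarrow> bool" where
  "half_system H \<longleftrightarrow> H \<subseteq> X \<and> (\<forall>a\<in>X. a \<in> H \<longleftrightarrow> - a \<notin> H)"

definition consistent :: "'a set \<Rightarrow> bool" where
  "consistent A \<longleftrightarrow> A \<subseteq> X \<and> (\<forall>a\<in>A. - a \<notin> A)"

lemma half_system_consistent: "half_system H \<Longrightarrow> consistent H"
  by (auto simp: half_system_def consistent_def)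

lemma X_nonzero: "a \<in> X \<Longrightarrow> a \<noteq> 0" "a \<in> X \<Longrightarrow> - a \<noteq> a" "a \<in> X \<Longrightarrow> a \<noteq> - a"
  using unit_X by (force simp: eq_neg_iff_add_eq_0 neg_eq_iff_add_eq_0 simp flip: scaleR_2)+

lemma inner_X:
  assumes "a \<in> X" "b \<in> X"
  shows "a \<bullet> b = (if b = a then 1 else if b = - a then -1 else 0)"
  using assms unit_X orth_X by auto

lemma inner_sum_X:
  assumes "consistent A" "a \<in> X"
  shows "a \<bullet> \<Sum>A = (if a \<in> A then 1 else if - a \<in> A then -1 else 0)"
proof -
  have A: "finite A" "A \<subseteq> X" using assms(1) finite_X finite_subset by (auto simp: consistent_def)
  have "a \<bullet> \<Sum>A = (\<Sum>b\<in>A. a \<bullet> b)" by (simp add: inner_sum_right)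
  also have "\<dots> = (\<Sum>b\<in>A. (if b = a then 1 else 0) - (if b = - a then 1 else 0))"
    using A assms(2) X_nonzero by (intro sum.cong) (auto simp: inner_X subset_iff)
  also have "\<dots> = (if a \<in> A then 1 else 0) - (if - a \<in> A then 1 else 0)"
    using A by (simp add: sum_subtractf)
  finally show ?thesis using assms(1) by (auto simp: consistent_def)
qed

lemma roots_nonzero: "b \<in> roots \<Longrightarrow> b \<noteq> 0"
  by (auto simp: roots_def)

lemma rootI: "a \<in> X \<Longrightarrow> b \<in> X \<Longrightarrow> b \<noteq> a \<Longrightarrow> b \<noteq> - a \<Longrightarrow> a - b \<in> roots"
  by (auto simp: roots_def)

lemma linear_eq_on_X:
  assumes "linear f" "linear g" "\<And>a. a \<in> X \<Longrightarrow> f a = g a"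
  shows "f = g"
  using linear_eq_on_span[of f g X] assms span_X by (auto simp: fun_eq_iff)

end

text \<open>\<open>W_even\<close> separates type D from type B: it rules out the change of a single
  sign, which has codimension one without being a reflection along a root.\<close>

locale D_group = signed_basis X for X :: "'a::euclidean_space set" +
  fixes W :: "('a \<Rightarrow> 'a) set"
  assumes W_id: "id \<in> W"
    and W_comp: "v \<in> W \<Longrightarrow> w \<in> W \<Longrightarrow> v \<circ> w \<in> W"
    and W_inv: "w \<in> W \<Longrightarrow> finv w \<in> W"
    and W_orth: "w \<in> W \<Longrightarrow> orthogonal_transformation w"
    and W_X: "w \<in> W \<Longrightarrow> a \<in> X \<Longrightarrow> w a \<in> X"
    and W_refl: "b \<in> roots \<Longrightarrow> orthogonal_reflection b \<in> W"
    and W_even: "w \<in> W \<Longrightarrow> half_system H \<Longrightarrow> even (card {h \<in> H. w h \<notin> H})"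
    and ex_half_system: "\<exists>H. half_system H"
begin

definition G :: "('a \<Rightarrow> 'a) monoid" where
  "G = \<lparr>carrier = W, monoid.mult = (\<circ>), one = id\<rparr>"

definition T :: "('a \<Rightarrow> 'a) set" where
  "T = orthogonal_reflection ` roots"

lemma mult_G: "v \<otimes>\<^bsub>G\<^esub> w = v \<circ> w" and one_G: "\<one>\<^bsub>G\<^esub> = id"
    and carrier_G: "carrier G = W"
  by (simp_all add: G_def)

lemma W_linear: "w \<in> W \<Longrightarrow> linear w" and W_bij: "w \<in> W \<Longrightarrow> bij w"
  using W_orth orthogonal_transformation_linear orthogonal_transformation_bij by auto

lemma W_neg: "w \<in> W \<Longrightarrow> w (- a) = - w a"
  by (simp add: W_linear linear_neg)

lemma W_finv_left [simp]: "w \<in> W \<Longrightarrow> finv w (w a) = a"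
  by (simp add: W_bij bij_is_inj)

lemma W_finv_right [simp]: "w \<in> W \<Longrightarrow> w (finv w a) = a"
  by (simp add: W_bij bij_is_surj surj_f_inv_f)

lemma W_eq_iff: "w \<in> W \<Longrightarrow> w a = w b \<longleftrightarrow> a = b"
  by (metis W_finv_left)

text \<open>Among the vectors of \<open>X\<close>, those of \<open>A\<close> are exactly the ones
  with inner product 1 with the sum of \<open>A\<close>. This translates fixed vectors into
  invariant sets.\<close>

lemma fixes_sum_iff:
  assumes "w \<in> W" "consistent A"
  shows "w (\<Sum>A) = \<Sum>A \<longleftrightarrow> w ` A = A"
proof
  have A: "finite A" "A \<subseteq> X" using assms(2) finite_X finite_subset by (auto simp: consistent_def)
  { assume "w ` A = A"
    have "w (\<Sum>A) = \<Sum>(w ` A)"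
      using W_eq_iff[OF assms(1)] W_linear[OF assms(1)]
      by (simp add: linear_sum sum.reindex inj_on_def)
    then show "w (\<Sum>A) = \<Sum>A" using \<open>w ` A = A\<close> by simp }
  assume fx: "w (\<Sum>A) = \<Sum>A"
  have "w a \<in> A" if "a \<in> A" for a
  proof -
    have "w a \<bullet> \<Sum>A = w a \<bullet> w (\<Sum>A)" using fx by simp
    also have "\<dots> = a \<bullet> \<Sum>A"
      using W_orth[OF assms(1)] by (simp add: orthogonal_transformation_def)
    also have "\<dots> = 1" using inner_sum_X[OF assms(2), of a] that A by auto
    finally show ?thesis
      using inner_sum_X[OF assms(2), of "w a"] that A W_X[OF assms(1)]
      by (auto split: if_splits)
  qed
  then show "w ` A = A"
    using A(1) W_eq_iff[OF assms(1)] by (intro endo_inj_surj) (auto simp: inj_on_def)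
qed

text \<open>Otherwise \<open>z\<close> is the only element leaving \<open>H\<close>, an odd
  number.\<close>

lemma half_system_rest:
  assumes "w \<in> W" "half_system H" "z \<in> H" "\<And>h. h \<in> H \<Longrightarrow> h \<noteq> z \<Longrightarrow> w h \<in> H"
  shows "w z \<in> H"
proof (rule ccontr)
  assume "w z \<notin> H"
  then have "{h \<in> H. w h \<notin> H} = {z}" using assms by auto
  then show False using W_even[OF assms(1,2)] by simp
qed

text \<open>If some \<open>a\<close> leaves its axis, then \<open>w a - a\<close> is a root.
  Otherwise \<open>w\<close> only changes signs, and by parity it negates two members of a half
  system, whose difference is a root.\<close>

lemma ex_root_movspace:
  assumes "w \<in> W" "w \<noteq> id"
  shows "\<exists>b\<in>roots. b \<in> movspace w"
proof (cases "\<exists>a\<in>X. w a \<noteq> a \<and> w a \<noteq> - a")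
  case True
  then obtain a where a: "a \<in> X" "w a \<noteq> a" "w a \<noteq> - a" by blast
  then have "w a - a \<in> roots"
    using assms W_X by (intro rootI) (auto simp: equation_minus_iff)
  then show ?thesis by (auto simp: movspace_def)
next
  case False
  obtain H where H: "half_system H" using ex_half_system by blast
  then have HX: "H \<subseteq> X" by (auto simp: half_system_def)
  define N where "N = {h \<in> H. w h \<notin> H}"
  have N: "N = {h \<in> H. w h = - h}"
    using False H by (auto simp: N_def half_system_def subset_iff) (metis)
  obtain a where "a \<in> X" "w a \<noteq> a"
    using linear_eq_on_X[of w id] assms W_linear by (metis eq_id_iff linear_id)
  then have "a \<in> N \<or> - a \<in> N"
    using False H W_neg[OF assms(1)] neg_X unfolding N half_system_def by fastforce
  moreover have "finite N" using finite_subset[OF HX finite_X] by (simp add: N_def)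
  moreover have "even (card N)" using W_even[OF assms(1) H] by (simp add: N_def)
  ultimately have "card N \<ge> 2"
    using card_0_eq[of N] by (cases "card N"; cases "card N = 1") auto
  then obtain h h' where h: "h \<in> N" "h' \<in> N" "h \<noteq> h'"
    by (metis card_le_Suc0_iff_eq \<open>finite N\<close> not_less_eq_eq numeral_2_eq_2)
  then have "h - h' \<in> roots"
    using HX H by (intro rootI) (auto simp: N half_system_def)
  moreover have "w (h - h') = - (h - h')"
    using h W_linear[OF assms(1)] unfolding N by (simp add: linear_diff)
  \<comment> \<open>\<open>w\<close> negates \<open>h - h'\<close>, so the multiple by -1/2 is a
    preimage of \<open>h - h'\<close> under \<open>w - 1\<close>.\<close>
  then have "w ((- 1/2) *\<^sub>R (h - h')) - (- 1/2) *\<^sub>R (h - h') = (1/2 + 1/2) *\<^sub>R (h - h')"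
    unfolding scaleR_add_left linear_scale[OF W_linear[OF assms(1)]]
    by (simp add: scaleR_diff_right)
  then have "w ((- 1/2) *\<^sub>R (h - h')) - (- 1/2) *\<^sub>R (h - h') = h - h'" by simp
  then have "h - h' \<in> movspace w" unfolding movspace_def by (rule range_eqI[OF sym])
  ultimately show ?thesis by blast
qed

text \<open>Induction on the codimension: reflecting along a root in \<open>movspace w\<close>
  lowers it by one and shrinks \<open>movspace\<close>, so later roots stay inside. Together with
  subadditivity this is Carter's formula for reflection length.\<close>

lemma ex_reflection_factorization:
  assumes "w \<in> W"
  shows "\<exists>bs. set bs \<subseteq> roots \<inter> movspace w \<and> length bs = dim (movspace w) \<and>
              foldr (\<circ>) (map orthogonal_reflection bs) id = w"
  using assms
proof (induction "dim (movspace w)" arbitrary: w rule: less_induct)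
  case less
  show ?case
  proof (cases "w = id")
    case True
    then have "movspace w = {0}" by (auto simp: movspace_def)
    then show ?thesis using True by (intro exI[of _ "[]"]) simp
  next
    case False
    then obtain b where b: "b \<in> roots" "b \<in> movspace w" using ex_root_movspace less.prems by blast
    let ?s = "orthogonal_reflection b"
    have sw: "?s \<circ> w \<in> W" using b less.prems W_refl W_comp by blast
    have d: "dim (movspace (?s \<circ> w)) + 1 = dim (movspace w)"
      using dim_movspace_reflection_comp W_orth[OF less.prems] b roots_nonzero by blast
    then obtain bs where bs: "set bs \<subseteq> roots \<inter> movspace (?s \<circ> w)"
        "length bs = dim (movspace (?s \<circ> w))"
        "foldr (\<circ>) (map orthogonal_reflection bs) id = ?s \<circ> w"
      using less.hyps[OF _ sw] by auto
    have "movspace (?s \<circ> w) \<subseteq> movspace w"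
      using fixspace_subset_fixspace_reflection_comp[of w b] b W_orth less.prems sw
        movspace_subset_iff by metis
    moreover have "foldr (\<circ>) (map orthogonal_reflection (b # bs)) id = w"
      using bs(3) by (simp add: fun_eq_iff orthogonal_reflection_involution)
    ultimately show ?thesis
      using bs b d by (intro exI[of _ "b # bs"]) auto
  qed
qed

text \<open>\<open>w x - x\<close> telescopes along a factorization, and each reflection changes its
  argument by a multiple of its root.\<close>

lemma movspace_subset_span_roots:
  assumes "w \<in> W"
  shows "movspace w \<subseteq> span (roots \<inter> movspace w)"
proof -
  obtain bs where bs: "set bs \<subseteq> roots \<inter> movspace w"
      "foldr (\<circ>) (map orthogonal_reflection bs) id = w"
    using ex_reflection_factorization[OF assms] by blast
  define F where "F as = foldr (\<circ>) (map orthogonal_reflection as) id" for as :: "'a list"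
  have F: "F [] = id" "F (a # as) = orthogonal_reflection a \<circ> F as" for a as by (simp_all add: F_def)
  have "F bs x - x \<in> span (set bs)" for x
  proof (induction bs)
    case (Cons b bs)
    have "F bs x - x \<in> span (set (b # bs))"
      using Cons span_mono[of "set bs" "set (b # bs)"] by (meson set_subset_Cons subsetD)
    moreover have "orthogonal_reflection b (F bs x) - F bs x \<in> span (set (b # bs))"
      by (simp add: orthogonal_reflection_def span_neg span_scale span_base)
    ultimately have "(orthogonal_reflection b (F bs x) - F bs x) + (F bs x - x) \<in> span (set (b # bs))"
      by (rule span_add[rotated])
    then show ?case by (simp add: F)
  qed (simp add: F span_zero)
  then show ?thesis
    using bs span_mono[OF bs(1)] by (auto simp: movspace_def F_def)
qed

lemma dim_movspace_foldr_le:
  assumes "set ts \<subseteq> T"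
  shows "dim (movspace (foldr (\<circ>) ts id)) \<le> length ts"
proof -
  define F where "F us = foldr (\<circ>) us (id :: 'a \<Rightarrow> 'a)" for us :: "('a \<Rightarrow> 'a) list"
  have F: "F [] = id" "F (u # us) = u \<circ> F us" for u us by (simp_all add: F_def)
  have "linear (F ts) \<and> dim (movspace (F ts)) \<le> length ts"
    using assms
  proof (induction ts)
    case Nil
    have "movspace (id::'a \<Rightarrow> 'a) = {0}" by (auto simp: movspace_def)
    then show ?case using linear_id by (simp add: F id_def)
  next
    case (Cons t ts)
    then obtain b where b: "b \<in> roots" "t = orthogonal_reflection b" by (auto simp: T_def)
    then have "dim (movspace t) = 1" "linear t"
      using dim_movspace_reflection roots_nonzero orthogonal_reflection_linear by blast+
    then show ?case
      using Cons dim_movspace_comp_le[of t "F ts"] linear_compose[of "F ts" t] by (auto simp: F o_def)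
  qed
  then show ?thesis by (simp add: F_def)
qed

lemma reflection_length_eq:
  assumes "w \<in> W"
  shows "reflection_length G T w = dim (movspace w)"
  unfolding reflection_length_def
proof (rule Least_equality)
  obtain bs where "set bs \<subseteq> roots \<inter> movspace w" "length bs = dim (movspace w)"
      "foldr (\<circ>) (map orthogonal_reflection bs) id = w"
    using ex_reflection_factorization[OF assms] by blast
  then show "\<exists>ts. set ts \<subseteq> T \<and> length ts = dim (movspace w) \<and> foldr (\<otimes>\<^bsub>G\<^esub>) ts \<one>\<^bsub>G\<^esub> = w"
    by (intro exI[of _ "map orthogonal_reflection bs"]) (auto simp: T_def G_def)
next
  fix k assume "\<exists>ts. set ts \<subseteq> T \<and> length ts = k \<and> foldr (\<otimes>\<^bsub>G\<^esub>) ts \<one>\<^bsub>G\<^esub> = w"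
  then show "dim (movspace w) \<le> k" using dim_movspace_foldr_le by (auto simp: G_def)
qed

lemma inv_G: "w \<in> W \<Longrightarrow> inv\<^bsub>G\<^esub> w = finv w"
proof -
  assume w: "w \<in> W"
  have "\<exists>y\<in>W. y \<circ> v = id" if "v \<in> W" for v
    using that W_inv by (intro bexI[of _ "finv v"]) (auto simp: fun_eq_iff)
  then have "group G"
    by (intro groupI) (auto simp: G_def W_comp W_id o_assoc)
  then show ?thesis
    using w W_inv by (intro group.inv_equality) (auto simp: G_def fun_eq_iff)
qed

lemma absolute_le_iff:
  assumes "v \<in> W" "w \<in> W"
  shows "absolute_le G T v w \<longleftrightarrow> dim (movspace (w \<circ> finv v)) + dim (movspace v) = dim (movspace w)"
proof -
  have "w \<circ> finv v \<in> W" using assms W_comp W_inv by blast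
  then have "reflection_length G T (w \<otimes>\<^bsub>G\<^esub> inv\<^bsub>G\<^esub> v) = dim (movspace (w \<circ> finv v))"
    using assms reflection_length_eq[of "w \<circ> finv v"] inv_G[of v]
    by (simp add: mult_G)
  then show ?thesis
    using assms by (auto simp: absolute_le_def reflection_length_eq)
qed

lemma ball_T: "(\<forall>t\<in>T. P t) \<longleftrightarrow> (\<forall>b\<in>roots. P (orthogonal_reflection b))"
  by (simp add: T_def)

lemma absolute_le_reflection_iff:
  assumes "b \<in> roots" "w \<in> W"
  shows "absolute_le G T (orthogonal_reflection b) w \<longleftrightarrow> b \<in> movspace w"
proof -
  show ?thesis
    using finv_orthogonal_reflection[of b] absolute_le_iff[OF W_refl[OF assms(1)] assms(2)] dim_movspace_reflection[of b]
      dim_movspace_comp_reflection_iff[of w b] W_orth assms roots_nonzero by simp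
qed

text \<open>Reflections below \<open>w\<close> correspond to the roots in \<open>movspace w\<close>,
  and these span it. So upper bounds of the reflections below \<open>w\<close> are recognised by
  their fixed spaces.\<close>

lemma reflections_le_iff:
  assumes "v \<in> W" "w \<in> W"
  shows "(\<forall>t\<in>T. absolute_le G T t w \<longrightarrow> absolute_le G T t v) \<longleftrightarrow> fixspace v \<subseteq> fixspace w"
proof -
  have "(\<forall>t\<in>T. absolute_le G T t w \<longrightarrow> absolute_le G T t v) \<longleftrightarrow> roots \<inter> movspace w \<subseteq> movspace v"
    using assms absolute_le_reflection_iff by (auto simp: ball_T)
  also have "\<dots> \<longleftrightarrow> movspace w \<subseteq> movspace v"
  proof
    assume "roots \<inter> movspace w \<subseteq> movspace v"
    then have "span (roots \<inter> movspace w) \<subseteq> movspace v"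
      using assms W_linear subspace_movspace by (intro span_minimal) auto
    then show "movspace w \<subseteq> movspace v" using movspace_subset_span_roots[OF assms(2)] by blast
  qed auto
  also have "\<dots> \<longleftrightarrow> fixspace v \<subseteq> fixspace w" using assms W_orth movspace_subset_iff by blast
  finally show ?thesis .
qed

end

section \<open>The Coxeter element and its arcs\<close>

text \<open>Integer indices make arcs plain intervals; by \<open>E_add_m\<close> and
  \<open>E_inj\<close>, two indices name the same vector exactly when they agree modulo
  \<open>2 * m\<close>.\<close>

locale D_coxeter = D_group X W for X :: "'a::euclidean_space set" and W +
  fixes m :: int and E :: "int \<Rightarrow> 'a" and z :: 'a and c :: "'a \<Rightarrow> 'a"
  assumes m_ge: "m \<ge> 3"
    and X_eq: "X = range E \<union> {z, - z}"
    and E_add_m: "E (i + m) = - E i"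
    and E_inj: "E i = E j \<Longrightarrow> 2 * m dvd i - j"
    and z_notin: "z \<notin> range E"
    and c_W: "c \<in> W"
    and c_E: "c (E i) = E (i + 1)"
    and c_z: "c z = - z"
begin

lemma E_X [simp]: "E i \<in> X" and z_X: "z \<in> X" and neg_z_X: "- z \<in> X"
  by (auto simp: X_eq)

lemma E_sub_m: "E (i - m) = - E i"
  using E_add_m[of "i - m"] by simp

lemma E_add_2m: "E (i + 2 * m) = E i"
  using E_add_m[of "i + m"] E_add_m[of i] by (simp add: algebra_simps)

lemma E_eq_imp_eq: "E i = E j \<Longrightarrow> \<bar>i - j\<bar> < 2 * m \<Longrightarrow> i = j"
  using E_inj[of i j] zdvd_imp_le[of "2 * m" "\<bar>i - j\<bar>"] by (cases "i = j") auto

lemma E_add_mult: "E (i + 2 * m * k) = E i"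
proof (induction k rule: int_induct[where k = 0])
  case (step1 k)
  then show ?case using E_add_2m[of "i + 2 * m * k"] by (simp add: algebra_simps)
next
  case (step2 k)
  then show ?case using E_add_2m[of "i + 2 * m * (k - 1)"] by (simp add: algebra_simps)
qed simp

lemma E_normalize:
  obtains k where "E i = E k" "j \<le> k" "k < j + 2 * m"
proof
  let ?k = "j + (i - j) mod (2 * m)"
  have "i = ?k + 2 * m * ((i - j) div (2 * m))"
    using minus_mod_eq_mult_div[of "i - j" "2 * m"] by (simp add: algebra_simps)
  then show "E i = E ?k" using E_add_mult by metis
  show "j \<le> ?k" "?k < j + 2 * m" using m_ge by simp_all
qed

lemma E_neq_z: "E i \<noteq> z" "E i \<noteq> - z" "z \<noteq> E i" "- z \<noteq> E i" "- E i \<noteq> z" "- E i \<noteq> - z"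
  using z_notin E_add_m[of i] by (metis minus_minus rangeI)+

lemma z_neq: "z \<noteq> - z" "- z \<noteq> z"
  using X_nonzero z_X by auto

lemma X_cases:
  assumes "a \<in> X"
  obtains (circle) i where "a = E i" | (centre) "a \<in> {z, - z}"
  using assms by (auto simp: X_eq)

definition arc :: "int \<Rightarrow> int \<Rightarrow> 'a set" where
  "arc i j = E ` {i..<j}"

text \<open>Half of the circle with one central point: for \<open>y\<close> in
  \<open>{z, - z}\<close> this is a half system, so parity applies to it.\<close>

definition half :: "int \<Rightarrow> 'a \<Rightarrow> 'a set" where
  "half p y = insert y (arc p (p + m))"

lemma inj_on_E: "j \<le> i + 2 * m \<Longrightarrow> inj_on E {i..<j}"
  by (rule inj_onI, rule E_eq_imp_eq) auto

lemma arcI: "i \<le> k \<Longrightarrow> k < j \<Longrightarrow> E k \<in> arc i j"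
  by (auto simp: arc_def)

lemma centre_notin_arc: "y \<in> {z, - z} \<Longrightarrow> y \<notin> arc i j"
  using E_neq_z by (auto simp: arc_def)

lemma neg_E_notin_arc:
  assumes "i \<le> k" "k < j" "j \<le> i + m"
  shows "- E k \<notin> arc i j"
proof
  assume "- E k \<in> arc i j"
  then obtain l where l: "i \<le> l" "l < j" "- E k = E l" by (auto simp: arc_def)
  then have "E (k + m) = E l" "E (k - m) = E l" using E_add_m E_sub_m by simp_all
  then have "k + m = l \<or> k - m = l"
    using l assms E_eq_imp_eq[of "k + m" l] E_eq_imp_eq[of "k - m" l] m_ge
    by (cases "l \<le> k") auto
  then show False using l assms by auto
qed

lemma consistent_arc: "j \<le> i + m \<Longrightarrow> consistent (arc i j)"
  using neg_E_notin_arc by (auto simp: consistent_def arc_def)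

lemma half_system_half:
  assumes "y \<in> {z, - z}"
  shows "half_system (half p y)"
  unfolding half_system_def
proof (intro conjI ballI)
  show "half p y \<subseteq> X" using assms z_X neg_z_X by (auto simp: half_def arc_def)
  fix a assume "a \<in> X"
  then show "a \<in> half p y \<longleftrightarrow> - a \<notin> half p y"
  proof (cases rule: X_cases)
    case (circle i)
    obtain k where k: "E i = E k" "p \<le> k" "k < p + 2 * m" using E_normalize by blast
    show ?thesis
    proof (cases "k < p + m")
      case True
      then have "E k \<in> arc p (p + m)" "- E k \<notin> arc p (p + m)"
        using k neg_E_notin_arc by (auto simp: arcI)
      then show ?thesis using circle k assms E_neq_z by (auto simp: half_def)
    next
      case False
      then have *: "- E k \<in> arc p (p + m)" using k arcI[of p "k - m" "p + m"] by (simp add: E_sub_m)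
      then obtain l where l: "- E k = E l" "p \<le> l" "l < p + m" by (auto simp: arc_def)
      then have "- E l \<notin> arc p (p + m)" using neg_E_notin_arc by blast
      then have "E k \<notin> arc p (p + m)" using l(1) by (metis minus_minus)
      then show ?thesis using * circle k assms E_neq_z by (auto simp: half_def)
    qed
  next
    case centre
    then have "- a \<in> {z, - z}" by auto
    then have "a \<notin> arc p (p + m)" "- a \<notin> arc p (p + m)" using centre centre_notin_arc by auto
    then show ?thesis using assms centre z_neq by (auto simp: half_def)
  qed
qed

text \<open>Summation runs over indices, not over points as for \<open>arc\<close>, so that
  intervals longer than a full turn still telescope.\<close>

definition S :: "int \<Rightarrow> int \<Rightarrow> 'a" where
  "S i j = (\<Sum>k\<in>{i..<j}. E k)"

lemma sum_arc: "j \<le> i + 2 * m \<Longrightarrow> \<Sum>(arc i j) = S i j"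
  by (simp add: arc_def S_def sum.reindex inj_on_E)

lemma sum_half:
  assumes "y \<in> {z, - z}"
  shows "\<Sum>(half p y) = S p (p + m) + y"
proof -
  have "finite (arc p (p + m))" by (simp add: arc_def)
  then show ?thesis
    using centre_notin_arc[OF assms] sum_arc[of "p + m" p] m_ge by (simp add: half_def add.commute)
qed

lemma S_split: "i \<le> j \<Longrightarrow> j \<le> k \<Longrightarrow> S i k = S i j + S j k"
  unfolding S_def by (subst sum.union_disjoint[symmetric]) (auto intro: sum.cong)

lemma S_shift: "S (i + m) (j + m) = - S i j"
  unfolding S_def sum_negf[symmetric]
  by (rule sum.reindex_bij_witness[of _ "\<lambda>k. k + m" "\<lambda>k. k - m"]) (auto simp: E_sub_m)

lemma S_full: "S i (i + 2 * m) = 0"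
  using S_split[of i "i + m" "i + 2 * m"] S_shift[of i "i + m"] m_ge by (simp add: algebra_simps)

lemma linear_c: "linear c" using c_W W_linear by blast

lemma c_S:
  assumes "i \<le> j"
  shows "c (S i j) - S i j = E j - E i"
  using assms
proof (induction j rule: int_ge_induct)
  case base
  then show ?case using linear_c by (simp add: S_def linear_0)
next
  case (step j)
  have "S j (j + 1) = E j"
  proof -
    have "{j..<j + 1} = {j}" by auto
    then show ?thesis by (simp add: S_def)
  qed
  then have "S i (j + 1) = S i j + E j" using S_split[of i j "j + 1"] step by simp
  then show ?case using step linear_c by (simp add: linear_add c_E algebra_simps)
qed

text \<open>The inner product of a fixed vector with \<open>E i\<close> is constant around the
  circle, yet changes sign after \<open>m\<close> steps; likewise for \<open>z\<close> after one
  step.\<close>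

lemma fixspace_c: "fixspace c = {0}"
proof (intro equalityI subsetI)
  fix f assume "f \<in> fixspace c"
  then have "c f = f" by (simp add: fixspace_iff)
  then have step: "c a \<bullet> f = a \<bullet> f" for a
    using W_orth[OF c_W] by (metis orthogonal_transformation_def)
  have "E (i + int k) \<bullet> f = E i \<bullet> f" for i k
  proof (induction k)
    case (Suc k)
    then show ?case using step[of "E (i + int k)"] by (simp add: c_E algebra_simps)
  qed simp
  then have "E (i + int (nat m)) \<bullet> f = E i \<bullet> f" for i by blast
  then have "- (E i \<bullet> f) = E i \<bullet> f" for i
    using m_ge by (simp add: E_add_m)
  then have "E i \<bullet> f = 0" for i by (metis neg_equal_zero)
  moreover have "z \<bullet> f = 0" using step[of z] by (simp add: c_z)
  ultimately have "a \<bullet> f = 0" if "a \<in> X" for a using that by (auto simp: X_eq)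
  then have "x \<bullet> f = 0" if "x \<in> span X" for x
    by (intro span_induct[OF that, of "\<lambda>x. x \<bullet> f = 0"]) (auto simp: subspace_def inner_add_left)
  then have "f \<bullet> f = 0" by (simp add: span_X)
  then show "f \<in> {0}" by simp
qed (use linear_c in \<open>auto simp: fixspace_iff linear_0\<close>)

sublocale fixed_point_free c
  by unfold_locales (use W_orth[OF c_W] fixspace_c in auto)

definition NCset :: "('a \<Rightarrow> 'a) set" where
  "NCset = {v \<in> W. divides_coxeter c v}"

lemma NCsetD: "v \<in> NCset \<Longrightarrow> v \<in> W" "v \<in> NCset \<Longrightarrow> divides_coxeter c v"
  by (auto simp: NCset_def)

lemma movspace_id: "movspace (id::'a \<Rightarrow> 'a) = {0}"
  by (auto simp: movspace_def)

lemma carrier_NC: "carrier (NC G T c) = NCset"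
proof -
  have "absolute_le G T id w" if "w \<in> W" for w
    using absolute_le_iff[OF W_id that] movspace_id by simp
  moreover have "absolute_le G T w c \<longleftrightarrow> divides_coxeter c w" if "w \<in> W" for w
    using absolute_le_iff[OF that c_W] movspace_eq_UNIV[OF orth_c fix_c] W_orth[OF that]
    by (auto simp: divides_coxeter_def add.commute)
  ultimately show ?thesis by (auto simp: NC_def NCset_def carrier_G one_G)
qed

lemma c_NCset: "c \<in> NCset"
proof -
  have "c \<circ> finv c = id" using c_W by (auto simp: fun_eq_iff)
  then show ?thesis
    using movspace_eq_UNIV[OF orth_c fix_c] movspace_id c_W orth_c
    by (simp add: NCset_def divides_coxeter_def)
qed

subsection \<open>The shape of the elements below \<open>c\<close>\<close>

lemma NC_fix_arc:
  assumes "v \<in> NCset" "v (E i) = E j" "i < j"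
  shows "v (S (i + 1) j) = S (i + 1) j"
proof (rule divides_coxeter_fixes)
  \<comment> \<open>With the witness \<open>- E i\<close> both sides equal
    \<open>E j - E (i + 1)\<close>.\<close>
  show "c (S (i + 1) j) - S (i + 1) j = c (- E i) - v (- E i)"
    using assms c_S[of "i + 1" j] W_neg[OF NCsetD(1)[OF assms(1)]] W_neg[OF c_W] by (simp add: c_E)
qed (use assms NCsetD in blast)

lemma NC_arc_short:
  assumes "v \<in> NCset" "v (E i) = E j" "i < j" "j \<le> i + m + 1"
  shows "v ` arc (i + 1) j = arc (i + 1) j"
  using NC_fix_arc[OF assms(1-3)] assms consistent_arc[of j "i + 1"] fixes_sum_iff[of v "arc (i + 1) j"]
    sum_arc[of j "i + 1"] m_ge NCsetD by simp

text \<open>An open arc longer than \<open>m\<close> contains opposite points. The full circle sums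
  to 0, so the complementary arc, which includes \<open>E i\<close> itself as
  \<open>E (i + 2 * m)\<close>, has the opposite sum and is fixed too.\<close>

lemma NC_arc_long:
  assumes "v \<in> NCset" "v (E i) = E j" "i + m + 1 \<le> j" "j \<le> i + 2 * m"
  shows "v ` arc j (i + 2 * m + 1) = arc j (i + 2 * m + 1)"
proof -
  have "S (i + 1) j = - S j (i + 2 * m + 1)"
    using S_split[of "i + 1" j "i + 2 * m + 1"] S_full[of "i + 1"] assms m_ge
    by (simp add: algebra_simps eq_neg_iff_add_eq_0)
  then have "v (S j (i + 2 * m + 1)) = S j (i + 2 * m + 1)"
    using NC_fix_arc[OF assms(1,2)] assms m_ge W_neg[OF NCsetD(1)[OF assms(1)]] by auto
  then show ?thesis
    using assms consistent_arc[of "i + 2 * m + 1" j] fixes_sum_iff[of v "arc j (i + 2 * m + 1)"]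
      sum_arc[of "i + 2 * m + 1" j] m_ge NCsetD[OF assms(1)] by simp
qed

lemma c_centre: "y \<in> {z, - z} \<Longrightarrow> c y = - y"
  using c_z W_neg[OF c_W] by auto

text \<open>The half circle telescopes to \<open>E (p + m) - E p\<close>, twice
  \<open>- E p\<close>, and the centre contributes twice \<open>- y\<close>. Up to a factor, half
  systems are thus the preimages of the roots \<open>E p + y\<close> under
  \<open>c - 1\<close>.\<close>

lemma c_half:
  assumes "y \<in> {z, - z}"
  shows "c (\<Sum>(half p y)) - \<Sum>(half p y) = (-2) *\<^sub>R (E p + y)"
proof -
  have "c (S p (p + m)) - S p (p + m) = - E p - E p"
    using c_S[of p "p + m"] m_ge by (simp add: E_add_m)
  then show ?thesis
    unfolding sum_half[OF assms] linear_add[OF linear_c] c_centre[OF assms]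
    by (simp add: algebra_simps scaleR_2)
qed

text \<open>The witness is twice \<open>y\<close>: \<open>c\<close> negates it and \<open>v\<close>
  sends it to twice \<open>E x\<close>, which matches \<open>c_half\<close> at
  \<open>p = x\<close>.\<close>

lemma NC_half_exit:
  assumes "v \<in> NCset" "v y = E x" "y \<in> {z, - z}"
  shows "v ` half x y = half x y"
proof -
  have "v (\<Sum>(half x y)) = \<Sum>(half x y)"
  proof (rule divides_coxeter_fixes)
    show "c (\<Sum>(half x y)) - \<Sum>(half x y) = c (2 *\<^sub>R y) - v (2 *\<^sub>R y)"
      using assms W_linear[OF NCsetD(1)[OF assms(1)]] linear_c
      by (simp add: c_half linear_scale c_centre[OF assms(3)] algebra_simps)
  qed (use assms NCsetD in blast)
  then show ?thesis
    using fixes_sum_iff half_system_half half_system_consistent assms NCsetD by blast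
qed

text \<open>The half circle is the one whose last point is \<open>E i\<close>, so its start
  \<open>E (i - m + 1)\<close> is \<open>- E (i + 1)\<close>; the witness is twice
  \<open>E i\<close>.\<close>

lemma NC_half_enter:
  assumes "v \<in> NCset" "v (E i) = y" "y \<in> {z, - z}"
  shows "v ` half (i - m + 1) y = half (i - m + 1) y"
proof -
  let ?h = "half (i - m + 1) y"
  have "E (i - m + 1) = - E (i + 1)" using E_sub_m[of "i + 1"] by (simp add: algebra_simps)
  then have *: "c (\<Sum>?h) - \<Sum>?h = 2 *\<^sub>R (E (i + 1) - y)"
    unfolding c_half[OF assms(3)] by (simp add: algebra_simps)
  have "v (\<Sum>?h) = \<Sum>?h"
  proof (rule divides_coxeter_fixes)
    show "c (\<Sum>?h) - \<Sum>?h = c (2 *\<^sub>R E i) - v (2 *\<^sub>R E i)"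
      unfolding * using assms W_linear[OF NCsetD(1)[OF assms(1)]] linear_c
      by (simp add: linear_scale c_E algebra_simps)
  qed (use assms NCsetD in blast)
  then show ?thesis
    using fixes_sum_iff half_system_half half_system_consistent assms NCsetD by blast
qed

end

section \<open>Existence of the join\<close>

context D_coxeter
begin

lemma card_Diff_commute:
  "finite A \<Longrightarrow> finite B \<Longrightarrow> card A = card B \<Longrightarrow> card (A - B) = card (B - A)"
  by (simp add: card_Diff_subset_Int Int_commute)

text \<open>The bounds keep the index intervals from meeting a second time one turn later.\<close>

lemma arc_Int:
  assumes "j - p \<le> 2 * m" "q - i \<le> 2 * m"
  shows "arc i j \<inter> arc p q = arc (max i p) (min j q)"
proof (intro equalityI subsetI)
  fix a assume "a \<in> arc i j \<inter> arc p q"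
  then obtain k l where k: "a = E k" "i \<le> k" "k < j" and l: "a = E l" "p \<le> l" "l < q"
    unfolding arc_def by (meson IntE atLeastLessThan_iff imageE)
  then have "k = l" using assms E_eq_imp_eq[of k l] by auto
  then show "a \<in> arc (max i p) (min j q)" using k l by (auto simp: arc_def)
qed (auto simp: arc_def)

lemma arc_Un: "p \<le> y \<Longrightarrow> y \<le> q \<Longrightarrow> arc p q = arc p y \<union> arc y q"
  unfolding arc_def image_Un[symmetric] by (simp add: ivl_disj_un)

lemma arc_Un_overlap: "p \<le> i \<Longrightarrow> i \<le> q \<Longrightarrow> q \<le> r \<Longrightarrow> arc p q \<union> arc i r = arc p r"
  unfolding arc_def image_Un[symmetric] by (rule arg_cong[where f = "image E"]) auto

lemma W_image_Int: "w \<in> W \<Longrightarrow> w ` A = A \<Longrightarrow> w ` B = B \<Longrightarrow> w ` (A \<inter> B) = A \<inter> B"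
  by (simp add: image_Int W_bij bij_is_inj)

lemma W_image_Diff: "w \<in> W \<Longrightarrow> w ` A = A \<Longrightarrow> w ` B = B \<Longrightarrow> w ` (A - B) = A - B"
  by (simp add: image_set_diff W_bij bij_is_inj)

lemma W_mem_image_iff: "w \<in> W \<Longrightarrow> w ` A = A \<Longrightarrow> w a \<in> A \<longleftrightarrow> a \<in> A"
  by (metis W_eq_iff image_iff)

lemma fixspace_mono_image:
  assumes "v \<in> W" "w \<in> W" "fixspace v \<subseteq> fixspace w" "consistent A" "v ` A = A"
  shows "w ` A = A"
  using assms fixes_sum_iff by (metis fixspace_iff subsetD)

lemma consistent_half: "y \<in> {z, - z} \<Longrightarrow> consistent (half p y)"
  by (simp add: half_system_half half_system_consistent)

text \<open>Here \<open>E y\<close> is a point of \<open>A\<close> whose preimage under \<open>v\<close> lies outside \<open>A\<close>. The arc between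
  that preimage and \<open>E y\<close> is invariant, and it cuts \<open>A\<close> at \<open>E y\<close>.\<close>

lemma invariant_arc_split:
  assumes v: "v \<in> NCset" and w: "w \<in> W" and vw: "fixspace v \<subseteq> fixspace w"
    and D: "D \<subseteq> {z, - z}" and A: "A = arc p q \<union> D" "w ` A = A"
    and q: "q \<le> p + m" and y: "p \<le> y" "y < q" and a: "a \<in> X" "a \<notin> A" "v a = E y"
  shows "w ` arc p y = arc p y \<or> w ` arc y q = arc y q"
proof -
  note inv = fixspace_mono_image[OF NCsetD(1)[OF v] w vw]
  have D_arc: "D \<inter> arc i j = {}" for i j using D centre_notin_arc by blast
  from a(1) show ?thesis
  proof (cases rule: X_cases)
    case (circle i0)
    \<comment> \<open>The index is taken in the last turn before \<open>y\<close> and lies before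
      \<open>p\<close>, because the preimage is outside \<open>A\<close>. The open arc from it to
      \<open>E y\<close> meets \<open>A\<close> in \<open>arc p y\<close>, the complementary arc in
      \<open>arc y q\<close>.\<close>
    obtain i where i: "E i0 = E i" "y - 2 * m \<le> i" "i < y"
      using E_normalize[of i0 "y - 2 * m"] by auto
    have ai: "a = E i" using circle i by simp
    have vi: "v (E i) = E y" using ai a by simp
    have ip: "i < p" using arcI[of p i q] a ai A(1) i y by auto
    show ?thesis
    proof (cases "y \<le> i + m + 1")
      case True
      have "w ` arc (i + 1) y = arc (i + 1) y"
        using inv NC_arc_short[OF v vi] i True consistent_arc by auto
      then have "w ` (arc (i + 1) y \<inter> A) = arc (i + 1) y \<inter> A"
        using W_image_Int[OF w] A(2) by blast
      moreover have "arc (i + 1) y \<inter> arc p q = arc (max (i + 1) p) (min y q)"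
        using True q y m_ge by (intro arc_Int) auto
      then have "arc (i + 1) y \<inter> A = arc p y"
        using A(1) D_arc[of "i + 1" y] ip y by (auto simp: max_def min_def)
      ultimately show ?thesis by simp
    next
      case False
      have "w ` arc y (i + 2 * m + 1) = arc y (i + 2 * m + 1)"
        using inv NC_arc_long[OF v vi] i False consistent_arc by auto
      then have "w ` (arc y (i + 2 * m + 1) \<inter> A) = arc y (i + 2 * m + 1) \<inter> A"
        using W_image_Int[OF w] A(2) by blast
      moreover have "\<not> i + 2 * m < q"
        using arcI[of p "i + 2 * m" q] a ai A(1) i y E_add_2m[of i] by auto
      then have "arc y (i + 2 * m + 1) \<inter> arc p q = arc y q"
        using arc_Int[of "i + 2 * m + 1" p q y] q y ip m_ge by (simp add: max_absorb1 min_absorb2)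
      then have "arc y (i + 2 * m + 1) \<inter> A = arc y q"
        using A(1) D_arc[of y "i + 2 * m + 1"] by auto
      ultimately show ?thesis by simp
    qed
  next
    case centre
    have "w ` half y a = half y a"
      using inv NC_half_exit[OF v a(3) centre] consistent_half centre by blast
    then have "w ` (half y a \<inter> A) = half y a \<inter> A"
      using W_image_Int[OF w] A(2) by blast
    moreover have "arc y (y + m) \<inter> arc p q = arc y q"
      using arc_Int[of "y + m" p q y] q y m_ge by (simp add: max_absorb1 min_absorb2)
    then have "half y a \<inter> A = arc y q"
      using A(1) a(2) D_arc[of y "y + m"] by (auto simp: half_def)
    ultimately show ?thesis by simp
  qed
qed

text \<open>The candidate for the join. Maximal dimension makes existence immediate, as
  \<open>c\<close> itself competes; that its fixed space contains all competing ones is proved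
  later.\<close>

definition optimal :: "('a \<Rightarrow> 'a) \<Rightarrow> ('a \<Rightarrow> 'a) \<Rightarrow> bool" where
  "optimal w v \<longleftrightarrow> v \<in> NCset \<and> fixspace v \<subseteq> fixspace w \<and>
     (\<forall>v'\<in>NCset. fixspace v' \<subseteq> fixspace w \<longrightarrow> dim (fixspace v') \<le> dim (fixspace v))"

lemma ex_optimal:
  assumes "w \<in> W"
  shows "\<exists>v. optimal w v"
proof -
  let ?P = "\<lambda>v. v \<in> NCset \<and> fixspace v \<subseteq> fixspace w"
  have "?P c" using c_NCset fixspace_c W_linear[OF assms] by (auto simp: fixspace_iff linear_0)
  moreover have "\<forall>v. ?P v \<longrightarrow> dim (fixspace v) < DIM('a) + 1"
    by (simp add: dim_subset_UNIV less_Suc_eq_le)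
  ultimately have "\<exists>v. ?P v \<and> (\<forall>v'. ?P v' \<longrightarrow> dim (fixspace v') \<le> dim (fixspace v))"
    using ex_has_greatest_nat[of ?P c "\<lambda>v. dim (fixspace v)" "DIM('a) + 1"] by blast
  then show ?thesis unfolding optimal_def by blast
qed

lemma optimalD:
  assumes "optimal w v"
  shows "v \<in> NCset" "v \<in> W" "fixspace v \<subseteq> fixspace w" "linear v"
    "\<And>v'. v' \<in> NCset \<Longrightarrow> fixspace v' \<subseteq> fixspace w \<Longrightarrow> dim (fixspace v') \<le> dim (fixspace v)"
  using assms NCsetD W_linear by (auto simp: optimal_def)

text \<open>Otherwise the reflection along \<open>b\<close> composed with \<open>v\<close> is still
  below \<open>c\<close> and fixes \<open>u\<close> besides \<open>fixspace v\<close>. Its fixed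
  space has one more dimension, so it is spanned by these and stays inside
  \<open>fixspace w\<close>, against maximality.\<close>

lemma optimal_no_root:
  assumes w: "w \<in> W" and v: "optimal w v" and u: "w u = u" "v u - u = k *\<^sub>R b" "k \<noteq> 0"
    and b: "b \<in> roots"
  shows False
proof -
  note D = optimalD[OF v]
  let ?s = "orthogonal_reflection b"
  have orth: "orthogonal_transformation v" using D W_orth by blast
  have "k *\<^sub>R b \<in> movspace v" unfolding movspace_def u(2)[symmetric] by (rule rangeI)
  then have "(1 / k) *\<^sub>R (k *\<^sub>R b) \<in> movspace v"
    using subspace_movspace[OF D(4)] subspace_scale by blast
  then have bv: "b \<in> movspace v" using u(3) by simp
  have b0: "b \<noteq> 0" using b roots_nonzero by blast
  have sv: "?s \<circ> v \<in> NCset"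
    using divides_coxeter_reflection_comp[OF NCsetD(2)[OF D(1)] bv b0] W_comp[OF W_refl[OF b] D(2)]
    unfolding NCset_def by blast
  have lin: "linear (?s \<circ> v)" and orth': "orthogonal_transformation (?s \<circ> v)"
    using sv NCsetD W_linear W_orth by blast+
  have "?s (v u) = u" using orthogonal_reflection_comp_fixes[OF orth u(3,2)] .
  then have sub: "insert u (fixspace v) \<subseteq> fixspace (?s \<circ> v)"
    using fixspace_subset_fixspace_reflection_comp[OF orth bv] by (auto simp: fixspace_iff)
  have "u \<notin> fixspace v" using u(2,3) b0 by (auto simp: fixspace_iff)
  then have "u \<notin> span (fixspace v)"
    using subspace_fixspace[OF D(4)] by (simp add: span_eq_iff[THEN iffD2])
  then have d1: "dim (insert u (fixspace v)) = dim (fixspace v) + 1"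
    by (simp add: dim_insert)
  have d2: "dim (fixspace (?s \<circ> v)) = dim (fixspace v) + 1"
    using dim_movspace_reflection_comp[OF orth bv b0] dim_fixspace_movspace[OF orth]
      dim_fixspace_movspace[OF orth'] by linarith
  have "span (insert u (fixspace v)) = span (fixspace (?s \<circ> v))"
    using sub d1 d2 by (intro dim_eq_span) auto
  also have "\<dots> = fixspace (?s \<circ> v)" using subspace_fixspace[OF lin] by simp
  finally have "fixspace (?s \<circ> v) = span (insert u (fixspace v))" ..
  also have "\<dots> \<subseteq> fixspace w"
    using D(3) u(1) subspace_fixspace[OF W_linear[OF w]]
    by (intro span_minimal) (auto simp: fixspace_iff)
  finally show False using D(5)[OF sv] d2 by simp
qed

text \<open>If \<open>v\<close> breaks a shortest such arc, it replaces only the first point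
  \<open>E p\<close>, by some \<open>y0\<close>, so the arc sum moves by \<open>y0 - E p\<close>.
  This is a root unless \<open>y0 = - E p\<close>; in that case adding \<open>z\<close> to the sum
  produces a root.\<close>

lemma optimal_arc:
  assumes w: "w \<in> W" and v: "optimal w v" and "w ` arc p q = arc p q" "q < p + m"
  shows "v ` arc p q = arc p q"
  using assms(3,4)
proof (induction "nat (q - p)" arbitrary: p q rule: less_induct)
  case less
  note D = optimalD[OF v]
  note inv = fixspace_mono_image[OF D(2) w D(3)]
  let ?A = "arc p q"
  have fin: "finite ?A" by (simp add: arc_def)
  have cons: "consistent ?A" using less.prems by (intro consistent_arc) auto
  have AX: "?A \<subseteq> X" by (auto simp: arc_def)
  have inj: "inj v" using W_bij D(2) bij_is_inj by blast
  show ?case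
  proof (rule ccontr)
    assume neq: "v ` ?A \<noteq> ?A"
    \<comment> \<open>A missed point other than \<open>E p\<close> would cut the arc into two
      shorter \<open>w\<close>-invariant arcs, both \<open>v\<close>-invariant by induction.\<close>
    have entry: "b = E p" if b: "b \<in> ?A" "b \<notin> v ` ?A" for b
    proof (rule ccontr)
      assume "b \<noteq> E p"
      obtain y where y: "b = E y" "p \<le> y" "y < q" using b(1) by (auto simp: arc_def)
      then have py: "p < y" using \<open>b \<noteq> E p\<close> by (cases "p = y") auto
      have a: "finv v b \<in> X" "finv v b \<notin> ?A" "v (finv v b) = E y"
        using b y D(2) W_X W_inv AX by (auto simp: image_iff)
      have "w ` arc p y = arc p y \<or> w ` arc y q = arc y q"
        using invariant_arc_split[OF D(1) w D(3), of "{}" ?A p q y "finv v b"] less.prems y a by simp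
      moreover have "arc y q = ?A - arc p y" "arc p y = ?A - arc y q"
      proof -
        have "arc p y \<inter> arc y q = {}"
          using arc_Int[of y y q p] less.prems y m_ge by (simp add: arc_def)
        then show "arc y q = ?A - arc p y" "arc p y = ?A - arc y q"
          using arc_Un[of p y q] y by auto
      qed
      ultimately have "w ` arc p y = arc p y" "w ` arc y q = arc y q"
        using W_image_Diff[OF w less.prems(1)] by metis+
      then have "v ` arc p y = arc p y" "v ` arc y q = arc y q"
        using less.hyps[of y p] less.hyps[of q y] y py less.prems(2) by auto
      then show False using neq arc_Un[of p y q] y by (simp add: image_Un)
    qed
    have cardeq: "card (v ` ?A) = card ?A" by (rule card_image) (rule inj_on_subset[OF inj subset_UNIV])
    have "?A - v ` ?A \<noteq> {}"
      using neq card_subset_eq[of "v ` ?A" ?A] fin cardeq by auto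
    then have out: "?A - v ` ?A = {E p}" using entry by auto
    have "card (v ` ?A - ?A) = card (?A - v ` ?A)"
      using cardeq fin by (intro card_Diff_commute) auto
    then obtain y0 where y0: "v ` ?A - ?A = {y0}"
      using out by (metis card_1_singletonE card.empty card.insert empty_iff finite.emptyI One_nat_def)
    have vA: "v ` ?A = insert y0 (?A - {E p})" using out y0 by auto
    have y0v: "y0 \<in> v ` ?A" "y0 \<notin> ?A" using y0 by blast+
    then have y0X: "y0 \<in> X" "y0 \<notin> ?A" using AX W_X[OF D(2)] by auto
    have pA: "E p \<in> ?A" using out by auto
    have "v (\<Sum>?A) = \<Sum>(v ` ?A)"
      using inj D(4) by (simp add: linear_sum sum.reindex inj_on_subset)
    also have "\<dots> = y0 + (\<Sum>?A - E p)"
      unfolding vA using fin y0X pA by (simp add: sum_diff1)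
    finally have vu: "v (\<Sum>?A) - \<Sum>?A = y0 - E p" by simp
    have wu: "w (\<Sum>?A) = \<Sum>?A" using fixes_sum_iff[OF w cons] less.prems by simp
    show False
    proof (cases "y0 = - E p")
      case False
      then have "y0 - E p \<in> roots"
        using y0X pA by (intro rootI) (auto simp: equation_minus_iff)
      then show False using optimal_no_root[OF w v wu, of 1 "y0 - E p"] vu by simp
    next
      case True
      obtain i where i: "v (E i) = y0" "p \<le> i" "i < q" using y0v by (auto simp: arc_def)
      let ?P = "arc (i + 1) (p + m)" and ?Q = "arc p (p + m)"
      have vP: "v ` ?P = ?P"
        using NC_arc_short[OF D(1), of i "p + m"] i True less.prems by (simp add: E_add_m)
      then have wP: "w ` ?P = ?P" using inv consistent_arc i by simp
      have Q: "?Q = ?A \<union> ?P" using arc_Un_overlap[of p "i + 1" q "p + m"] i less.prems by simp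
      have wQ: "w ` ?Q = ?Q" using wP less.prems Q by (simp add: image_Un)
      \<comment> \<open>\<open>w\<close> preserves the half circle, so parity prevents
        \<open>z\<close> from changing sign.\<close>
      have wz: "w z = z"
      proof -
        have "w h \<in> half p z" if "h \<in> half p z" "h \<noteq> z" for h
          using that W_mem_image_iff[OF w wQ, of h] unfolding half_def by blast
        then have "w z \<in> half p z"
          using half_system_rest[OF w half_system_half[of z p], of z] by (auto simp: half_def)
        moreover have "w z \<notin> ?Q" using W_mem_image_iff[OF w wQ] centre_notin_arc by blast
        ultimately show ?thesis by (simp add: half_def)
      qed
      have vQ: "v h \<in> ?Q" if "h \<in> ?Q" "h \<noteq> E i" for h
      proof (cases "h \<in> ?P")
        case True
        then show ?thesis using vP Q by blast
      next
        case False
        then have "h \<in> ?A" using that Q by blast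
        then have "v h \<in> insert y0 (?A - {E p})" using vA by blast
        moreover have "v h \<noteq> y0" using that i W_eq_iff[OF D(2)] by metis
        ultimately show ?thesis using Q by blast
      qed
      have "v (E i) \<notin> ?Q" using i True neg_E_notin_arc[of p p "p + m"] m_ge by simp
      moreover have "v (E i) \<notin> {z, - z}"
        using i(1) True E_neq_z(5)[of p] E_neq_z(6)[of p] by simp
      ultimately have out_i: "v (E i) \<notin> half p y" "E i \<in> ?Q" if "y \<in> {z, - z}" for y
        using i that less.prems unfolding half_def by (blast, simp add: arcI)
      \<comment> \<open>\<open>E i\<close> leaves the half system for either central point, and no
        other circle point does; by parity the central point has to leave as well.\<close>
      have flip: "v y \<notin> half p y" if y: "y \<in> {z, - z}" for y
      proof
        assume "v y \<in> half p y"
        then have "{h \<in> half p y. v h \<notin> half p y} = {E i}"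
          using out_i[OF y] vQ by (auto simp: half_def)
        then show False using W_even[OF D(2) half_system_half[OF y], of p] by simp
      qed
      have "v z \<notin> half p z" using flip by blast
      moreover have "v (- z) \<notin> half p (- z)" using flip by blast
      then have "v z \<in> half p (- z)"
        using half_system_half[of "- z" p] W_X[OF D(2) z_X] W_neg[OF D(2), of z]
        unfolding half_system_def by auto
      ultimately have vz: "v z = - z" by (auto simp: half_def)
      \<comment> \<open>Alone, the arc sum moves by -2 times \<open>E p\<close>, no multiple of a
        root; with \<open>z\<close> added it moves by -2 times the root
        \<open>E p + z\<close>.\<close>
      have "v (\<Sum>?A + z) - (\<Sum>?A + z) = (v (\<Sum>?A) - \<Sum>?A) + (v z - z)"
        using D(4) by (simp add: linear_add)
      also have "\<dots> = (-2) *\<^sub>R (E p - (- z))"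
        unfolding vu vz True by (simp add: algebra_simps scaleR_2)
      finally have "v (\<Sum>?A + z) - (\<Sum>?A + z) = (-2) *\<^sub>R (E p - (- z))" .
      moreover have "w (\<Sum>?A + z) = \<Sum>?A + z" using wu wz W_linear[OF w] by (simp add: linear_add)
      moreover have "E p - (- z) \<in> roots" using neg_z_X E_neq_z by (intro rootI) auto
      ultimately show False using optimal_no_root[OF w v] by (metis neg_equal_0_iff_equal zero_neq_numeral)
    qed
  qed
qed

text \<open>\<open>N\<close> holds the points of the half system missed by its image. At most one
  lies on the circle and their number is even, so \<open>N = {y, b}\<close>. The sum then moves by
  -2 times the root \<open>b + y\<close>.\<close>

lemma optimal_half:
  assumes w: "w \<in> W" and v: "optimal w v" and y: "y \<in> {z, - z}" and wH: "w ` half p y = half p y"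
  shows "v ` half p y = half p y"
proof (rule ccontr)
  note D = optimalD[OF v]
  let ?H = "half p y"
  assume neq: "v ` ?H \<noteq> ?H"
  have hs: "half_system ?H" using half_system_half y by blast
  then have HX: "?H \<subseteq> X" by (simp add: half_system_def)
  have fin: "finite ?H" using HX finite_X finite_subset by blast
  have inj: "inj v" using W_bij D(2) bij_is_inj by blast
  define N where "N = ?H - v ` ?H"
  have notin: "finv v b \<in> X" "finv v b \<notin> ?H" "v (finv v b) = b" if "b \<in> N" for b
    using that D(2) W_X W_inv HX unfolding N_def by (auto simp: image_iff)
  \<comment> \<open>For \<open>k\<close> other than \<open>p\<close>, the upper part of the split
    cannot be invariant under \<open>w\<close>: it would be so under \<open>v\<close>, and
    \<open>E k\<close> would be covered.\<close>
  have low: "v ` arc p k = arc p k" if k: "E k \<in> N" "p \<le> k" "k < p + m" for k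
  proof -
    have H: "?H = arc p (p + m) \<union> {y}" by (auto simp: half_def)
    have split: "w ` arc p k = arc p k \<or> w ` arc k (p + m) = arc k (p + m)"
      using invariant_arc_split[OF D(1) w D(3) _ H wH _ k(2,3) notin[OF k(1)]] y by simp
    have "w ` arc p k = arc p k"
    proof (cases "k = p")
      case False
      have "w ` arc k (p + m) \<noteq> arc k (p + m)"
      proof
        assume "w ` arc k (p + m) = arc k (p + m)"
        then have "v ` arc k (p + m) = arc k (p + m)"
          using False k by (intro optimal_arc[OF w v]) auto
        moreover have "E k \<in> arc k (p + m)" using k by (simp add: arcI)
        ultimately have "E k \<in> v ` arc k (p + m)" by simp
        moreover have "arc k (p + m) \<subseteq> ?H" using k by (auto simp: half_def arc_def)
        ultimately have "E k \<in> v ` ?H" by blast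
        then show False using k by (simp add: N_def)
      qed
      then show ?thesis using split by blast
    qed (simp add: arc_def)
    then show ?thesis using k by (intro optimal_arc[OF w v]) auto
  qed
  \<comment> \<open>The earlier of two missed circle points lies in the \<open>v\<close>-invariant
    arc ending at the later one, so it is covered.\<close>
  have uniq: "k = l" if "E k \<in> N" "p \<le> k" "k < p + m" "E l \<in> N" "p \<le> l" "l < p + m" for k l
  proof (rule ccontr)
    assume "k \<noteq> l"
    { fix k l assume kl: "k < l" "E k \<in> N" "p \<le> k" "k < p + m" "E l \<in> N" "p \<le> l" "l < p + m"
      then have "E k \<in> arc p l" by (simp add: arcI)
      then have "E k \<in> v ` arc p l" using low kl by blast
      moreover have "arc p l \<subseteq> ?H" using arc_Un[of p l "p + m"] kl by (auto simp: half_def)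
      ultimately have False using kl by (auto simp: N_def) }
    then show False using that \<open>k \<noteq> l\<close> by (meson linorder_neqE)
  qed
  have cardeq: "card (v ` ?H) = card ?H" by (rule card_image) (rule inj_on_subset[OF inj subset_UNIV])
  have "card (v ` ?H - ?H) = card N"
    unfolding N_def using cardeq fin by (intro card_Diff_commute) auto
  moreover have "v ` ?H - ?H = v ` {h \<in> ?H. v h \<notin> ?H}" by auto
  ultimately have "card N = card {h \<in> ?H. v h \<notin> ?H}"
    using card_image[OF inj_on_subset[OF inj subset_UNIV], of "{h \<in> ?H. v h \<notin> ?H}"] by simp
  then have even: "even (card N)" using W_even[OF D(2) hs] by simp
  have finN: "finite N" using fin by (simp add: N_def)
  have "N \<noteq> {}"
    using neq card_subset_eq[of "v ` ?H" ?H] fin cardeq by (auto simp: N_def)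
  then have "card N \<noteq> 0" using finN by simp
  then have "card N \<ge> 2" using even by (cases "card N = 1") auto
  moreover have "card (N - {y}) \<le> 1"
  proof -
    have "a = b" if "a \<in> N - {y}" "b \<in> N - {y}" for a b
    proof -
      have "a \<in> arc p (p + m)" "b \<in> arc p (p + m)" using that by (auto simp: N_def half_def)
      then obtain k l where "a = E k" "b = E l" "p \<le> k" "k < p + m" "p \<le> l" "l < p + m"
        by (auto simp: arc_def)
      then show ?thesis using that uniq[of k l] by simp
    qed
    then show ?thesis using finN by (simp add: card_le_Suc0_iff_eq)
  qed
  ultimately have "y \<in> N" and "card (N - {y}) = 1"
    using finN by (auto simp: card_Diff_singleton_if split: if_splits)
  then obtain b where b: "N - {y} = {b}" by (metis card_1_singletonE)
  then have N: "N = {y, b}" "b \<noteq> y" using \<open>y \<in> N\<close> by auto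
  \<comment> \<open>The image is again a half system, so it contains the negatives of the missed
    vectors.\<close>
  have HN: "v ` ?H = (?H - N) \<union> uminus ` N"
  proof (intro equalityI subsetI)
    fix a assume a: "a \<in> v ` ?H"
    then have aX: "a \<in> X" using HX W_X[OF D(2)] by auto
    show "a \<in> (?H - N) \<union> uminus ` N"
    proof (cases "a \<in> ?H")
      case False
      then have "- a \<in> ?H" using hs aX by (auto simp: half_system_def)
      moreover have "- a \<notin> v ` ?H"
      proof
        assume "- a \<in> v ` ?H"
        then obtain h h' where "h \<in> ?H" "h' \<in> ?H" "v h = - a" "v h' = a" using a by auto
        then have "v h' = v (- h)" using W_neg[OF D(2)] by simp
        then have "h' = - h" using W_eq_iff[OF D(2)] by blast
        then show False using \<open>h \<in> ?H\<close> \<open>h' \<in> ?H\<close> hs HX by (auto simp: half_system_def)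
      qed
      ultimately have "- a \<in> N" by (simp add: N_def)
      then show ?thesis by (metis UnCI image_eqI minus_minus)
    qed (use a in \<open>auto simp: N_def\<close>)
  next
    fix a assume "a \<in> (?H - N) \<union> uminus ` N"
    then show "a \<in> v ` ?H"
    proof
      assume "a \<in> uminus ` N"
      then obtain b where b: "b \<in> N" "a = - b" by auto
      have "finv v a = - finv v b" using b D(2) W_inv W_neg by simp
      then have "finv v a \<in> ?H" using notin[OF b(1)] hs by (auto simp: half_system_def)
      then show ?thesis using W_finv_right[OF D(2), of a] by (intro image_eqI[of _ v "finv v a"]) auto
    qed (auto simp: N_def)
  qed
  have NX: "N \<subseteq> ?H" by (auto simp: N_def)
  have disj: "(?H - N) \<inter> uminus ` N = {}" using NX hs HX by (auto simp: half_system_def)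
  have "v (\<Sum>?H) = \<Sum>(v ` ?H)"
    using inj D(4) by (simp add: linear_sum sum.reindex inj_on_subset)
  also have "\<dots> = \<Sum>(?H - N) + \<Sum>(uminus ` N)"
    unfolding HN using disj fin finN by (intro sum.union_disjoint) auto
  also have "\<dots> = \<Sum>?H - \<Sum>N - \<Sum>N"
    using fin NX by (simp add: sum_diff sum.reindex sum_negf)
  also have "\<Sum>N = b - (- y)" using N by (simp add: add.commute)
  finally have "v (\<Sum>?H) - \<Sum>?H = (-2) *\<^sub>R (b - (- y))" by (simp add: algebra_simps scaleR_2)
  moreover have "w (\<Sum>?H) = \<Sum>?H"
    using fixes_sum_iff[OF w half_system_consistent[OF hs]] wH by simp
  moreover have "b - (- y) \<in> roots"
    using N NX HX hs neg_X by (intro rootI) (auto simp: half_system_def)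
  ultimately show False using optimal_no_root[OF w v] by (metis neg_equal_0_iff_equal zero_neq_numeral)
qed

text \<open>The cases are those whose preimages under \<open>c - 1\<close> are arc sums and
  half-system sums. A difference at distance beyond \<open>m\<close> is rewritten by
  \<open>E j - E i = E (i + m) - E (j - m)\<close>.\<close>

lemma root_cases:
  assumes "b \<in> roots"
  obtains (arc) p q where "p < q" "q < p + m" "b = E q - E p"
    | (half) p y where "y \<in> {z, - z}" "b = E p + y"
proof -
  obtain x y where xy: "x \<in> X" "y \<in> X" "y \<noteq> x" "y \<noteq> - x" "b = x - y"
    using assms by (auto simp: roots_def)
  from xy(1) show thesis
  proof (cases rule: X_cases)
    case x: (circle j0)
    from xy(2) show thesis
    proof (cases rule: X_cases)
      case y: (circle i)
      obtain j where j: "E j0 = E j" "i \<le> j" "j < i + 2 * m" using E_normalize by blast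
      have "j \<noteq> i" "j \<noteq> i + m" using xy x y j E_add_m[of i] by auto
      then consider "j < i + m" "i < j" | "i + m < j" using j by linarith
      then show thesis
      proof cases
        case 1
        then show thesis using arc[of i j] xy x y j by simp
      next
        case 2
        then show thesis
          using arc[of "j - m" "i + m"] xy x y j by (simp add: E_add_m E_sub_m)
      qed
    next
      case y: centre
      then show thesis using half[of "- y" j0] xy x by auto
    qed
  next
    case x: centre
    from xy(2) show thesis
    proof (cases rule: X_cases)
      case y: (circle i)
      then show thesis using half[OF x, of "i + m"] xy by (simp add: E_add_m)
    next
      case y: centre
      then show thesis using x xy by auto
    qed
  qed
qed

text \<open>\<open>fixspace v'\<close> is the preimage under \<open>c - 1\<close> of a space spanned
  by roots. Each such root has an arc or half-system sum, up to a factor, as preimage;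
  \<open>w\<close> fixes it, hence so does \<open>v\<close>.\<close>

lemma optimal_maximum:
  assumes w: "w \<in> W" and v: "optimal w v" and v': "v' \<in> NCset" "fixspace v' \<subseteq> fixspace w"
  shows "fixspace v' \<subseteq> fixspace v"
proof
  note D = optimalD[OF v]
  define L where "L = (\<lambda>x. c x - x) ` fixspace v"
  have "linear (\<lambda>x. c x - x)" using linear_c by (intro linear_compose_sub linear_ident)
  then have subL: "subspace L"
    unfolding L_def using subspace_fixspace[OF D(4)] by (rule linear_subspace_image)
  have fix': "fixspace v' = {f. c f - f \<in> movspace (c \<circ> finv v')}"
    using divides_coxeter_fixspace v' NCsetD by blast
  have "b \<in> L" if b: "b \<in> roots" "b \<in> movspace (c \<circ> finv v')" for b
  proof -
    obtain g where g: "c g - g = b" using surj_c_minus_1 by blast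
    then have wg: "w g = g" using b fix' v'(2) by (auto simp: fixspace_iff)
    from b(1) have "v g = g"
    proof (cases rule: root_cases)
      case (arc p q)
      have A: "\<Sum>(arc p q) = S p q" using arc m_ge by (intro sum_arc) auto
      have "c g - g = c (S p q) - S p q" using c_S[of p q] g arc by simp
      then have gS: "g = \<Sum>(arc p q)" unfolding A by (rule inj_c_minus_1)
      have cons: "consistent (arc p q)" using arc by (intro consistent_arc) auto
      have "w ` arc p q = arc p q" using fixes_sum_iff[OF w cons] wg gS by simp
      then have "v ` arc p q = arc p q" using optimal_arc[OF w v] arc by blast
      then show ?thesis using fixes_sum_iff[OF D(2) cons] gS by simp
    next
      case (half p y)
      let ?h = "\<Sum>(half p y)"
      have "c ((-1/2) *\<^sub>R ?h) - (-1/2) *\<^sub>R ?h = (-1/2) *\<^sub>R (c ?h - ?h)"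
        unfolding linear_scale[OF linear_c] scaleR_diff_right ..
      also have "\<dots> = c g - g" using c_half[OF half(1)] g half(2) by simp
      finally have g': "g = (-1/2) *\<^sub>R ?h" using inj_c_minus_1 by metis
      then have h: "?h = (-2) *\<^sub>R g" by simp
      have cons: "consistent (half p y)" using half consistent_half by blast
      have "w ?h = ?h" unfolding h linear_scale[OF W_linear[OF w]] wg ..
      then have "w ` half p y = half p y" using fixes_sum_iff[OF w cons] by simp
      then have "v ` half p y = half p y" using optimal_half[OF w v half(1)] by blast
      then have "v ?h = ?h" using fixes_sum_iff[OF D(2) cons] by simp
      then show ?thesis unfolding g' linear_scale[OF D(4)] by simp
    qed
    then show ?thesis using g by (auto simp: L_def fixspace_iff image_iff)
  qed
  then have "span (roots \<inter> movspace (c \<circ> finv v')) \<subseteq> L"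
    using subL by (intro span_minimal) auto
  moreover have "c \<circ> finv v' \<in> W" using v' NCsetD W_inv W_comp c_W by blast
  ultimately have mov: "movspace (c \<circ> finv v') \<subseteq> L"
    using movspace_subset_span_roots by blast
  fix f assume "f \<in> fixspace v'"
  then have "c f - f \<in> L" using fix' mov by blast
  then obtain g where "c f - f = c g - g" "g \<in> fixspace v" by (auto simp: L_def)
  then show "f \<in> fixspace v" using inj_c_minus_1 by metis
qed

text \<open>The join is some chosen least upper bound. It lies below any optimal \<open>v\<close>,
  so its codimension is at most that of \<open>v\<close>, and it inherits optimality.\<close>

lemma optimal_nc_projection:
  assumes w: "w \<in> W"
  shows "optimal w (nc_projection G T c w)"
proof -
  let ?L = "NC G T c" and ?A = "{t \<in> T. absolute_le G T t w}"
  have le: "x \<sqsubseteq>\<^bsub>?L\<^esub> y \<longleftrightarrow> absolute_le G T x y" for x y by (simp add: NC_def)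
  have T_NC: "T \<subseteq> NCset"
  proof
    fix t assume "t \<in> T"
    then obtain b where b: "b \<in> roots" "t = orthogonal_reflection b" by (auto simp: T_def)
    then have tW: "t \<in> W" using W_refl by blast
    have "absolute_le G T t c"
      using absolute_le_reflection_iff[OF b(1) c_W] b movspace_eq_UNIV[OF orth_c fix_c] by simp
    then show "t \<in> NCset"
      using absolute_le_iff[OF tW c_W] tW W_orth[OF tW] movspace_eq_UNIV[OF orth_c fix_c]
      by (simp add: NCset_def divides_coxeter_def add.commute)
  qed
  have Upper: "Upper ?L ?A = {v \<in> NCset. fixspace v \<subseteq> fixspace w}"
    using reflections_le_iff[OF _ w] NCsetD T_NC unfolding Upper_def carrier_NC le by blast
  obtain v where v: "optimal w v" using ex_optimal[OF w] by blast
  note D = optimalD[OF v]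
  have "least ?L v (Upper ?L ?A)"
    unfolding least_def Upper carrier_NC le
  proof (intro conjI ballI)
    fix x assume x: "x \<in> {v \<in> NCset. fixspace v \<subseteq> fixspace w}"
    then have "fixspace x \<subseteq> fixspace v" using optimal_maximum[OF w v] by blast
    then have "dim (movspace (x \<circ> finv v)) + dim (movspace v) = dim (movspace x)"
      using divides_coxeter_mono[of v x] x D(1) NCsetD(2) by blast
    then show "absolute_le G T v x"
      using absolute_le_iff[OF D(2), of x] x NCsetD(1) by blast
  qed (use D in auto)
  then have "least ?L (nc_projection G T c w) (Upper ?L ?A)"
    unfolding nc_projection_def sup_def by (rule someI[of "\<lambda>x. least ?L x (Upper ?L ?A)"])
  then have p: "nc_projection G T c w \<in> NCset" "fixspace (nc_projection G T c w) \<subseteq> fixspace w"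
      and pv: "absolute_le G T (nc_projection G T c w) v"
    using D unfolding least_def Upper carrier_NC le by auto
  have "dim (movspace (nc_projection G T c w)) \<le> dim (movspace v)"
    using pv absolute_le_iff[of "nc_projection G T c w" v] p D NCsetD by auto
  then have "dim (fixspace v) \<le> dim (fixspace (nc_projection G T c w))"
    using dim_fixspace_movspace[of v] dim_fixspace_movspace[of "nc_projection G T c w"]
      W_orth[OF D(2)] W_orth[OF NCsetD(1)[OF p(1)]] by linarith
  then show ?thesis using p D unfolding optimal_def by (meson order_trans)
qed

end

section \<open>Dynamics of the pop operator\<close>

context D_coxeter
begin

text \<open>Parity settles the centre once the circle is fixed.\<close>

lemma fixes_circle_imp_id:
  assumes w: "w \<in> W" and fixed: "\<And>i. w (E i) = E i"
  shows "w = id"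
proof -
  have "w h \<in> half 0 z" if "h \<in> half 0 z" "h \<noteq> z" for h
    using that fixed by (auto simp: half_def arc_def)
  then have "w z \<in> half 0 z"
    using half_system_rest[OF w half_system_half[of z 0], of z] by (auto simp: half_def)
  moreover have "w z \<noteq> E i" for i
    using W_eq_iff[OF w, of z "E i"] fixed E_neq_z by metis
  ultimately have "w z = z" by (auto simp: half_def arc_def)
  then have "w a = id a" if "a \<in> X" for a
    using that fixed W_neg[OF w] by (auto simp: X_eq)
  then show ?thesis using linear_eq_on_X[OF W_linear[OF w] linear_id] by blast
qed

abbreviation proj :: "('a \<Rightarrow> 'a) \<Rightarrow> 'a \<Rightarrow> 'a" where
  "proj \<equiv> nc_projection G T c"

abbreviation pop :: "('a \<Rightarrow> 'a) \<Rightarrow> 'a \<Rightarrow> 'a" where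
  "pop \<equiv> Pop G T c"

lemmas projD = optimalD[OF optimal_nc_projection]

lemma pop_eq: "w \<in> W \<Longrightarrow> pop w = w \<circ> finv (proj w)"
  using projD(2)[of w] by (simp add: Pop_def inv_G mult_G)

lemma pop_W: "w \<in> W \<Longrightarrow> pop w \<in> W"
  by (simp add: pop_eq W_comp W_inv projD(2))

lemma funpow_pop_W: "w \<in> W \<Longrightarrow> (pop ^^ k) w \<in> W"
  by (induction k) (simp_all add: pop_W)

text \<open>The orbit of \<open>w\<close> is followed through the preimages of a fixed point: these are moved by the
  projections.\<close>

lemma finv_pop:
  assumes "w \<in> W"
  shows "finv (pop w) a = proj w (finv w a)"
proof -
  have "pop w (proj w (finv w a)) = a" using assms projD(2) by (simp add: pop_eq)
  then show ?thesis using W_finv_left[OF pop_W[OF assms]] by metis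
qed

lemma proj_inv_imp:
  assumes "w \<in> W" "consistent A" "proj w ` A = A"
  shows "w ` A = A" "pop w ` A = A"
proof -
  show *: "w ` A = A"
    using fixspace_mono_image[OF projD(2) _ projD(3)] assms by blast
  have "finv (proj w) ` A = A"
    using assms(3) projD(2)[OF assms(1)]
    by (metis W_bij bij_is_inj image_inv_f_f)
  then show "pop w ` A = A" using * assms by (metis image_comp pop_eq)
qed

lemma proj_fixes: "w \<in> W \<Longrightarrow> w (E i) = E i \<Longrightarrow> proj w (E i) = E i"
  using optimal_arc[OF _ optimal_nc_projection, of w i "i + 1"] m_ge
  by (simp add: arc_def atLeastLessThanPlusOne_atLeastAtMost_int)

text \<open>\<open>d\<close> is the distance that the preimage has yet to travel. Overtaking
  \<open>E j\<close> would give an arc invariant under \<open>w\<close> that contains only one of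
  \<open>E (j - d)\<close> and its image \<open>E j\<close>. Entering the centre makes a half circle
  ending at \<open>E (j - d)\<close> contain \<open>E j\<close>, which needs
  \<open>d > m\<close>.\<close>

lemma proj_circle:
  assumes w: "w \<in> W" and a: "finv w (E j) = E (j - d)" and d: "0 < d" "d < 2 * m"
  obtains (move) d' where "proj w (E (j - d)) = E (j - d')" "0 \<le> d'" "d' < d"
    | (enter) "proj w (E (j - d)) \<in> {z, - z}" "m < d"
proof -
  let ?v = "proj w"
  note D = projD[OF w]
  have wa: "w (E (j - d)) = E j" using a W_finv_right[OF w] by metis
  have "?v (E (j - d)) \<in> X" using W_X[OF D(2)] by simp
  then show thesis
  proof (cases rule: X_cases)
    case (circle i0)
    \<comment> \<open>Staying in place counts here as a full turn, \<open>i = j - d + 2 * m\<close>,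
      and is excluded together with overtaking.\<close>
    obtain i where i: "E i0 = E i" "j - d + 1 \<le> i" "i < j - d + 1 + 2 * m"
      using E_normalize by blast
    have vi: "?v (E (j - d)) = E i" using circle i by simp
    have "i \<le> j"
    proof (rule ccontr)
      assume ij: "\<not> i \<le> j"
      show False
      proof (cases "i \<le> j - d + m + 1")
        case True
        have "?v ` arc (j - d + 1) i = arc (j - d + 1) i"
          using NC_arc_short[OF D(1) vi] True i by simp
        then have "w ` arc (j - d + 1) i = arc (j - d + 1) i"
          using proj_inv_imp[OF w] consistent_arc True by simp
        moreover have "E j \<in> arc (j - d + 1) i" using d ij by (simp add: arcI)
        ultimately have "E (j - d) \<in> arc (j - d + 1) i"
          using W_mem_image_iff[OF w] wa by metis
        then obtain k where "E (j - d) = E k" "j - d + 1 \<le> k" "k < i" by (auto simp: arc_def)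
        then show False using E_eq_imp_eq[of "j - d" k] i by auto
      next
        case False
        let ?B = "arc i (j - d + 2 * m + 1)"
        have "?v ` ?B = ?B" using NC_arc_long[OF D(1) vi] False i by simp
        then have "w ` ?B = ?B" using proj_inv_imp[OF w] consistent_arc False by simp
        moreover have "E (j - d) \<in> ?B"
          using arcI[of i "j - d + 2 * m" "j - d + 2 * m + 1"] i E_add_2m[of "j - d"] by simp
        ultimately have "E j \<in> ?B" using W_mem_image_iff[OF w] wa by metis
        then obtain k where "E j = E k" "i \<le> k" "k < j - d + 2 * m + 1" by (auto simp: arc_def)
        then show False using E_eq_imp_eq[of j k] ij d by auto
      qed
    qed
    then show thesis using move[of "j - i"] vi i by simp
  next
    case centre
    let ?y = "?v (E (j - d))"
    let ?H = "half (j - d - m + 1) ?y"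
    have "?v ` ?H = ?H" using NC_half_enter[OF D(1) _ centre, of "j - d"] by simp
    then have "w ` ?H = ?H" using proj_inv_imp(1)[OF w] consistent_half centre by blast
    moreover have "E (j - d) \<in> arc (j - d - m + 1) (j - d - m + 1 + m)" using m_ge by (simp add: arcI)
    ultimately have "E j \<in> ?H" using wa W_mem_image_iff[OF w] unfolding half_def by (metis insertI2)
    then have "E j \<in> arc (j - d - m + 1) (j - d - m + 1 + m)" using centre E_neq_z by (auto simp: half_def)
    then obtain k where k: "E j = E k" "j - d - m + 1 \<le> k" "k < j - d + 1" by (auto simp: arc_def)
    have "m < d"
    proof (rule ccontr)
      assume "\<not> m < d"
      then have "j = k" using k d E_eq_imp_eq[of j k] by auto
      then show False using k d by simp
    qed
    then show thesis using enter centre by blast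
  qed
qed

text \<open>The projection fixes only what \<open>w\<close> fixes, so \<open>y\<close> moves. If it
  leaves at \<open>E x\<close>, the half system of \<open>x\<close> and \<open>y\<close> is
  \<open>w\<close>-invariant and contains \<open>y\<close>, hence also \<open>E j\<close>.\<close>

lemma proj_centre:
  assumes w: "w \<in> W" and y: "y \<in> {z, - z}" "finv w (E j) = y"
  obtains (flip) "proj w y = - y"
    | (exit) d where "proj w y = E (j - d)" "0 \<le> d" "d < m"
proof -
  let ?v = "proj w"
  note D = projD[OF w]
  have wy: "w y = E j" using y W_finv_right[OF w] by metis
  have yX: "y \<in> X" using y z_X neg_z_X by auto
  have "?v y \<in> X" using W_X[OF D(2) yX] .
  then show thesis
  proof (cases rule: X_cases)
    case (circle x)
    have H: "?v ` half x y = half x y" using NC_half_exit[OF D(1) circle y(1)] .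
    then have "w ` half x y = half x y" using proj_inv_imp(1)[OF w] consistent_half y by blast
    then have "E j \<in> half x y" using wy W_mem_image_iff[OF w] unfolding half_def by (metis insertI1)
    then have "E j \<in> arc x (x + m)" using y E_neq_z by (auto simp: half_def)
    then obtain k where k: "E j = E k" "x \<le> k" "k < x + m" by (auto simp: arc_def)
    obtain t where t: "j = k + 2 * m * t" using E_inj[OF k(1)] by (auto simp: dvd_def algebra_simps)
    have "E (j - (k - x)) = E x" using E_add_mult[of x t] t by (simp add: algebra_simps)
    then show thesis using exit[of "k - x"] circle k by simp
  next
    case centre
    have "?v y \<noteq> y"
    proof
      assume "?v y = y"
      then have "w y = y" using D(3) by (auto simp: fixspace_iff)
      then show False using wy y E_neq_z by auto
    qed
    then show thesis using flip centre y(1) by (metis insertE minus_minus singletonD)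
  qed
qed

section \<open>Upper bound: preimages along an orbit\<close>

context
  fixes w0 :: "'a \<Rightarrow> 'a"
  assumes w0: "w0 \<in> W"
begin

definition wk :: "nat \<Rightarrow> 'a \<Rightarrow> 'a" where "wk k = (pop ^^ k) w0"

definition tr :: "nat \<Rightarrow> 'a \<Rightarrow> 'a" where "tr k a = finv (wk k) a"

lemma wk_W: "wk k \<in> W"
  by (simp add: wk_def funpow_pop_W w0)

lemma tr_Suc: "tr (Suc k) a = proj (wk k) (tr k a)"
  using finv_pop[OF wk_W[of k]] by (simp add: tr_def wk_def)

lemma tr_eq_iff: "tr k a = tr k b \<longleftrightarrow> a = b"
  using W_eq_iff[OF W_inv[OF wk_W]] by (simp add: tr_def)

lemma tr_neg: "tr k (- a) = - tr k a"
  using W_neg[OF W_inv[OF wk_W]] by (simp add: tr_def)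

lemma tr_X: "a \<in> X \<Longrightarrow> tr k a \<in> X"
  using W_X[OF W_inv[OF wk_W]] by (simp add: tr_def)

lemma tr_fixed: "tr k (E j) = E j \<Longrightarrow> tr (Suc k) (E j) = E j"
  using proj_fixes[OF wk_W, of k j] W_finv_right[OF wk_W, of k "E j"] unfolding tr_Suc
  by (simp add: tr_def)

text \<open>Within distance \<open>m\<close> the centre is out of reach, so every step gains a
  position until the target is reached for good.\<close>

lemma tr_close:
  assumes "tr k (E j) = E (j - d)" "0 \<le> d" "d \<le> m"
  shows "\<exists>d'. tr (k + t) (E j) = E (j - d') \<and> 0 \<le> d' \<and> d' \<le> max 0 (d - int t)"
proof (induction t)
  case (Suc t)
  then obtain d' where d': "tr (k + t) (E j) = E (j - d')" "0 \<le> d'" "d' \<le> max 0 (d - int t)" by blast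
  show ?case
  proof (cases "d' = 0")
    case True
    then show ?thesis using d' tr_fixed[of "k + t" j] by (intro exI[of _ 0]) simp
  next
    case False
    have pre: "finv (wk (k + t)) (E j) = E (j - d')" "0 < d'" "d' < 2 * m"
      using d' False assms m_ge by (simp_all add: tr_def)
    from proj_circle[OF wk_W pre]
    consider (move) d'' where "proj (wk (k + t)) (E (j - d')) = E (j - d'')" "0 \<le> d''" "d'' < d'" | "m < d'"
      by metis
    then show ?thesis
    proof cases
      case (move d'')
      then show ?thesis
        using d' False by (intro exI[of _ d'']) (auto simp: tr_Suc)
    qed (use False d' assms in auto)
  qed
qed (use assms in auto)

lemma tr_close_end:
  assumes "tr k (E j) = E (j - d)" "0 \<le> d" "d \<le> m" "d \<le> int t"
  shows "tr (k + t) (E j) = E j"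
  using tr_close[OF assms(1-3), of t] assms(4) by auto

text \<open>A detour through the centre costs nothing: it takes two steps and shortens the distance
  by at least two.\<close>

lemma tr_circle_end:
  assumes "tr k (E j) = E (j - d)" "0 \<le> d" "d < 2 * m" "d \<le> int t"
  shows "tr (k + t) (E j) = E j"
  using assms
proof (induction "nat d" arbitrary: d k t rule: less_induct)
  case less
  show ?case
  proof (cases "d = 0")
    case True
    then show ?thesis using tr_close_end[OF less.prems(1)] less.prems m_ge by simp
  next
    case False
    then obtain t' where t': "t = Suc t'" using less.prems by (cases t) auto
    have pre: "finv (wk k) (E j) = E (j - d)" "0 < d" "d < 2 * m"
      using less.prems False by (simp_all add: tr_def)
    from proj_circle[OF wk_W pre]
    consider (move) d' where "proj (wk k) (E (j - d)) = E (j - d')" "0 \<le> d'" "d' < d"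
      | (enter) "proj (wk k) (E (j - d)) \<in> {z, - z}" "m < d"
      by metis
    then show ?thesis
    proof cases
      case (move d')
      then have "tr (Suc k + t') (E j) = E j"
        using less.hyps[of d' "Suc k" t'] less.prems t' by (simp add: tr_Suc)
      then show ?thesis using t' by simp
    next
      case enter
      define y where "y = proj (wk k) (E (j - d))"
      have y: "y \<in> {z, - z}" using enter by (simp add: y_def)
      let ?H = "half (j - d - m + 1) y"
      have "proj (wk k) ` ?H = ?H"
        using NC_half_enter[OF projD(1)[OF wk_W] _ y, of k "j - d"] y_def by simp
      then have "wk (Suc k) ` ?H = ?H"
        using proj_inv_imp(2)[OF wk_W consistent_half[OF y]] by (simp add: wk_def)
      \<comment> \<open>The half system attached to the entry is invariant under the next iterate
        too, hence under its projection. It contains \<open>y\<close> but not \<open>- y\<close>, so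
        flipping is impossible.\<close>
      then have H: "proj (wk (Suc k)) ` ?H = ?H"
        using optimal_half[OF wk_W optimal_nc_projection[OF wk_W] y] by blast
      have trS: "tr (Suc k) (E j) = y" using less.prems by (simp add: tr_Suc y_def)
      then have pre': "finv (wk (Suc k)) (E j) = y" by (simp add: tr_def)
      from proj_centre[OF wk_W y pre']
      consider (flip) "proj (wk (Suc k)) y = - y"
        | (exit) d' where "proj (wk (Suc k)) y = E (j - d')" "0 \<le> d'" "d' < m"
        by metis
      then show ?thesis
      proof cases
        case flip
        then have "- y \<in> ?H" using H by (metis half_def image_eqI insertI1)
        then show ?thesis
          using half_system_half[OF y] y z_X neg_z_X unfolding half_system_def half_def by blast
      next
        case (exit d')
        then have "tr (k + 2) (E j) = E (j - d')" using trS tr_Suc[of "Suc k"] by simp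
        \<comment> \<open>\<open>d' < m < d\<close> gives \<open>d' \<le> d - 2\<close>.\<close>
        moreover have idx: "k + t = k + 2 + (t - 2)" and "d' \<le> int (t - 2)"
          using enter exit less.prems m_ge by linarith+
        ultimately show ?thesis
          unfolding idx using exit by (intro tr_close_end[of "k + 2" j d']) auto
      qed
    qed
  qed
qed

text \<open>While the preimage of \<open>E j\<close> flips between the two central points, all other points keep
  moving on the circle.\<close>

lemma tr_flipping:
  assumes y: "tr 0 (E j) = y" "y \<in> {z, - z}"
    and flips: "\<And>i. i < s \<Longrightarrow> proj (wk i) (tr i (E j)) = - tr i (E j)"
  shows "tr s (E j) \<in> {z, - z}"
    and "E l \<noteq> E j \<Longrightarrow> E l \<noteq> - E j \<Longrightarrow>
      \<exists>d. tr s (E l) = E (l - d) \<and> 0 \<le> d \<and> d \<le> max 0 (2 * m - 1 - int s)"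
proof -
  have centre: "tr i (E j) \<in> {z, - z}" if "i \<le> s" for i
    using that
  proof (induction i)
    case (Suc i)
    then show ?case using flips[of i] by (auto simp: tr_Suc)
  qed (use y in simp)
  then show "tr s (E j) \<in> {z, - z}" by simp
  assume l: "E l \<noteq> E j" "E l \<noteq> - E j"
  have "\<exists>d. tr i (E l) = E (l - d) \<and> 0 \<le> d \<and> d \<le> max 0 (2 * m - 1 - int i)" if "i \<le> s" for i
    using that
  proof (induction i)
    case 0
    have "tr 0 (E l) \<noteq> tr 0 (E j)" "tr 0 (E l) \<noteq> - tr 0 (E j)"
      using l tr_eq_iff[of 0 "E l" "E j"] tr_eq_iff[of 0 "E l" "- E j"] by (auto simp: tr_neg)
    then have "tr 0 (E l) \<notin> {z, - z}" using y by auto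
    then obtain k where "tr 0 (E l) = E k" using tr_X[of "E l" 0] X_cases by auto
    moreover obtain i where "E k = E i" "l - 2 * m + 1 \<le> i" "i < l - 2 * m + 1 + 2 * m"
      using E_normalize by blast
    ultimately show ?case by (intro exI[of _ "l - i"]) auto
  next
    case (Suc i)
    then obtain d where d: "tr i (E l) = E (l - d)" "0 \<le> d" "d \<le> max 0 (2 * m - 1 - int i)" by auto
    show ?case
    proof (cases "d = 0")
      case True
      then show ?thesis using d tr_fixed[of i l] by (intro exI[of _ 0]) simp
    next
      case False
      have pre: "finv (wk i) (E l) = E (l - d)" "0 < d" "d < 2 * m"
        using d False by (simp_all add: tr_def)
      from proj_circle[OF wk_W pre]
      consider (move) d' where "proj (wk i) (E (l - d)) = E (l - d')" "0 \<le> d'" "d' < d"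
        | (enter) "proj (wk i) (E (l - d)) \<in> {z, - z}"
        by metis
      then show ?thesis
      proof cases
        case (move d')
        then show ?thesis using d False by (intro exI[of _ d']) (auto simp: tr_Suc)
      next
        case enter
        \<comment> \<open>The centre is occupied by the preimages of \<open>E j\<close> and
          \<open>- E j\<close>, so entering it contradicts injectivity.\<close>
        then have "tr (Suc i) (E l) = tr (Suc i) (E j) \<or> tr (Suc i) (E l) = - tr (Suc i) (E j)"
          using centre[of "Suc i"] Suc.prems d by (auto simp: tr_Suc)
        then have "tr (Suc i) (E l) = tr (Suc i) (E j) \<or> tr (Suc i) (E l) = tr (Suc i) (- E j)"
          by (simp add: tr_neg)
        then show ?thesis using l tr_eq_iff by blast
      qed
    qed
  qed
  then show "\<exists>d. tr s (E l) = E (l - d) \<and> 0 \<le> d \<and> d \<le> max 0 (2 * m - 1 - int s)" by blast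
qed

text \<open>After \<open>2 * m - 2\<close> flips every other circle point is within distance 1 of
  its target. The half system starting at \<open>E j\<close> is then mapped into itself, its central
  point by parity, so the projection preserves it and cannot flip that point.\<close>

lemma not_flipping_long:
  assumes y: "tr 0 (E j) \<in> {z, - z}"
    and flips: "\<And>i. i \<le> s \<Longrightarrow> proj (wk i) (tr i (E j)) = - tr i (E j)"
  shows "int s < 2 * m - 2"
proof (rule ccontr)
  assume "\<not> int s < 2 * m - 2"
  then have s: "max 0 (2 * m - 1 - int s) \<le> 1" by simp
  note fl = tr_flipping[OF refl y, of s]
  let ?y = "tr s (E j)"
  have yc: "?y \<in> {z, - z}" using fl(1) flips by simp
  let ?H = "half j ?y"
  have step: "tr s h \<in> ?H" if "h \<in> ?H" "h \<noteq> ?y" for h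
  proof -
    have "h \<in> arc j (j + m)" using that by (simp add: half_def)
    then obtain k where k: "h = E k" "j \<le> k" "k < j + m" by (auto simp: arc_def)
    show ?thesis
    proof (cases "k = j")
      case True
      then show ?thesis using k by (simp add: half_def)
    next
      case False
      have "E k \<noteq> E j" using False k E_eq_imp_eq[of k j] by auto
      moreover have "E k \<noteq> - E j"
        using False k E_eq_imp_eq[of k "j + m"] by (auto simp: E_add_m)
      ultimately obtain d where d: "tr s (E k) = E (k - d)" "0 \<le> d" "d \<le> 1"
        using fl(2)[of k] flips s by force
      then show ?thesis using k False arcI[of j "k - d" "j + m"] by (simp add: half_def)
    qed
  qed
  then have "tr s ?y \<in> ?H"
    using half_system_rest[OF W_inv[OF wk_W[of s]] half_system_half[OF yc], of ?y j]
    by (simp add: tr_def half_def)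
  then have sub: "finv (wk s) ` ?H \<subseteq> ?H" using step unfolding tr_def by blast
  have fin: "finite ?H" by (simp add: half_def arc_def)
  have "inj_on (finv (wk s)) ?H" using W_eq_iff[OF W_inv[OF wk_W]] by (auto simp: inj_on_def)
  then have "finv (wk s) ` ?H = ?H" using endo_inj_surj[OF fin sub] by blast
  then have "wk s ` ?H = ?H" using W_finv_right[OF wk_W[of s]] by (metis (no_types, lifting) image_cong image_comp comp_apply image_ident)
  then have "proj (wk s) ` ?H = ?H" using optimal_half[OF wk_W optimal_nc_projection[OF wk_W] yc] by blast
  then have "- ?y \<in> ?H" using flips[of s] by (metis half_def image_eqI insertI1 order_refl)
  then show False
    using half_system_half[OF yc, of j] yc z_X neg_z_X unfolding half_system_def half_def by blast
qed

text \<open>\<open>s\<close> counts the flips, one step is the exit, and \<open>d\<close> remains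
  afterwards; the claim amounts to \<open>s + 1 + d \<le> 2 * m - 1\<close>.\<close>

lemma tr_centre_end:
  assumes y: "tr 0 (E j) \<in> {z, - z}"
  shows "tr (nat (2 * m - 1)) (E j) = E j"
proof -
  let ?F = "\<lambda>i. proj (wk i) (tr i (E j)) = - tr i (E j)"
  have "\<exists>i. \<not> ?F i" using not_flipping_long[OF y, of "nat (2 * m - 2)"] m_ge by auto
  define s where "s = (LEAST i. \<not> ?F i)"
  have ns: "\<not> ?F s" unfolding s_def using \<open>\<exists>i. \<not> ?F i\<close> by (rule LeastI_ex)
  have fl: "?F i" if "i < s" for i using that not_less_Least unfolding s_def by blast
  have s_le: "int s \<le> 2 * m - 2"
  proof (cases s)
    case (Suc r)
    then show ?thesis using not_flipping_long[OF y, of r] fl by auto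
  qed (use m_ge in simp)
  let ?y = "tr s (E j)"
  have yc: "?y \<in> {z, - z}" using tr_flipping(1)[OF refl y fl] by blast
  have "finv (wk s) (E j) = ?y" by (simp add: tr_def)
  from proj_centre[OF wk_W yc this] ns
  obtain d where d: "proj (wk s) ?y = E (j - d)" "0 \<le> d" "d < m" by metis
  \<comment> \<open>If this fails, the preimage of the exit point \<open>E (j - d)\<close> is less
    than \<open>m\<close> behind it. It lies in the half system starting at the exit point, so it
    equals that point. The projection then fixes \<open>E (j - d)\<close> and also sends the central
    point there.\<close>
  have bound: "int s + d \<le> 2 * m - 2"
  proof (rule ccontr)
    assume long: "\<not> int s + d \<le> 2 * m - 2"
    then have d0: "d > 0" using s_le by simp
    have "E (j - d) \<noteq> E j" using E_eq_imp_eq[of "j - d" j] d d0 m_ge by auto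
    moreover have "E (j - d) \<noteq> - E j"
      using E_eq_imp_eq[of "j - d" "j - m"] d m_ge by (auto simp: E_sub_m)
    ultimately obtain d' where d': "tr s (E (j - d)) = E (j - d - d')" "0 \<le> d'"
        "d' \<le> max 0 (2 * m - 1 - int s)"
      using tr_flipping(2)[OF refl y fl, of s "j - d"] by blast
    have d'd: "d' < m" using d' d long m_ge by simp
    let ?H = "half (j - d) ?y"
    have "proj (wk s) ` ?H = ?H" using NC_half_exit[OF projD(1)[OF wk_W] d(1) yc] .
    then have "wk s ` ?H = ?H" using proj_inv_imp(1)[OF wk_W consistent_half[OF yc]] by blast
    moreover have "wk s (E (j - d - d')) = E (j - d)"
      using d'(1) W_finv_right[OF wk_W, of s "E (j - d)"] by (simp add: tr_def)
    moreover have "E (j - d) \<in> ?H" using arcI[of "j - d" "j - d" "j - d + m"] m_ge by (simp add: half_def)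
    ultimately have "E (j - d - d') \<in> ?H" using W_mem_image_iff[OF wk_W] by metis
    then have "E (j - d - d') \<in> arc (j - d) (j - d + m)" using yc E_neq_z by (auto simp: half_def)
    then obtain k where k: "E (j - d - d') = E k" "j - d \<le> k" "k < j - d + m" by (auto simp: arc_def)
    then have "j - d - d' = k" using d' d'd by (intro E_eq_imp_eq) auto
    then have "d' = 0" using k d' by simp
    then have "wk s (E (j - d)) = E (j - d)" using \<open>wk s (E (j - d - d')) = E (j - d)\<close> by simp
    then have "proj (wk s) (E (j - d)) = proj (wk s) ?y" using proj_fixes[OF wk_W] d(1) by simp
    then have "E (j - d) = ?y" using W_eq_iff[OF projD(2)[OF wk_W]] by blast
    then show False using yc E_neq_z by (metis insertE singletonD)
  qed
  have "tr (Suc s) (E j) = E (j - d)" using d by (simp add: tr_Suc)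
  moreover have "nat (2 * m - 1) = Suc s + (nat (2 * m - 1) - Suc s)" "d \<le> int (nat (2 * m - 1) - Suc s)"
    using bound d m_ge by linarith+
  ultimately show ?thesis
    using tr_close_end[of "Suc s" j d "nat (2 * m - 1) - Suc s"] d by simp
qed

lemma funpow_pop_eq_id: "(pop ^^ nat (2 * m - 1)) w0 = id"
proof -
  have "tr (nat (2 * m - 1)) (E j) = E j" for j
  proof -
    have "tr 0 (E j) \<in> X" by (simp add: tr_X)
    then show ?thesis
    proof (cases rule: X_cases)
      case (circle k)
      \<comment> \<open>Distances are normalised to at most \<open>2 * m - 1\<close>, which is the
        exponent.\<close>
      obtain i where i: "E k = E i" "j - 2 * m + 1 \<le> i" "i < j - 2 * m + 1 + 2 * m"
        using E_normalize by blast
      then show ?thesis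
        using tr_circle_end[of 0 j "j - i" "nat (2 * m - 1)"] circle by simp
    next
      case centre
      then show ?thesis using tr_centre_end by blast
    qed
  qed
  then have "wk (nat (2 * m - 1)) (E j) = E j" for j
    unfolding tr_def using W_finv_right[OF wk_W] by metis
  then have "wk (nat (2 * m - 1)) = id" using fixes_circle_imp_id[OF wk_W] by blast
  then show ?thesis by (simp add: wk_def)
qed

end

text \<open>The image of the first point \<open>E p\<close> lies in the arc only if
  \<open>i > m\<close>, its preimage only if \<open>i < m\<close>.\<close>

lemma not_rotation_invariant:
  assumes u: "\<And>l. u (E l) = E (l - i)" and i: "0 < i" "i < 2 * m"
    and pq: "p < q" "q \<le> p + m" and inv: "u ` arc p q = arc p q"
  shows False
proof -
  have p: "E p \<in> arc p q" using pq by (simp add: arcI)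
  then have "E (p - i) \<in> arc p q" using inv u by (metis image_eqI)
  then obtain k where k: "E (p - i) = E k" "p \<le> k" "k < q" by (auto simp: arc_def)
  then have "E (p - i + 2 * m) = E k" by (simp add: E_add_2m)
  then have "p - i + 2 * m = k" using k i pq by (intro E_eq_imp_eq) auto
  then have "m < i" using k pq by simp
  have "E p \<in> u ` arc p q" using p inv by simp
  then obtain r where r: "E p = E (r - i)" "p \<le> r" "r < q" using u by (auto simp: arc_def)
  then have "p = r - i" using i pq by (intro E_eq_imp_eq) auto
  then show False using \<open>m < i\<close> r pq by simp
qed

text \<open>Any image of \<open>E l\<close> other than \<open>E (l + 1)\<close> would yield a
  nonempty arc of length at most \<open>m\<close> that the rotation \<open>u\<close>
  preserves.\<close>

lemma NC_above_rotation:
  assumes v: "v \<in> NCset" and uW: "u \<in> W" and vu: "fixspace v \<subseteq> fixspace u"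
    and u: "\<And>l. u (E l) = E (l - i)" and i: "0 < i" "i < 2 * m"
  shows "v = c"
proof -
  note inv = fixspace_mono_image[OF NCsetD(1)[OF v] uW vu]
  note rot = not_rotation_invariant[OF u i]
  have vE: "v (E l) = E (l + 1)" for l
  proof -
    have "v (E l) \<in> X" using W_X[OF NCsetD(1)[OF v]] by simp
    then show ?thesis
    proof (cases rule: X_cases)
      case (circle k)
      obtain j where j: "E k = E j" "l + 1 \<le> j" "j < l + 1 + 2 * m" using E_normalize by blast
      have vl: "v (E l) = E j" using circle j by simp
      have short: "j \<le> l + m + 1"
      proof (rule ccontr)
        assume long: "\<not> j \<le> l + m + 1"
        have "v ` arc j (l + 2 * m + 1) = arc j (l + 2 * m + 1)"
          using NC_arc_long[OF v vl] long j by simp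
        then have "u ` arc j (l + 2 * m + 1) = arc j (l + 2 * m + 1)"
          using long by (intro inv consistent_arc) auto
        then show False using rot[of j "l + 2 * m + 1"] long j by simp
      qed
      have "v ` arc (l + 1) j = arc (l + 1) j" using NC_arc_short[OF v vl] short j by simp
      then have "u ` arc (l + 1) j = arc (l + 1) j"
        using short by (intro inv consistent_arc) auto
      then have "\<not> l + 1 < j" using rot[of "l + 1" j] short by auto
      then show ?thesis using vl j by simp
    next
      case centre
      let ?y = "v (E l)" and ?p = "l - m + 1"
      have "v ` half ?p ?y = half ?p ?y" using NC_half_enter[OF v refl centre] .
      then have H: "u ` half ?p ?y = half ?p ?y" using inv consistent_half centre by blast
      have "u ` arc ?p (?p + m) \<subseteq> arc ?p (?p + m)"
      proof
        fix a assume "a \<in> u ` arc ?p (?p + m)"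
        then obtain k where k: "a = E (k - i)" "E k \<in> arc ?p (?p + m)" using u by (auto simp: arc_def)
        then have "a \<in> half ?p ?y" using H u[of k] unfolding half_def by (metis image_eqI insertI2)
        then show "a \<in> arc ?p (?p + m)" using k centre E_neq_z by (auto simp: half_def)
      qed
      moreover have "inj_on u (arc ?p (?p + m))" using W_eq_iff[OF uW] by (auto simp: inj_on_def)
      ultimately have "u ` arc ?p (?p + m) = arc ?p (?p + m)"
        by (intro endo_inj_surj) (auto simp: arc_def)
      then show ?thesis using rot[of ?p "?p + m"] m_ge by simp
    qed
  qed
  have "finv c (v (E l)) = E l" for l
    using vE c_E W_finv_left[OF c_W] by metis
  then have "finv c \<circ> v = id"
    using fixes_circle_imp_id[of "finv c \<circ> v"] W_comp W_inv c_W NCsetD(1)[OF v] by simp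
  then have "c (finv c (v x)) = c x" for x by (metis comp_apply id_apply)
  then show ?thesis using W_finv_right[OF c_W] by (simp add: fun_eq_iff)
qed

lemma funpow_finv_c: "(finv c ^^ r) (E l) = E (l - int r)"
proof (induction r)
  case (Suc r)
  have "finv c (E k) = E (k - 1)" for k
    using c_E[of "k - 1"] W_finv_left[OF c_W] by (metis diff_add_cancel)
  then show ?case using Suc by (simp add: algebra_simps)
qed simp

text \<open>Each of these powers before the last is a proper rotation, whose projection is
  \<open>c\<close>; so \<open>pop\<close> multiplies it by one more inverse of
  \<open>c\<close>.\<close>

lemma funpow_pop_c_inverse:
  assumes "int k < 2 * m"
  shows "(pop ^^ k) (finv c) = finv c ^^ (k + 1)"
  using assms
proof (induction k)
  case (Suc k)
  let ?u = "finv c ^^ (k + 1)"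
  have uW: "(finv c ^^ r) \<in> W" for r
  proof (induction r)
    case (Suc r)
    then show ?case using W_comp[OF W_inv[OF c_W], of "finv c ^^ r"] by (simp add: o_def)
  qed (use W_id in \<open>simp add: id_def\<close>)
  have "proj ?u = c"
    using NC_above_rotation[OF projD(1)[OF uW] uW projD(3)[OF uW] funpow_finv_c, of "k + 1"] Suc.prems
    by (simp del: funpow.simps)
  then have "pop ?u = ?u \<circ> finv c" using pop_eq[OF uW, of "k + 1"] by (simp only:)
  moreover have "(pop ^^ k) (finv c) = ?u" by (rule Suc.IH) (use Suc.prems in simp)
  then have "(pop ^^ Suc k) (finv c) = pop ?u" by (simp only: funpow.simps comp_apply)
  moreover have "finv c ^^ (Suc k + 1) = ?u \<circ> finv c"
    by (simp add: funpow_Suc_right del: funpow.simps)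
  ultimately show ?case by (simp only:)
qed simp

lemma max_orbit:
  "(\<forall>w\<in>W. (pop ^^ nat (2 * m - 1)) w = id) \<and>
   (MAX w\<in>W. card (forward_orbit pop w)) = nat (2 * m)"
proof
  let ?K = "nat (2 * m - 1)"
  show id: "\<forall>w\<in>W. (pop ^^ ?K) w = id" using funpow_pop_eq_id by blast
  have sub: "forward_orbit pop w \<subseteq> (\<lambda>k. (pop ^^ k) w) ` {..?K}" if w: "w \<in> W" for w
  proof
    fix x assume "x \<in> forward_orbit pop w"
    then obtain k where k: "x = (pop ^^ k) w" by (auto simp: forward_orbit_def)
    show "x \<in> (\<lambda>k. (pop ^^ k) w) ` {..?K}"
    proof (cases "k \<le> ?K")
      case False
      then have "x = (pop ^^ ?K) ((pop ^^ (k - ?K)) w)"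
        unfolding k by (simp add: funpow_add[symmetric, THEN fun_cong, unfolded comp_apply])
      then have "x = (pop ^^ ?K) w" using id w funpow_pop_W by simp
      then show ?thesis by auto
    qed (use k in auto)
  qed
  have le: "card (forward_orbit pop w) \<le> nat (2 * m)" if "w \<in> W" for w
  proof -
    have "card (forward_orbit pop w) \<le> card {..?K}"
      using card_mono[OF _ sub[OF that]] card_image_le[of "{..?K}" "\<lambda>k. (pop ^^ k) w"] by force
    then show ?thesis using m_ge by simp
  qed
  have ciW: "finv c \<in> W" using W_inv c_W by blast
  have "inj_on (\<lambda>k. (pop ^^ k) (finv c)) {..<nat (2 * m)}"
  proof (rule inj_onI)
    fix k l assume kl: "k \<in> {..<nat (2 * m)}" "l \<in> {..<nat (2 * m)}"
      and eq: "(pop ^^ k) (finv c) = (pop ^^ l) (finv c)"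
    have "finv c ^^ (k + 1) = finv c ^^ (l + 1)"
      using eq kl funpow_pop_c_inverse[of k] funpow_pop_c_inverse[of l] by simp
    then have "E (0 - int (k + 1)) = E (0 - int (l + 1))" using funpow_finv_c by metis
    then have "0 - int (k + 1) = 0 - int (l + 1)" using kl by (intro E_eq_imp_eq) auto
    then show "k = l" by simp
  qed
  then have "card ((\<lambda>k. (pop ^^ k) (finv c)) ` {..<nat (2 * m)}) = nat (2 * m)"
    by (simp add: card_image)
  moreover have "finite (forward_orbit pop (finv c))" using sub[OF ciW] finite_subset by blast
  ultimately have "nat (2 * m) \<le> card (forward_orbit pop (finv c))"
    using card_mono[of "forward_orbit pop (finv c)" "(\<lambda>k. (pop ^^ k) (finv c)) ` {..<nat (2 * m)}"]
    by (auto simp: forward_orbit_def)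
  then have ge: "card (forward_orbit pop (finv c)) = nat (2 * m)" using le[OF ciW] by simp
  show "(MAX w\<in>W. card (forward_orbit pop w)) = nat (2 * m)"
  proof (rule Max_eqI)
    have "(\<lambda>w. card (forward_orbit pop w)) ` W \<subseteq> {..nat (2 * m)}" using le by blast
    then show "finite ((\<lambda>w. card (forward_orbit pop w)) ` W)" by (rule finite_subset) simp
    show "nat (2 * m) \<in> (\<lambda>w. card (forward_orbit pop w)) ` W"
      using ge ciW by (intro image_eqI[where x = "finv c"]) auto
  qed (use le in blast)
qed

end

section \<open>Recognising Coxeter elements\<close>

lemma dvd_less_double:
  fixes m k :: nat
  assumes "m dvd k" "0 < k" "k < 2 * m"
  shows "k = m"
proof -
  obtain q where q: "k = m * q" using assms(1) by blast
  then have "q \<noteq> 0" using assms(2) by auto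
  moreover have "q < 2" using q assms(3) by (simp add: mult.commute[of m])
  ultimately have "q = 1" by simp
  then show ?thesis using q by simp
qed

context signed_basis
begin

text \<open>By counting, \<open>P\<close> and its negatives fill everything outside the pair of
  \<open>z\<close>.\<close>

lemma half_system_insert:
  assumes z: "z \<in> X" and P: "P \<subseteq> X - {z, - z}" and cons: "\<And>a. a \<in> P \<Longrightarrow> - a \<notin> P"
    and card: "card (X - {z, - z}) = 2 * card P"
  shows "half_system (insert z P)"
proof -
  have fin: "finite P" using P finite_X finite_subset by blast
  have "card (P \<union> uminus ` P) = card P + card (uminus ` P)"
    using fin cons by (intro card_Un_disjoint) auto
  also have "card (uminus ` P) = card P" by (rule card_image) (simp add: inj_on_def)
  finally have "card (P \<union> uminus ` P) = card (X - {z, - z})" using card by simp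
  moreover have "P \<union> uminus ` P \<subseteq> X - {z, - z}"
    using P neg_X by (auto simp: subset_iff)
  ultimately have eq: "P \<union> uminus ` P = X - {z, - z}"
    using finite_X by (intro card_subset_eq) auto
  show ?thesis unfolding half_system_def
  proof (intro conjI ballI)
    show "insert z P \<subseteq> X" using z P by auto
    fix a assume "a \<in> X"
    show "a \<in> insert z P \<longleftrightarrow> - a \<notin> insert z P"
    proof (cases "a \<in> {z, - z}")
      case True
      then show ?thesis using P X_nonzero[OF z] by auto
    next
      case False
      then have "a \<in> P \<or> - a \<in> P" 
      proof -
        have "a \<in> P \<union> uminus ` P" using False \<open>a \<in> X\<close> eq by blast
        then show ?thesis by auto
      qed
      moreover have "- a \<noteq> z" using False by auto
      ultimately show ?thesis using False cons[of a] cons[of "- a"] by auto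
    qed
  qed
qed

end

context D_group
begin

lemma funpow_W: "w \<in> W \<Longrightarrow> w ^^ k \<in> W"
proof (induction k)
  case (Suc k)
  then show ?case using W_comp[of w "w ^^ k"] by (simp add: o_def)
qed (use W_id in \<open>simp add: id_def\<close>)

text \<open>\<phi> pairs vectors with the eigenvector, so \<open>c\<close> acts on its values
  through one scalar. A power of \<open>c\<close> that fixes one vector with nonzero value therefore
  fixes all of them; order and parity determine the rest.\<close>

lemma ex_coxeter_labelling:
  assumes cW: "c \<in> W" and m: "3 \<le> m" and cardX: "card X = 2 * m + 2"
    and ord: "\<And>k. c ^^ k = id \<longleftrightarrow> 2 * m dvd k"
    and eig: "complex_eigenvector c \<mu> (x, y)"
    and reg: "\<And>b. b \<in> roots \<Longrightarrow> \<not> (x \<bullet> b = 0 \<and> y \<bullet> b = 0)"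
  shows "\<exists>E z. D_coxeter X W (int m) E z c"
proof -
  define \<phi> where "\<phi> a = Complex (a \<bullet> x) (a \<bullet> y)" for a
  note cneg = W_neg[OF cW]
  have ck: "c ^^ k \<in> W" for k using funpow_W[OF cW] .
  have ckX: "(c ^^ k) a \<in> X" if "a \<in> X" for k a using W_X[OF ck that] .
  have \<phi>c: "\<phi> a = \<mu> * \<phi> (c a)" for a
  proof -
    have "a \<bullet> x = c a \<bullet> c x" "a \<bullet> y = c a \<bullet> c y"
      using W_orth[OF cW] by (simp_all add: orthogonal_transformation_def)
    then show ?thesis
      using eig by (simp add: \<phi>_def complex_eigenvector_def complex_eq_iff inner_diff_right inner_add_right)
  qed
  have \<phi>ck: "\<phi> a = \<mu> ^ k * \<phi> ((c ^^ k) a)" for a k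
  proof (induction k)
    case (Suc k)
    then show ?case using \<phi>c[of "(c ^^ k) a"] by simp
  qed simp
  have \<phi>neg: "\<phi> (- a) = - \<phi> a" for a by (simp add: \<phi>_def complex_eq_iff)
  \<comment> \<open>No root is orthogonal to both \<open>x\<close> and \<open>y\<close>, so equal
    values force equality up to sign.\<close>
  have \<phi>inj: "b = a \<or> b = - a" if "a \<in> X" "b \<in> X" "\<phi> a = \<phi> b" for a b
  proof (rule ccontr)
    assume "\<not> (b = a \<or> b = - a)"
    then have "a - b \<in> roots" using that by (intro rootI) auto
    moreover have "x \<bullet> (a - b) = 0" "y \<bullet> (a - b) = 0"
      using that(3) by (simp_all add: \<phi>_def inner_diff_right inner_commute)
    ultimately show False using reg by blast
  qed
  define X0 where "X0 = {a \<in> X. \<phi> a \<noteq> 0}"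
  have \<phi>inj0: "a = b" if "a \<in> X0" "b \<in> X0" "\<phi> a = \<phi> b" for a b
    using \<phi>inj[of a b] that \<phi>neg by (auto simp: X0_def)
  have cX0: "(c ^^ k) a \<in> X0" if "a \<in> X0" for a k
    using that \<phi>ck[of a k] ckX by (auto simp: X0_def)
  have fix_all: "(c ^^ k) b = b" if "a \<in> X0" "b \<in> X0" "(c ^^ k) a = a" for a b k
  proof -
    have "\<mu> ^ k = 1" using \<phi>ck[of a k] that by (simp add: X0_def)
    then have "\<phi> b = \<phi> ((c ^^ k) b)" using \<phi>ck[of b k] by simp
    then show ?thesis using \<phi>inj0 cX0 that by metis
  qed
  have id_if: "c ^^ k = id" if "\<And>b. b \<in> X \<Longrightarrow> (c ^^ k) b = b" for k
    using linear_eq_on_X[OF W_linear[OF ck] linear_id] that by simp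
  have c2m: "(c ^^ (2 * m)) a = a" for a using ord[of "2 * m"] by simp
  have dist: "inj_on (\<lambda>k. (c ^^ k) a) {..<N}" if "\<And>k. 0 < k \<Longrightarrow> k < N \<Longrightarrow> (c ^^ k) a \<noteq> a" for a N
  proof -
    have *: "False" if "k < l" "l < N" "(c ^^ k) a = (c ^^ l) a" for k l
    proof -
      have "(c ^^ l) a = (c ^^ k) ((c ^^ (l - k)) a)"
        using funpow_add[of k "l - k" c] that by simp
      then have "(c ^^ (l - k)) a = a" using that(3) W_eq_iff[OF ck] by metis
      then show False using \<open>\<And>k. 0 < k \<Longrightarrow> k < N \<Longrightarrow> (c ^^ k) a \<noteq> a\<close>[of "l - k"] that by simp
    qed
    show ?thesis
      using *[of k l for k l] by (intro inj_onI) (metis lessThan_iff linorder_neqE_nat)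
  qed
  \<comment> \<open>If no value vanished, all orbits would have \<open>2 * m\<close> elements;
    \<open>X\<close> with \<open>2 * m + 2\<close> is too large for one orbit and too small for
    two.\<close>
  have "\<exists>z\<in>X. \<phi> z = 0"
  proof (rule ccontr)
    assume "\<not> ?thesis"
    then have X0: "X0 = X" by (auto simp: X0_def)
    have free: "2 * m dvd k" if "a \<in> X" "(c ^^ k) a = a" for a k
      using id_if[of k] fix_all[of a _ k] that X0 ord by metis
    have card_orbit: "card ((\<lambda>k. (c ^^ k) a) ` {..<2 * m}) = 2 * m" if "a \<in> X" for a
    proof -
      have "inj_on (\<lambda>k. (c ^^ k) a) {..<2 * m}"
        using free[OF that] by (intro dist) (auto dest: nat_dvd_not_less)
      then show ?thesis by (simp add: card_image)
    qed
    have "X \<noteq> {}" using cardX by auto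
    then obtain a where a: "a \<in> X" by blast
    let ?O = "\<lambda>a. (\<lambda>k. (c ^^ k) a) ` {..<2 * m}"
    have "\<not> X \<subseteq> ?O a" using card_orbit[OF a] cardX card_mono[of "?O a" X] by auto
    then obtain b where b: "b \<in> X" "b \<notin> ?O a" by blast
    have "?O a \<inter> ?O b = {}"
    proof (rule ccontr)
      assume "?O a \<inter> ?O b \<noteq> {}"
      then obtain d where d: "d \<in> ?O a" "d \<in> ?O b" by blast
      obtain l where l: "l < 2 * m" "d = (c ^^ l) a" using d(1) by blast
      obtain k where k: "k < 2 * m" "d = (c ^^ k) b" using d(2) by blast
      have kl: "k < 2 * m" "l < 2 * m" "(c ^^ k) b = (c ^^ l) a" using k l by simp_all
      have "b = (c ^^ (2 * m - k)) ((c ^^ k) b)"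
        using c2m[of b] funpow_add[of "2 * m - k" k c] kl by simp
      also have "\<dots> = (c ^^ (2 * m - k + l)) a" unfolding kl(3) by (simp add: funpow_add)
      also have "\<dots> = (c ^^ ((2 * m - k + l) mod (2 * m))) a" using funpow_mod_eq[of "2 * m" c a] c2m by metis
      finally show False using b m by auto
    qed
    then have "card (?O a \<union> ?O b) = 4 * m"
      using card_Un_disjoint[of "?O a" "?O b"] card_orbit a b by simp
    moreover have "?O a \<union> ?O b \<subseteq> X" using ckX a b by auto
    ultimately show False using card_mono[OF finite_X, of "?O a \<union> ?O b"] cardX m by simp
  qed
  then obtain z where z: "z \<in> X" "\<phi> z = 0" by blast
  have zero_iff: "\<phi> a = 0 \<longleftrightarrow> a \<in> {z, - z}" if "a \<in> X" for a
    using \<phi>inj[OF z(1) that] z \<phi>neg[of z] by auto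
  have X0: "X0 = X - {z, - z}" using zero_iff by (auto simp: X0_def)
  have zz: "- z \<in> X" "z \<noteq> - z" using z neg_X X_nonzero by auto
  have cardX0: "card X0 = 2 * m"
    unfolding X0 using cardX z zz finite_X by (simp add: card_Diff_subset)
  have "\<mu> \<noteq> 0"
  proof
    assume "\<mu> = 0"
    then have "\<phi> a = 0" for a using \<phi>c[of a] by simp
    then have "X0 = {}" by (auto simp: X0_def)
    then show False using cardX0 m by simp
  qed
  then have "\<phi> (c z) = 0" using \<phi>c[of z] z by simp
  then have cz: "c z \<in> {z, - z}" using zero_iff W_X[OF cW z(1)] by blast
  then have ccz: "c (c z) = z" using cneg by auto
  have czk: "(c ^^ (2 * k)) z = z" for k by (induction k) (simp_all add: ccz)
  have id_if0: "c ^^ k = id" if "a \<in> X0" "(c ^^ k) a = a" "(c ^^ k) z = z" for a k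
  proof (rule id_if)
    fix b assume "b \<in> X"
    then show "(c ^^ k) b = b"
      using fix_all[OF that(1) _ that(2), of b] that(3) X0 W_neg[OF ck, of k z] by (cases "b \<in> X0") auto
  qed
  \<comment> \<open>Even powers of \<open>c\<close> fix \<open>z\<close>, so twice the exponent
    gives the identity.\<close>
  have half_ord: "m dvd k" if "a \<in> X0" "(c ^^ k) a = a" for a k
  proof -
    have "(c ^^ (2 * k)) a = a" using that(2) by (simp add: mult_2 funpow_add)
    then have "2 * m dvd 2 * k" using id_if0[OF that(1) _ czk] ord by blast
    then show ?thesis by simp
  qed
  \<comment> \<open>With period \<open>m\<close>, the orbit of \<open>a\<close> and \<open>z\<close>
    would form a half system: \<open>- a\<close> on the orbit forces an even \<open>m\<close>, so
    that \<open>c ^^ m\<close> fixes \<open>z\<close>, against the order. Parity then gives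
    \<open>c z = z\<close>, the same contradiction.\<close>
  have not_m: "(c ^^ m) a \<noteq> a" if a: "a \<in> X0" for a
  proof
    assume fixm: "(c ^^ m) a = a"
    have mz: "(c ^^ m) z \<noteq> z"
      using id_if0[OF a fixm] ord[of m] m by (auto dest: nat_dvd_not_less)
    let ?P = "(\<lambda>k. (c ^^ k) a) ` {..<m}"
    have "inj_on (\<lambda>k. (c ^^ k) a) {..<m}"
      using half_ord[OF a] by (intro dist) (auto dest: nat_dvd_not_less)
    then have cardP: "card ?P = m" by (simp add: card_image)
    have noneg: "(c ^^ d) a \<noteq> - a" if "d < m" for d
    proof
      assume d: "(c ^^ d) a = - a"
      then have "(c ^^ (2 * d)) a = a" using W_neg[OF ck] by (simp add: mult_2 funpow_add)
      then have "m dvd 2 * d" using half_ord[OF a] by blast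
      moreover have "d \<noteq> 0" using d X_nonzero a X0 by (cases d) auto
      ultimately have "2 * d = m" using that by (intro dvd_less_double) auto
      then show False using mz czk by metis
    qed
    have "half_system (insert z ?P)"
    proof (rule half_system_insert[OF z(1)])
      show "?P \<subseteq> X - {z, - z}" using cX0[OF a] X0 by auto
      show "card (X - {z, - z}) = 2 * card ?P" using cardX0 cardP X0 by simp
      fix b assume "b \<in> ?P"
      then obtain k where k: "k < m" "b = (c ^^ k) a" by auto
      show "- b \<notin> ?P"
      proof
        assume "- b \<in> ?P"
        then obtain l where l: "l < m" "- (c ^^ k) a = (c ^^ l) a" using k by auto
        show False
        proof (cases "k \<le> l")
          case True
          then have "(c ^^ k) ((c ^^ (l - k)) a) = (c ^^ k) (- a)"
            using l(2) funpow_add[of k "l - k" c] W_neg[OF ck] by simp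
          then have "(c ^^ (l - k)) a = - a" using W_eq_iff[OF ck] by blast
          then show False using noneg[of "l - k"] l by simp
        next
          case False
          have "- (c ^^ l) ((c ^^ (k - l)) a) = (c ^^ l) a"
            using l(2) funpow_add[of l "k - l" c] False by simp
          then have "(c ^^ l) ((c ^^ (k - l)) a) = (c ^^ l) (- a)"
            using W_neg[OF ck] by (metis minus_minus)
          then have "(c ^^ (k - l)) a = - a" using W_eq_iff[OF ck] by blast
          then show False using noneg[of "k - l"] k by simp
        qed
      qed
    qed
    moreover have "c h \<in> insert z ?P" if h: "h \<in> insert z ?P" "h \<noteq> z" for h
    proof -
      obtain k where k: "k < m" "h = (c ^^ k) a" using h by auto
      show ?thesis
      proof (cases "Suc k = m")
        case True
        then have "c h = a" using k fixm by auto
        then show ?thesis using m by (auto intro!: image_eqI[of _ _ 0])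
      next
        case False
        then show ?thesis using k by (auto intro!: image_eqI[of _ _ "Suc k"])
      qed
    qed
    ultimately have czP: "c z \<in> insert z ?P" using half_system_rest[OF cW, of "insert z ?P" z] by blast
    have "- z \<notin> X0" using X0 by simp
    moreover have "?P \<subseteq> X0" using cX0[OF a] by blast
    ultimately have "- z \<notin> ?P" by blast
    then have "c z = z" using czP cz zz by auto
    then have "(c ^^ k) z = z" for k by (induction k) simp_all
    then show False using mz by blast
  qed
  have free: "2 * m dvd k" if a: "a \<in> X0" "(c ^^ k) a = a" for a k
  proof -
    obtain q where q: "k = m * q" using half_ord[OF a] by blast
    have "even q"
    proof (rule ccontr)
      assume "odd q"
      then obtain p where "q = 2 * p + 1" by (elim oddE)
      then have "k = m + (2 * m) * p" using q by (simp add: algebra_simps)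
      moreover have "(c ^^ ((2 * m) * p)) a = a" for p
        using ord[of "(2 * m) * p"] by simp
      ultimately have "(c ^^ k) a = (c ^^ m) a" by (simp add: funpow_add)
      then show False using not_m[OF a(1)] a(2) by simp
    qed
    then show ?thesis using q by (auto elim!: evenE)
  qed
  have "X0 \<noteq> {}" using cardX0 m by auto
  then obtain a where a: "a \<in> X0" by blast
  \<comment> \<open>Reducing the index modulo \<open>2 * m\<close> gives meaning to negative powers
    of \<open>c\<close>.\<close>
  define E where "E i = (c ^^ nat (i mod (2 * int m))) a" for i
  have E_nat: "E i = (c ^^ k) a" if "int k mod (2 * int m) = i mod (2 * int m)" for i k
  proof -
    have "nat (i mod (2 * int m)) = k mod (2 * m)"
      using that by (metis nat_int of_nat_mult of_nat_numeral zmod_int)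
    then show ?thesis using funpow_mod_eq[of "2 * m" c a k] c2m by (simp add: E_def)
  qed
  have E_ex: "\<exists>k < 2 * m. E i = (c ^^ k) a \<and> int k mod (2 * int m) = i mod (2 * int m)" for i
    using m by (intro exI[of _ "nat (i mod (2 * int m))"]) (auto simp: E_def nat_less_iff)
  have inj: "inj_on (\<lambda>k. (c ^^ k) a) {..<2 * m}"
    using free[OF a] by (intro dist) (auto dest: nat_dvd_not_less)
  have range_E: "range E = X0"
  proof -
    have "range E \<subseteq> (\<lambda>k. (c ^^ k) a) ` {..<2 * m}" using E_ex by (metis image_eqI image_subsetI lessThan_iff)
    moreover have "(\<lambda>k. (c ^^ k) a) ` {..<2 * m} \<subseteq> range E"
      using E_nat[of k "int k" for k] by (auto simp: image_iff) (metis)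
    moreover have "(\<lambda>k. (c ^^ k) a) ` {..<2 * m} = X0"
      using cX0[OF a] cardX0 inj finite_X by (intro card_subset_eq) (auto simp: card_image X0)
    ultimately show ?thesis by simp
  qed
  have cma: "(c ^^ m) a = - a"
  proof -
    have "- a \<in> X0" using a neg_X unfolding X0 by (auto simp: equation_minus_iff)
    then obtain k where k: "k < 2 * m" "- a = (c ^^ k) a" using range_E E_ex by (metis rangeE)
    then have "(c ^^ (2 * k)) a = a" using W_neg[OF ck] by (metis funpow_add comp_apply mult_2 minus_minus)
    then have "m dvd k" using free[OF a] by fastforce
    moreover have "k \<noteq> 0" using k(2) X_nonzero a X0 by (cases k) auto
    ultimately have "k = m" using k(1) by (intro dvd_less_double) auto
    then show ?thesis using k by simp
  qed
  have cE: "c (E i) = E (i + 1)" for i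
  proof -
    obtain k where k: "E i = (c ^^ k) a" "int k mod (2 * int m) = i mod (2 * int m)" using E_ex by blast
    then have "int (Suc k) mod (2 * int m) = (i + 1) mod (2 * int m)"
      by (metis add.commute mod_add_cong of_nat_Suc)
    then have "E (i + 1) = (c ^^ Suc k) a" using E_nat by blast
    then show ?thesis using k by simp
  qed
  have Em: "E (i + int m) = - E i" for i
  proof -
    obtain k where k: "E i = (c ^^ k) a" "int k mod (2 * int m) = i mod (2 * int m)" using E_ex by blast
    then have "int (k + m) mod (2 * int m) = (i + int m) mod (2 * int m)"
      by (metis mod_add_cong of_nat_add)
    then have "E (i + int m) = (c ^^ (k + m)) a" using E_nat by blast
    then show ?thesis using k cma W_neg[OF ck] by (simp add: funpow_add)
  qed
  have Einj: "2 * int m dvd i - j" if "E i = E j" for i j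
  proof -
    obtain k l where "k < 2 * m" "l < 2 * m" "E i = (c ^^ k) a" "E j = (c ^^ l) a"
        "int k mod (2 * int m) = i mod (2 * int m)" "int l mod (2 * int m) = j mod (2 * int m)"
      using E_ex by meson
    then have "i mod (2 * int m) = j mod (2 * int m)" using that inj by (metis inj_onD lessThan_iff)
    then show ?thesis by (simp add: mod_eq_dvd_iff)
  qed
  \<comment> \<open>If \<open>c\<close> fixed \<open>z\<close>, only \<open>E (m - 1)\<close> would
    leave the half system, an odd number.\<close>
  have cz': "c z = - z"
  proof (rule ccontr)
    assume "c z \<noteq> - z"
    then have cz1: "c z = z" using cz by auto
    let ?P = "E ` {0..<int m}"
    have injE: "inj_on E {0..<int m}"
    proof (rule inj_onI)
      fix i j assume "i \<in> {0..<int m}" "j \<in> {0..<int m}" "E i = E j"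
      then show "i = j" using Einj[of i j] zdvd_imp_le[of "2 * int m" "\<bar>i - j\<bar>"] by (cases "i = j") auto
    qed
    have noneg: "- E i \<noteq> E j" if "0 \<le> i" "i < int m" "0 \<le> j" "j < int m" for i j
    proof
      assume "- E i = E j"
      then have "2 * int m dvd i + int m - j" using Einj[of "i + int m" j] Em by simp
      then show False using zdvd_imp_le[of "2 * int m" "i + int m - j"] that by auto
    qed
    have hs: "half_system (insert z ?P)"
    proof (rule half_system_insert[OF z(1)])
      show "?P \<subseteq> X - {z, - z}" using range_E X0 by auto
      show "card (X - {z, - z}) = 2 * card ?P" using cardX0 injE X0 by (simp add: card_image)
    qed (use noneg in auto)
    let ?H = "insert z ?P"
    have "{h \<in> ?H. c h \<notin> ?H} = {E (int m - 1)}"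
    proof (intro equalityI subsetI)
      fix h assume h: "h \<in> {h \<in> ?H. c h \<notin> ?H}"
      then have "h \<noteq> z" using cz1 by auto
      then obtain i where i: "h = E i" "0 \<le> i" "i < int m" using h by auto
      then have "\<not> i + 1 < int m" using h cE by auto
      then show "h \<in> {E (int m - 1)}" using i by (auto simp: algebra_simps intro: arg_cong[of _ _ E])
    next
      fix h assume "h \<in> {E (int m - 1)}"
      moreover have "c (E (int m - 1)) = - E 0" using cE[of "int m - 1"] Em[of 0] by simp
      moreover have "- E 0 \<notin> ?P" using noneg[of 0] m by fastforce
      moreover have "- E 0 \<noteq> z" using range_E X0 Em[of 0] by (metis DiffE insertI1 rangeI)
      ultimately show "h \<in> {h \<in> ?H. c h \<notin> ?H}" using m by auto
    qed
    then show False using W_even[OF cW hs] by simp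
  qed
  have "D_coxeter X W (int m) E z c"
  proof unfold_locales
    show "X = range E \<union> {z, - z}" using range_E X0 z zz by auto
    show "z \<notin> range E" using range_E X0 by auto
  qed (use m Em Einj cW cE cz' in auto)
  then show ?thesis by blast
qed

end

section \<open>Coordinates for the root system\<close>

context signed_basis
begin

lemma root_reflection_X:
  assumes "a \<in> X" "b \<in> X" "b \<noteq> a" "b \<noteq> - a" "x \<in> X"
  shows "orthogonal_reflection (a - b) x =
    (if x = a then b else if x = b then a else if x = - a then - b else if x = - b then - a else x)"
proof -
  have ab: "a \<noteq> b" "a \<noteq> - b" "- a \<noteq> b" using assms(3,4) by auto
  have "a \<bullet> b = 0" "b \<bullet> a = 0" using assms orth_X by (auto simp: inner_commute)
  then have "(a - b) \<bullet> (a - b) = 2"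
    using unit_X assms by (simp add: inner_diff_left inner_diff_right)
  then have *: "orthogonal_reflection (a - b) x = x - (x \<bullet> a - x \<bullet> b) *\<^sub>R (a - b)"
    by (simp add: orthogonal_reflection_def inner_diff_right)
  show ?thesis
    unfolding * using assms ab X_nonzero[of a] X_nonzero[of b]
    by (auto simp: inner_X[of x a] inner_X[of x b] neg_X)
qed

definition even_perm :: "('a \<Rightarrow> 'a) \<Rightarrow> bool" where
  "even_perm w \<longleftrightarrow> orthogonal_transformation w \<and> (\<forall>a\<in>X. w a \<in> X) \<and>
     (\<forall>H. half_system H \<longrightarrow> even (card {h \<in> H. w h \<notin> H}))"

lemma even_perm_id: "even_perm id"
  by (auto simp: even_perm_def orthogonal_transformation_def linear_id)

text \<open>\<open>\<tau>\<close> is \<open>w\<close> with signs removed, a permutation of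
  \<open>H\<close>. The sign changes of the composite are the symmetric difference of those of
  \<open>w\<close> and those of \<open>v\<close> pulled back along \<open>\<tau>\<close>.\<close>

lemma even_perm_comp:
  assumes "even_perm v" "even_perm w"
  shows "even_perm (v \<circ> w)"
  unfolding even_perm_def
proof (intro conjI ballI allI impI)
  have orth: "orthogonal_transformation v" "orthogonal_transformation w"
    and vX: "\<And>a. a \<in> X \<Longrightarrow> v a \<in> X" and wX: "\<And>a. a \<in> X \<Longrightarrow> w a \<in> X"
    using assms by (auto simp: even_perm_def)
  show "orthogonal_transformation (v \<circ> w)" using orth by (rule orthogonal_transformation_compose)
  show "(v \<circ> w) a \<in> X" if "a \<in> X" for a using that vX wX by simp
  fix H assume H: "half_system H"
  then have HX: "H \<subseteq> X" and Hneg: "\<And>a. a \<in> X \<Longrightarrow> - a \<in> H \<longleftrightarrow> a \<notin> H"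
    by (auto simp: half_system_def)
  have fin: "finite H" using HX finite_X finite_subset by blast
  have neg: "v (- a) = - v a" "w (- a) = - w a" for a
    using orth orthogonal_transformation_linear linear_neg by blast+
  define \<tau> where "\<tau> h = (if w h \<in> H then w h else - w h)" for h
  have \<tau>H: "\<tau> h \<in> H" if "h \<in> H" for h using that Hneg[OF wX] HX by (auto simp: \<tau>_def)
  have "inj_on \<tau> H"
  proof (rule inj_onI)
    fix h h' assume h: "h \<in> H" "h' \<in> H" "\<tau> h = \<tau> h'"
    then have "w h = w h' \<or> w h = w (- h')" by (auto simp: \<tau>_def neg split: if_splits) (metis minus_minus)
    then have "h = h' \<or> h = - h'"
      using orthogonal_transformation_inj[OF orth(2)] by (auto dest: injD)
    then show "h = h'" using h Hneg[of h'] HX by auto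
  qed
  then have \<tau>bij: "bij_betw \<tau> H H"
    using endo_inj_surj[OF fin] \<tau>H by (auto simp: bij_betw_def)
  define A where "A = {h \<in> H. w h \<notin> H}"
  define B where "B = {h \<in> H. v (\<tau> h) \<notin> H}"
  have finAB: "finite A" "finite B" using fin by (auto simp: A_def B_def)
  have "\<tau> ` B = {h \<in> H. v h \<notin> H}"
    using \<tau>bij unfolding B_def bij_betw_def by (auto simp: image_iff)
  then have "bij_betw \<tau> B {h \<in> H. v h \<notin> H}"
    using \<open>inj_on \<tau> H\<close> by (auto simp: bij_betw_def B_def intro: inj_on_subset)
  then have evB: "even (card B)"
    using assms(1) H bij_betw_same_card unfolding even_perm_def by metis
  have evA: "even (card A)" using assms(2) H by (simp add: even_perm_def A_def)
  have "(v \<circ> w) h \<notin> H \<longleftrightarrow> (h \<in> A) \<noteq> (h \<in> B)" if "h \<in> H" for h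
  proof -
    have "w h \<in> X" using that HX wX by blast
    then have "v (- w h) \<in> H \<longleftrightarrow> v (w h) \<notin> H" using Hneg[OF vX] neg by simp
    then show ?thesis using that by (auto simp: A_def B_def \<tau>_def)
  qed
  then have "{h \<in> H. (v \<circ> w) h \<notin> H} = (A - B) \<union> (B - A)" by (auto simp: A_def B_def)
  moreover have "card ((A - B) \<union> (B - A)) + 2 * card (A \<inter> B) = card A + card B"
  proof -
    have "card ((A - B) \<union> (B - A)) = card (A - B) + card (B - A)"
      using finAB by (intro card_Un_disjoint) auto
    moreover have "card A = card (A - B) + card (A \<inter> B)" "card B = card (B - A) + card (A \<inter> B)"
      using finAB card_Int_Diff by (metis add.commute, metis add.commute Int_commute)
    ultimately show ?thesis by simp
  qed
  ultimately show "even (card {h \<in> H. (v \<circ> w) h \<notin> H})"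
    using evA evB by (metis dvd_triv_left even_add)
qed

text \<open>The reflection exchanges two axes: it changes no sign if \<open>H\<close> contains both
  or neither of \<open>a\<close> and \<open>b\<close>, and two signs otherwise.\<close>

lemma even_perm_root_reflection:
  assumes "r \<in> roots"
  shows "even_perm (orthogonal_reflection r)"
proof -
  obtain a b where ab: "a \<in> X" "b \<in> X" "b \<noteq> a" "b \<noteq> - a" "r = a - b"
    using assms by (auto simp: roots_def)
  note act = root_reflection_X[OF ab(1-4), folded ab(5)]
  show ?thesis unfolding even_perm_def
  proof (intro conjI ballI allI impI)
    show "orthogonal_reflection r x \<in> X" if "x \<in> X" for x
      using act[OF that] ab neg_X that by simp
    fix H assume H: "half_system H"
    then have HX: "H \<subseteq> X" and Hneg: "\<And>a. a \<in> X \<Longrightarrow> - a \<in> H \<longleftrightarrow> a \<notin> H"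
      by (auto simp: half_system_def)
    have ne: "a \<noteq> b" "a \<noteq> - b" "- a \<noteq> b" "- a \<noteq> - b" using ab by auto
    have "{h \<in> H. orthogonal_reflection r h \<notin> H} =
        (if a \<in> H \<longleftrightarrow> b \<in> H then {} else if a \<in> H then {a, - b} else {- a, b})"
      using Hneg[OF ab(1)] Hneg[OF ab(2)] HX by (auto simp: act subset_iff split: if_splits)
    then show "even (card {h \<in> H. orthogonal_reflection r h \<notin> H})" using ne by auto
  qed (rule orthogonal_transformation_reflection)
qed

end

section \<open>From simple roots to the group of even signed permutations\<close>

lemma group_general_linear_group: "group (general_linear_group :: ('a::euclidean_space \<Rightarrow> 'a) monoid)"
proof (rule groupI)
  fix x :: "'a \<Rightarrow> 'a" assume "x \<in> carrier general_linear_group"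
  then have x: "linear x" "bij x" by (auto simp: general_linear_group_def)
  then have "linear (finv x)" "bij (finv x)" "finv x \<circ> x = id"
    using inj_linear_imp_inv_linear bij_imp_bij_inv bij_is_inj inv_o_cancel by blast+
  then show "\<exists>y\<in>carrier general_linear_group.
      y \<otimes>\<^bsub>general_linear_group\<^esub> x = \<one>\<^bsub>general_linear_group\<^esub>"
    by (auto simp: general_linear_group_def)
qed (auto simp: general_linear_group_def linear_compose bij_comp o_assoc linear_id)

lemma inv_general_linear_group:
  assumes "w \<in> carrier (general_linear_group :: ('a::euclidean_space \<Rightarrow> 'a) monoid)"
  shows "inv\<^bsub>general_linear_group\<^esub> w = finv w"
proof -
  have w: "linear w" "bij w" using assms by (auto simp: general_linear_group_def)
  then have "linear (finv w)" "bij (finv w)" "finv w \<circ> w = id"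
    using inj_linear_imp_inv_linear bij_imp_bij_inv bij_is_inj inv_o_cancel by blast+
  then show ?thesis
    using assms group_general_linear_group
    by (intro group.inv_equality) (auto simp: general_linear_group_def)
qed

text \<open>The Gram matrix makes simple roots unit vectors, hence the factor
  \<open>1 / sqrt 2\<close> against the usual coordinates.\<close>

locale D_frame =
  fixes n :: nat and \<alpha> e :: "nat \<Rightarrow> 'a::euclidean_space"
  assumes n_ge: "n \<ge> 4"
    and span_\<alpha>: "span (\<alpha> ` {..<n}) = UNIV"
    and orthonormal: "i < n \<Longrightarrow> j < n \<Longrightarrow> e i \<bullet> e j = (if i = j then 1 else 0)"
    and \<alpha>_path: "Suc i < n \<Longrightarrow> \<alpha> i = (1 / sqrt 2) *\<^sub>R (e i - e (Suc i))"
    and \<alpha>_last: "\<alpha> (n - 1) = (1 / sqrt 2) *\<^sub>R (e (n - 2) + e (n - 1))"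
begin

definition X :: "'a set" where
  "X = e ` {..<n} \<union> (\<lambda>i. - e i) ` {..<n}"

lemma e_X: "i < n \<Longrightarrow> e i \<in> X" "i < n \<Longrightarrow> - e i \<in> X"
  by (auto simp: X_def)

lemma e_eq_iff: "i < n \<Longrightarrow> j < n \<Longrightarrow> e i = e j \<longleftrightarrow> i = j"
  using orthonormal[of i j] orthonormal[of i i] by (auto split: if_splits)

lemma e_neq_neg: "i < n \<Longrightarrow> j < n \<Longrightarrow> e i \<noteq> - e j" "i < n \<Longrightarrow> j < n \<Longrightarrow> - e i \<noteq> e j"
proof -
  have *: "e i \<noteq> - e j" if "i < n" "j < n" for i j
  proof
    assume "e i = - e j"
    then have "e i \<bullet> e j = - (e j \<bullet> e j)" by simp
    then show False using orthonormal[of i j] orthonormal[of j j] that by (auto split: if_splits)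
  qed
  show "i < n \<Longrightarrow> j < n \<Longrightarrow> e i \<noteq> - e j" by (rule *)
  show "i < n \<Longrightarrow> j < n \<Longrightarrow> - e i \<noteq> e j" using *[of j i] by metis
qed

lemma \<alpha>_in_span: "i < n \<Longrightarrow> \<alpha> i \<in> span X"
proof (cases "Suc i < n")
  case True
  then show ?thesis
    unfolding \<alpha>_path[OF True] using e_X by (intro span_scale span_diff span_base) auto
next
  case False
  assume "i < n"
  then have "i = n - 1" using False by simp
  moreover have "(1 / sqrt 2) *\<^sub>R (e (n - 2) + e (n - 1)) \<in> span X"
    using e_X n_ge by (intro span_scale span_add span_base) auto
  ultimately show ?thesis using \<alpha>_last by simp
qed

sublocale signed_basis X
proof
  show "span X = UNIV"
    using \<alpha>_in_span span_minimal[of "\<alpha> ` {..<n}" "span X"] span_\<alpha> by auto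
qed (auto simp: X_def orthonormal split: if_splits)

lemma e_half_system: "half_system (e ` {..<n})"
  unfolding half_system_def using e_neq_neg by (auto simp: X_def)

lemma card_X: "card X = 2 * n"
proof -
  have "inj_on e {..<n}" "inj_on (\<lambda>i. - e i) {..<n}" using e_eq_iff by (auto simp: inj_on_def)
  moreover have "e ` {..<n} \<inter> (\<lambda>i. - e i) ` {..<n} = {}" using e_neq_neg by auto
  ultimately show ?thesis by (simp add: X_def card_Un_disjoint card_image)
qed

definition W :: "('a \<Rightarrow> 'a) set" where
  "W = generate general_linear_group (simple_reflections n \<alpha>)"

lemma reflection_group_eq: "reflection_group n \<alpha> = \<lparr>carrier = W, monoid.mult = (\<circ>), one = id\<rparr>"
  by (simp add: reflection_group_def general_linear_group_def W_def)

lemma simple_root_is_root: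
  assumes "i < n"
  shows "\<exists>r\<in>roots. orthogonal_reflection (\<alpha> i) = orthogonal_reflection r"
proof (cases "Suc i < n")
  case True
  then have "e i - e (Suc i) \<in> roots" using e_X e_eq_iff e_neq_neg assms by (intro rootI) auto
  then show ?thesis using \<alpha>_path[OF True] orthogonal_reflection_scaleR[of "1 / sqrt 2"] by auto
next
  case False
  then have i: "i = n - 1" using assms by simp
  have "e (n - 2) - (- e (n - 1)) \<in> roots" using e_X e_eq_iff e_neq_neg n_ge by (intro rootI) auto
  then show ?thesis
    unfolding i \<alpha>_last using orthogonal_reflection_scaleR[of "1 / sqrt 2"] by auto
qed

lemma simple_reflections_GL: "simple_reflections n \<alpha> \<subseteq> carrier general_linear_group"
  using orthogonal_transformation_reflection orthogonal_transformation_bij orthogonal_transformation_linear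
  by (auto simp: simple_reflections_def general_linear_group_def)

lemma W_even_perm: "w \<in> W \<Longrightarrow> even_perm w"
  unfolding W_def
proof (induction rule: generate.induct)
  case one
  then show ?case using even_perm_id by (simp add: general_linear_group_def id_def)
next
  case (incl h)
  then show ?case
    using simple_root_is_root even_perm_root_reflection by (auto simp: simple_reflections_def) metis
next
  case (inv h)
  then have "inv\<^bsub>general_linear_group\<^esub> h = h"
    using inv_general_linear_group simple_reflections_GL finv_orthogonal_reflection
    by (metis (no_types, lifting) imageE simple_reflections_def subsetD)
  then show ?case
    using inv simple_root_is_root even_perm_root_reflection by (auto simp: simple_reflections_def) metis
next
  case (eng h1 h2)
  then show ?case using even_perm_comp[of h1 h2] by (simp add: general_linear_group_def o_def)
qed

lemma W_closed:
  shows "id \<in> W" and "v \<in> W \<Longrightarrow> w \<in> W \<Longrightarrow> v \<circ> w \<in> W" and "w \<in> W \<Longrightarrow> finv w \<in> W"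
proof -
  show "id \<in> W" using generate.one[of general_linear_group] by (simp add: W_def general_linear_group_def)
  show "v \<circ> w \<in> W" if "v \<in> W" "w \<in> W"
    using that generate.eng[of v general_linear_group] by (simp add: W_def general_linear_group_def)
  show "finv w \<in> W" if "w \<in> W"
  proof -
    have "w \<in> carrier general_linear_group"
      using that group.generate_in_carrier[OF group_general_linear_group simple_reflections_GL]
      by (simp add: W_def)
    then show ?thesis
      using that group.generate_m_inv_closed[OF group_general_linear_group simple_reflections_GL]
        inv_general_linear_group by (metis W_def)
  qed
qed

lemma group_W: "group (reflection_group n \<alpha>)"
  unfolding reflection_group_def
  using group.subgroup_imp_group[OF group_general_linear_group]
    group.generate_is_subgroup[OF group_general_linear_group simple_reflections_GL] by blast

lemma inv_W: "w \<in> W \<Longrightarrow> inv\<^bsub>reflection_group n \<alpha>\<^esub> w = finv w"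
proof -
  assume w: "w \<in> W"
  then have "bij w" using W_even_perm orthogonal_transformation_bij by (auto simp: even_perm_def)
  then show ?thesis
    using w W_closed group_W
    by (intro group.inv_equality) (auto simp: reflection_group_eq fun_eq_iff bij_is_inj)
qed

lemma simple_W: "i < n \<Longrightarrow> orthogonal_reflection (\<alpha> i) \<in> W"
  by (auto simp: W_def simple_reflections_def intro!: generate.incl)

abbreviation is_refl :: "'a \<Rightarrow> bool" where
  "is_refl b \<equiv> orthogonal_reflection b \<in> reflections n \<alpha>"

lemma reflections_eq:
  "reflections n \<alpha> = {orthogonal_reflection (w (\<alpha> i)) | w i. w \<in> W \<and> i < n}"
proof -
  have "w \<circ> orthogonal_reflection (\<alpha> i) \<circ> finv w = orthogonal_reflection (w (\<alpha> i))" if "w \<in> W" for w i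
  proof
    fix x
    have o: "orthogonal_transformation w" using that W_even_perm by (simp add: even_perm_def)
    then have "w (finv w x) = x" using orthogonal_transformation_surj surj_f_inv_f by metis
    then show "(w \<circ> orthogonal_reflection (\<alpha> i) \<circ> finv w) x = orthogonal_reflection (w (\<alpha> i)) x"
      using orthogonal_reflection_conj[OF o, of "\<alpha> i" "finv w x"] by simp
  qed
  then have conj: "w \<circ> orthogonal_reflection (\<alpha> i) \<circ> inv\<^bsub>reflection_group n \<alpha>\<^esub> w = orthogonal_reflection (w (\<alpha> i))"
    if "w \<in> W" for w i
    using that inv_W by simp
  have "reflections n \<alpha> = {w \<circ> orthogonal_reflection (\<alpha> i) \<circ> inv\<^bsub>reflection_group n \<alpha>\<^esub> w | w i. w \<in> W \<and> i < n}"
    unfolding reflections_def reflections_of_def simple_reflections_def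
    by (auto simp: reflection_group_eq)
  also have "\<dots> = {orthogonal_reflection (w (\<alpha> i)) | w i. w \<in> W \<and> i < n}"
    by (rule Collect_cong, rule ex_cong1, rule ex_cong1) (auto simp: conj)
  finally show ?thesis .
qed

lemma is_refl_conj:
  assumes "is_refl b" "w \<in> W"
  shows "is_refl (w b)"
proof -
  obtain u i where u: "u \<in> W" "i < n" "orthogonal_reflection b = orthogonal_reflection (u (\<alpha> i))"
    using assms(1) by (auto simp: reflections_eq)
  have o: "orthogonal_transformation w" using assms(2) W_even_perm by (simp add: even_perm_def)
  have "orthogonal_reflection (w b) = orthogonal_reflection (w (u (\<alpha> i)))"
  proof
    fix x
    obtain y where "x = w y" using orthogonal_transformation_surj[OF o] by (metis surjD)
    then show "orthogonal_reflection (w b) x = orthogonal_reflection (w (u (\<alpha> i))) x"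
      using orthogonal_reflection_conj[OF o] u(3) by metis
  qed
  then show ?thesis
    using u W_closed(2)[OF assms(2) u(1)] unfolding reflections_eq by (metis (mono_tags, lifting) comp_apply mem_Collect_eq)
qed

lemma is_refl_W: "is_refl b \<Longrightarrow> orthogonal_reflection b \<in> W"
proof -
  assume "is_refl b"
  then obtain w i where w: "w \<in> W" "i < n"
      "orthogonal_reflection b = w \<circ> orthogonal_reflection (\<alpha> i) \<circ> finv w"
    unfolding reflections_def reflections_of_def simple_reflections_def
    using inv_W by (auto simp: reflection_group_eq)
  then show ?thesis using W_closed simple_W by metis
qed

lemma is_refl_simple: "Suc i < n \<Longrightarrow> is_refl (e i - e (Suc i))"
    "is_refl (e (n - 2) + e (n - 1))"
proof -
  have \<alpha>: "is_refl (\<alpha> i)" if "i < n" for i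
    unfolding reflections_eq using that W_closed(1) by (metis (mono_tags, lifting) id_apply mem_Collect_eq)
  show "is_refl (e i - e (Suc i))" if "Suc i < n"
  proof -
    have "orthogonal_reflection (\<alpha> i) = orthogonal_reflection (e i - e (Suc i))"
      unfolding \<alpha>_path[OF that] by (rule orthogonal_reflection_scaleR) simp
    then show ?thesis using \<alpha>[of i] that by simp
  qed
  show "is_refl (e (n - 2) + e (n - 1))"
  proof -
    have "orthogonal_reflection (\<alpha> (n - 1)) = orthogonal_reflection (e (n - 2) + e (n - 1))"
      unfolding \<alpha>_last by (rule orthogonal_reflection_scaleR) simp
    then show ?thesis using \<alpha>[of "n - 1"] n_ge by simp
  qed
qed

lemma swap_e:
  assumes "i < n" "j < n" "k < n" "i \<noteq> j"
  shows "orthogonal_reflection (e i - e j) (e k) = (if k = i then e j else if k = j then e i else e k)"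
proof -
  have "e k \<noteq> - e i" "e k \<noteq> - e j" "e j \<noteq> - e i" "e j \<noteq> e i"
    using assms e_neq_neg e_eq_iff by auto
  then show ?thesis
    using root_reflection_X[of "e i" "e j" "e k"] assms e_X e_eq_iff by auto
qed

text \<open>Conjugation by the simple reflection exchanging \<open>e j\<close> and
  \<open>e (Suc j)\<close> lengthens the difference by one.\<close>

lemma is_refl_diff: "i < j \<Longrightarrow> j < n \<Longrightarrow> is_refl (e i - e j)"
proof (induction j)
  case (Suc j)
  show ?case
  proof (cases "i = j")
    case True
    then show ?thesis using is_refl_simple Suc by simp
  next
    case False
    then have ij: "i < j" using Suc by simp
    let ?s = "orthogonal_reflection (e j - e (Suc j))"
    have "?s (e i - e j) = e i - e (Suc j)"
      using swap_e[of j "Suc j"] ij Suc.prems by (simp add: linear_diff[OF orthogonal_reflection_linear])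
    moreover have "?s \<in> W" using is_refl_W is_refl_simple Suc.prems by blast
    ultimately show ?thesis using is_refl_conj[of "e i - e j" ?s] Suc ij by simp
  qed
qed simp

text \<open>Starting from the last simple root \<open>e (n - 2) + e (n - 1)\<close>, exchanges of
  coordinates move first one index to \<open>i\<close> and then the other to
  \<open>j\<close>.\<close>

lemma is_refl_sum: "i < j \<Longrightarrow> j < n \<Longrightarrow> is_refl (e i + e j)"
proof -
  have last: "is_refl (e i + e (n - 1))" if i: "i < n - 1" for i
  proof (cases "i = n - 2")
    case True
    then show ?thesis using is_refl_simple by simp
  next
    case False
    then have i': "i < n - 2" using i by simp
    have ne: "n - 1 \<noteq> n - 2" "n - 1 \<noteq> i" "n - 1 < n" "n - 2 < n" using i n_ge by auto
    let ?s = "orthogonal_reflection (e i - e (n - 2))"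
    have "?s (e (n - 2) + e (n - 1)) = e i + e (n - 1)"
      using swap_e[of i "n - 2" "n - 1"] swap_e[of i "n - 2" "n - 2"] i' ne by (simp add: linear_add[OF orthogonal_reflection_linear])
    moreover have "?s \<in> W" using is_refl_W is_refl_diff i' by auto
    ultimately show ?thesis using is_refl_conj[OF is_refl_simple(2), of ?s] by simp
  qed
  assume ij: "i < j" "j < n"
  show ?thesis
  proof (cases "j = n - 1")
    case True
    then show ?thesis using last ij by simp
  next
    case False
    then have j: "j < n - 1" using ij by simp
    let ?s = "orthogonal_reflection (e j - e (n - 1))"
    have "?s (e i + e (n - 1)) = e i + e j"
      using swap_e[of j "n - 1"] ij j by (simp add: linear_add[OF orthogonal_reflection_linear])
    moreover have "?s \<in> W" using is_refl_W is_refl_diff j by auto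
    ultimately show ?thesis using is_refl_conj[OF last[of i], of ?s] ij j by simp
  qed
qed

lemma is_refl_uminus: "is_refl (- b) \<longleftrightarrow> is_refl b"
  using orthogonal_reflection_scaleR[of "-1" b] by simp

lemma is_refl_root:
  assumes "b \<in> roots"
  shows "is_refl b"
proof -
  have diff: "is_refl (e i - e j)" if "i \<noteq> j" "i < n" "j < n" for i j
    using is_refl_diff[of i j] is_refl_diff[of j i] is_refl_uminus[of "e i - e j"] that
    by (cases "i < j") auto
  have sum: "is_refl (e i + e j)" if "i \<noteq> j" "i < n" "j < n" for i j
    using is_refl_sum[of i j] is_refl_sum[of j i] that by (cases "i < j") (auto simp: add.commute)
  have sum': "is_refl (- e i - e j)" if "i \<noteq> j" "i < n" "j < n" for i j
    using sum[OF that] is_refl_uminus[of "e i + e j"] by simp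
  have diff': "is_refl (- e i + e j)" if "i \<noteq> j" "i < n" "j < n" for i j
    using diff[of j i] that by simp
  obtain x y where xy: "x \<in> X" "y \<in> X" "y \<noteq> x" "y \<noteq> - x" "b = x - y"
    using assms by (auto simp: roots_def)
  obtain i where i: "i < n" "x = e i \<or> x = - e i" using xy(1) by (auto simp: X_def)
  obtain j where j: "j < n" "y = e j \<or> y = - e j" using xy(2) by (auto simp: X_def)
  have "i \<noteq> j" using i j xy(3,4) by auto
  then show ?thesis using i j xy(5) diff[of i j] sum[of i j] sum'[of i j] diff'[of i j] by auto
qed

sublocale D_group X W
proof
  show "\<exists>H. half_system H" using e_half_system by blast
qed (use W_closed W_even_perm is_refl_W is_refl_root in \<open>auto simp: even_perm_def\<close>)

lemma G_eq: "reflection_group n \<alpha> = G"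
  by (simp add: reflection_group_eq G_def)

lemma T_eq: "reflections n \<alpha> = T"
proof
  show "T \<subseteq> reflections n \<alpha>" using is_refl_root by (auto simp: T_def)
  show "reflections n \<alpha> \<subseteq> T"
  proof
    fix t assume "t \<in> reflections n \<alpha>"
    then obtain w i where w: "w \<in> W" "i < n" "t = orthogonal_reflection (w (\<alpha> i))"
      by (auto simp: reflections_eq)
    obtain r where r: "r \<in> roots" "orthogonal_reflection (\<alpha> i) = orthogonal_reflection r"
      using simple_root_is_root w by blast
    then obtain a b where ab: "a \<in> X" "b \<in> X" "b \<noteq> a" "b \<noteq> - a" "r = a - b" by (auto simp: roots_def)
    have "w r = w a - w b" using W_linear[OF w(1)] ab(5) by (simp add: linear_diff)
    moreover have "w b \<noteq> w a" "w b \<noteq> w (- a)" using W_eq_iff[OF w(1)] ab by auto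
    ultimately have wr: "w r \<in> roots"
      using ab W_X[OF w(1)] W_neg[OF w(1)] by (auto intro: rootI)
    have "t = orthogonal_reflection (w r)"
    proof
      fix x
      have "w (finv w x) = x" using w by simp
      then show "t x = orthogonal_reflection (w r) x"
        using orthogonal_reflection_conj[OF W_orth[OF w(1)]] r(2) w(3) by metis
    qed
    then show "t \<in> T" using wr by (auto simp: T_def)
  qed
qed

end

text \<open>The coordinate formulas for simple roots are solved for the basis: the half-sum and
  half-difference of the two fork ends, scaled by \<open>sqrt 2\<close>, give the last two vectors,
  and adding \<open>sqrt 2\<close> times \<open>\<alpha> i\<close> steps down the path.\<close>

lemma ex_D_frame:
  fixes \<alpha> :: "nat \<Rightarrow> 'a::euclidean_space"
  assumes n: "n \<ge> 4" and D: "D_simple_roots n \<alpha>"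
  shows "\<exists>e. D_frame n \<alpha> e"
proof -
  have gram: "\<alpha> i \<bullet> \<alpha> j = (if i = j then 1 else if D_edge n i j \<or> D_edge n j i then - 1 / 2 else 0)"
    if "i < n" "j < n" for i j
    using D that by (auto simp: D_simple_roots_def D_coxeter_matrix_def cos_60)
  define k where "k = n - 2"
  then have k: "n = k + 2" "k \<ge> 2" using n by auto
  define s :: real where "s = sqrt 2"
  have s: "s * s = 2" "s \<noteq> 0" "1 / s * s = 1" "s / 2 = 1 / s" "1 / s * (1 / s) = 1 / 2"
    by (auto simp: s_def field_simps)
  define f where "f i = (1 / s) *\<^sub>R (\<alpha> (k + 1) + \<alpha> k) + s *\<^sub>R (\<Sum>j\<in>{i..<k}. \<alpha> j)" for i
  define l where "l = (1 / s) *\<^sub>R (\<alpha> (k + 1) - \<alpha> k)"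
  have f_step: "f i = f (Suc i) + s *\<^sub>R \<alpha> i" if "i < k" for i
  proof -
    have "{i..<k} = insert i {Suc i..<k}" using that by auto
    then show ?thesis by (simp add: f_def scaleR_add_right)
  qed
  have fk: "f k = (1 / s) *\<^sub>R (\<alpha> (k + 1) + \<alpha> k)" by (simp add: f_def)
  have g1: "\<alpha> i \<bullet> \<alpha> k = (if Suc i = k then - 1 / 2 else 0)" "\<alpha> i \<bullet> \<alpha> (k + 1) = (if Suc i = k then - 1 / 2 else 0)"
    if "i < k" for i
    using that k gram[of i k] gram[of i "k + 1"] by (auto simp: D_edge_def)
  have g2: "\<alpha> i \<bullet> \<alpha> j = (if i = j then 1 else if Suc i = j \<or> Suc j = i then - 1 / 2 else 0)"
    if "i < k" "j < k" for i j
    using that k gram[of i j] by (auto simp: D_edge_def)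
  have g3: "\<alpha> k \<bullet> \<alpha> k = 1" "\<alpha> (k + 1) \<bullet> \<alpha> (k + 1) = 1" "\<alpha> k \<bullet> \<alpha> (k + 1) = 0" "\<alpha> (k + 1) \<bullet> \<alpha> k = 0"
    using k gram[of k k] gram[of "k + 1" "k + 1"] gram[of k "k + 1"] gram[of "k + 1" k]
    by (auto simp: D_edge_def)
  have \<alpha>l: "\<alpha> i \<bullet> l = 0" if "i < k" for i
    using g1[OF that] by (simp add: l_def inner_diff_right)
  have \<alpha>f: "\<alpha> i \<bullet> f j = (if i = j then 1 / s else if Suc i = j then - 1 / s else 0)" if "j \<le> k" "i < k" for i j
    using that
  proof (induction j rule: inc_induct)
    case base
    then show ?case using g1[of i] by (simp add: fk inner_add_right)
  next
    case (step j)
    have "\<alpha> i \<bullet> f j = \<alpha> i \<bullet> f (Suc j) + s * (\<alpha> i \<bullet> \<alpha> j)"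
      using f_step[of j] step by (simp add: inner_add_right)
    then show ?case using step g2[of i j] s by (auto simp: field_simps)
  qed
  have fl: "f i \<bullet> l = 0" if "i \<le> k" for i
    using that
  proof (induction i rule: inc_induct)
    case base
    then show ?case using g3 by (simp add: fk l_def inner_add_left inner_diff_right)
  next
    case (step i)
    then show ?case using f_step[of i] \<alpha>l[of i] by (simp add: inner_add_left)
  qed
  have ll: "l \<bullet> l = 1" using g3 s by (simp add: l_def inner_diff_left inner_diff_right field_simps)
  have sq: "(a + s *\<^sub>R b) \<bullet> (a + s *\<^sub>R b) = a \<bullet> a + 2 * s * (b \<bullet> a) + s * s * (b \<bullet> b)" for a b :: 'a
    by (simp add: inner_add_left inner_add_right inner_commute[of b a] distrib_left)
  have ff1: "f i \<bullet> f i = 1" if "i \<le> k" for i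
    using that
  proof (induction i rule: inc_induct)
    case base
    then show ?case using g3 s by (simp add: fk inner_add_left inner_add_right field_simps)
  next
    case (step i)
    \<comment> \<open>The last two terms are -2 and 2, so the norm is inherited.\<close>
    have "f i \<bullet> f i = f (Suc i) \<bullet> f (Suc i) + 2 * s * (\<alpha> i \<bullet> f (Suc i)) + s * s * (\<alpha> i \<bullet> \<alpha> i)"
      unfolding f_step[OF step(2)] by (rule sq)
    then show ?case using step \<alpha>f[of "Suc i" i] g2[of i i] s by (simp add: field_simps)
  qed
  have ff0: "f i \<bullet> f j = (if i = j then 1 else 0)" if "i \<le> j" "j \<le> k" for i j
    using that
  proof (induction i rule: inc_induct)
    case base
    then show ?case using ff1 by simp
  next
    case (step i)
    have "f i \<bullet> f j = f (Suc i) \<bullet> f j + s * (\<alpha> i \<bullet> f j)"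
      using f_step[of i] step by (simp add: inner_add_left)
    then show ?case using step \<alpha>f[of j i] s by auto
  qed
  define e where "e i = (if i = k + 1 then l else f i)" for i
  have "D_frame n \<alpha> e"
  proof
    show "n \<ge> 4" by fact
    show "span (\<alpha> ` {..<n}) = UNIV" using D by (simp add: D_simple_roots_def)
    show "e i \<bullet> e j = (if i = j then 1 else 0)" if ij: "i < n" "j < n" for i j
    proof -
      have "i \<le> k \<or> i = k + 1" "j \<le> k \<or> j = k + 1" using ij k by auto
      then show ?thesis
        using ll fl[of i] fl[of j] ff0[of i j] ff0[of j i]
        by (cases "i \<le> j") (auto simp: e_def inner_commute)
    qed
    show "\<alpha> i = (1 / sqrt 2) *\<^sub>R (e i - e (Suc i))" if "Suc i < n" for i
    proof (cases "i = k")
      case True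
      have "f k - l = (2 / s) *\<^sub>R \<alpha> k"
        by (simp add: fk l_def algebra_simps flip: scaleR_add_left)
      then show ?thesis using True s by (simp add: e_def s_def[symmetric] field_simps)
    next
      case False
      then have "i < k" using that k by simp
      then show ?thesis using f_step[of i] s by (simp add: e_def s_def[symmetric])
    qed
    show "\<alpha> (n - 1) = (1 / sqrt 2) *\<^sub>R (e (n - 2) + e (n - 1))"
    proof -
      have "f k + l = (2 / s) *\<^sub>R \<alpha> (k + 1)"
        by (simp add: fk l_def algebra_simps flip: scaleR_add_left)
      then show ?thesis using k s by (simp add: e_def s_def[symmetric] field_simps)
    qed
  qed
  then show ?thesis by blast
qed

theorem theorem6p1:
  fixes n :: nat and \<alpha> :: "nat \<Rightarrow> 'a::euclidean_space" and c :: "'a \<Rightarrow> 'a"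
  assumes "n \<ge> 4"
    and "D_simple_roots n \<alpha>"
    and "D_coxeter_element n \<alpha> c"
  shows "(\<forall>w \<in> carrier (reflection_group n \<alpha>).
            (Pop\<^sub>T n \<alpha> c ^^ (2 * n - 3)) w = \<one>\<^bsub>reflection_group n \<alpha>\<^esub>) \<and>
         (MAX w \<in> carrier (reflection_group n \<alpha>). card (forward_orbit (Pop\<^sub>T n \<alpha> c) w)) = 2 * n - 2"
proof -
  obtain e where "D_frame n \<alpha> e" using ex_D_frame assms by blast
  then interpret D_frame n \<alpha> e .
  have cW: "c \<in> W" and ord: "group.ord G c = 2 * n - 2" and reg: "regular_element T c"
    using assms(3) by (auto simp: D_coxeter_element_def D_coxeter_number_def G_eq T_eq carrier_G)
  have mon: "monoid G" using group.is_monoid[OF group_W] by (simp add: G_eq)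
  have pow: "c [^]\<^bsub>G\<^esub> k = c ^^ k" for k :: nat
  proof (induction k)
    case 0
    then show ?case using monoid.nat_pow_0[OF mon, of c] by (simp add: one_G id_def)
  next
    case (Suc k)
    then show ?case
      using monoid.nat_pow_Suc[OF mon, of c k]
      by (simp add: mult_G funpow_Suc_right del: funpow.simps)
  qed
  obtain \<mu> x y where eig: "complex_eigenvector c \<mu> (x, y)"
    and reg': "\<forall>t\<in>T. \<not> (t x = x \<and> t y = y)"
    using reg by (auto simp: regular_element_def)
  have "\<exists>E z. D_coxeter X W (int (n - 1)) E z c"
  proof (rule ex_coxeter_labelling[OF cW _ _ _ eig])
    show "3 \<le> n - 1" "card X = 2 * (n - 1) + 2" using assms(1) card_X by auto
    show "c ^^ k = id \<longleftrightarrow> 2 * (n - 1) dvd k" for k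
      using group.pow_eq_id[of G c k] group_W cW ord
      by (simp add: G_eq carrier_G one_G pow right_diff_distrib')
    show "\<not> (x \<bullet> b = 0 \<and> y \<bullet> b = 0)" if "b \<in> roots" for b
    proof -
      have "b \<noteq> 0" "orthogonal_reflection b \<in> T" using that roots_nonzero by (auto simp: T_def)
      then show ?thesis using reg' orthogonal_reflection_fixes_iff by blast
    qed
  qed
  then obtain E z where "D_coxeter X W (int (n - 1)) E z c" by blast
  then interpret C: D_coxeter X W "int (n - 1)" E z c .
  have "nat (2 * int (n - 1) - 1) = 2 * n - 3" "nat (2 * int (n - 1)) = 2 * n - 2"
    using assms(1) by auto
  then show ?thesis
    using C.max_orbit by (simp add: Pop\<^sub>T_def G_eq T_eq carrier_G one_G)
qed

end
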